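(* Let $\Lambda=(\pmb a;\lambda)$ be an $m$-partition. Then $$q^{|\pmb a|}t^{{\rm Inv}(\pmb a)}P_\Lambda(x;q^{-1},t^{-1})=t^{\binom m2}\,\tau_1\cdots\tau_m\,K_{\omega_m}\,\bar T_{\omega_m}P_\Lambda(x;q,t)$$ or, equivalently, $$q^{|\pmb a|}t^{{\rm Inv}(\pmb a)}P_\Lambda(x_mq^{-1},\dots,x_1q^{-1},x_{m+1},x_{m+2},\dots;q^{-1},t^{-1})=t^{\binom m2}\,\bar T_{\omega_m}P_\Lambda(x;q,t).$$
   Context: An $m$-partition is a pair $\Lambda=(\pmb a;\lambda)$ with $\pmb a=(a_1,\dots,a_m)\in\mathbb Z_{\ge0}^m$ and $\lambda$ a partition; $|\pmb a|=a_1+\cdots+a_m$ and ${\rm Inv}(\pmb a)=\#\{1\le i<j\le m\mid a_i<a_j\}$. Operators. $K_{i,j}$ exchanges $x_i$ and $x_j$, $\tau_i$ replaces $x_i$ by $qx_i$, and $T_i=t+\frac{tx_i-x_{i+1}}{x_i-x_{i+1}}(K_{i,i+1}-1)$. For a permutation $\sigma$ with reduced decomposition $s_{i_1}\cdots s_{i_r}$, $K_\sigma=K_{i_1,i_1+1}\cdots K_{i_r,i_r+1}$ and $T_\sigma=T_{i_1}\cdots T_{i_r}$. $\omega_m=[m,m-1,\dots,1]$ is the longest permutation of $S_m$ (acting on the indices $1,\dots,m$), and $\bar T_{\omega_m}=T_{\omega_m}^{-1}$. Non-symmetric Macdonald polynomials. In $N$ variables put $\omega=K_{N-1,N}\cdots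 K_{1,2}\tau_1$ and $Y_i=t^{-N+i}T_i\cdots T_{N-1}\,\omega\,T_1^{-1}\cdots T_{i-1}^{-1}$. For $\eta\in\mathbb Z_{\ge0}^N$, $E_\eta(x;q,t)$ is the unique polynomial over $\mathbb Q(q,t)$ of the form $x^\eta+\sum_{\nu\prec\eta}b_{\eta\nu}(q,t)x^\nu$ with $Y_iE_\eta=q^{\eta_i}t^{1-r_\eta(i)}E_\eta$ for $i=1,\dots,N$, where $r_\eta(i)=\#\{j:\eta_j>\eta_i\}+\#\{j\le i:\eta_j=\eta_i\}$. Here $\nu\prec\eta$ iff $\nu^+<\eta^+$ in dominance order, or $\nu^+=\eta^+$ and $w_\eta<w_\nu$ in Bruhat order, where $\eta^+$ is the decreasing rearrangement of $\eta$ and $w_\eta$ is the minimal length permutation with $\eta=w_\eta\eta^+$. $m$-symmetric Macdonald polynomials. For $N\ge m+\ell(\lambda)$ let $\eta_{\Lambda,N}=(a_1,\dots,a_m,\lambda_{N-m},\dots,\lambda_1)$ (with $\lambda_i=0$ for $i>\ell(\lambda)$) and $$P_\Lambda(x_1,\dots,x_N;q,t)=\frac1{u_{\Lambda,N}(t)}\sum_{\sigma}T_\sigma E_{\eta_{\Lambda,N}}(x_1,\dots,x_N;q,t),$$ the sum being over permutations $\sigma$ of $\{m+1,\dots,N\}$, and $u_{\Lambda,N}(t)=\bigl(\prod_{i\ge0}[n_\lambda(i)]_{t^{-1}}!\bigr)t^{(N-m)(N-m-1)/2}$ with $n_\lambda(i)$ the number of entries of $(\lambda_1,\dots,\lambda_{N-m})$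 equal to $i$ and $[k]_p!=\prod_{j=1}^k\frac{1-p^j}{1-p}$. For $m\le N<m+\ell(\lambda)$ put $P_\Lambda(x_1,\dots,x_N;q,t)=0$. These are stable (setting $x_N=0$, $N>m$, gives the polynomial in $N-1$ variables), and $P_\Lambda(x;q,t)$ is the resulting function in infinitely many variables $x=(x_1,x_2,\dots)$, of bounded degree and symmetric in $x_{m+1},x_{m+2},\dots$. $P_\Lambda(x;q^{-1},t^{-1})$ is obtained by substituting $q\mapsto q^{-1}$, $t\mapsto t^{-1}$ in the coefficients. *)

theory Defs
  imports
    "HOL-Computational_Algebra.Computational_Algebra"
    "HOL-Computational_Algebra.Field_as_Ring"
    "HOL-Combinatorics.Combinatorics"
    "HOL-Library.Poly_Mapping"
begin

section \<open>The coefficient field\<close>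

text \<open>
  The field of rational functions in $q$ and $t$ over the rationals: the inner polynomial variable
  is $q$, the outer one is $t$.
\<close>

type_synonym coef = "rat poly poly fract"

definition qq :: coef where
  "qq = to_fract [:[:0, 1:]:]"

definition tt :: coef where
  "tt = to_fract [:0, 1:]"

text \<open>Evaluation of a polynomial in $q$ and $t$ at $(q^{-1}, t^{-1})$.\<close>

definition eval_inv :: "rat poly poly \<Rightarrow> coef" where
  "eval_inv p =
     poly (map_poly (\<lambda>c. poly (map_poly (\<lambda>r. to_fract [:[:r:]:]) c) (inverse qq)) p) (inverse tt)"

text \<open>The substitution of $(q^{-1}, t^{-1})$ for $(q, t)$ in a rational function.\<close>

definition bar_coef :: "coef \<Rightarrow> coef" where
  "bar_coef c = eval_inv (fst (quot_of_fract c)) / eval_inv (snd (quot_of_fract c))"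


section \<open>Polynomials and functions in infinitely many variables\<close>

text \<open>
  A monomial is its exponent vector, the variables being $x_1, x_2, \dots$ (the index $0$ never
  occurs in the polynomials constructed below). A polynomial, or more generally a
  formal power series, is given by its coefficient function; the polynomials are the series
  of finite support. In this way the same operators act on the polynomials in
  $x_1, \dots, x_N$ and on the functions in infinitely many variables.
\<close>

type_synonym mono = "nat \<Rightarrow>\<^sub>0 nat"

type_synonym series = "mono \<Rightarrow> coef"

definition scale :: "coef \<Rightarrow> series \<Rightarrow> series" where
  "scale c f = (\<lambda>\<mu>. c * f \<mu>)"

definition mult_var :: "nat \<Rightarrow> series \<Rightarrow> series" where
  "mult_var i f =
     (\<lambda>\<mu>. if Poly_Mapping.lookup \<mu> i = 0 then 0 else f (\<mu> - Poly_Mapping.single i 1))"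

definition bar :: "series \<Rightarrow> series" where
  "bar f = (\<lambda>\<mu>. bar_coef (f \<mu>))"

text \<open>The exponent vector \<open>(\<mu>\<^bsub>\<sigma> 1\<^esub>, \<mu>\<^bsub>\<sigma> 2\<^esub>, \<dots>)\<close>.\<close>

definition permute_mono :: "(nat \<Rightarrow> nat) \<Rightarrow> mono \<Rightarrow> mono" where
  "permute_mono \<sigma> \<mu> = Poly_Mapping.map_key \<sigma> \<mu>"


section \<open>Operators\<close>

definition compose_list :: "('a \<Rightarrow> 'a) list \<Rightarrow> 'a \<Rightarrow> 'a" where
  "compose_list fs = foldr (\<circ>) fs id"

definition K_op :: "nat \<Rightarrow> nat \<Rightarrow> series \<Rightarrow> series" where
  "K_op i j f = (\<lambda>\<mu>. f (permute_mono (transpose i j) \<mu>))"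

definition tau_op :: "nat \<Rightarrow> series \<Rightarrow> series" where
  "tau_op i f = (\<lambda>\<mu>. qq ^ Poly_Mapping.lookup \<mu> i * f \<mu>)"

text \<open>
  The quotient of a series by $x_i - x_{i+1}$. Multiplication by $x_i - x_{i+1}$ is injective on
  formal power series, and every series antisymmetric in $x_i, x_{i+1}$ is divisible.
\<close>

definition div_diff :: "nat \<Rightarrow> series \<Rightarrow> series" where
  "div_diff i f = (THE g. \<forall>\<mu>. mult_var i g \<mu> - mult_var (Suc i) g \<mu> = f \<mu>)"

definition T_op :: "nat \<Rightarrow> series \<Rightarrow> series" where
  "T_op i f =
     (let g = div_diff i (\<lambda>\<mu>. K_op i (Suc i) f \<mu> - f \<mu>)
      in (\<lambda>\<mu>. tt * f \<mu> + (tt * mult_var i g \<mu> - mult_var (Suc i) g \<mu>)))"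


section \<open>Permutations and reduced decompositions\<close>

definition word_perm :: "nat list \<Rightarrow> nat \<Rightarrow> nat" where
  "word_perm ws = compose_list (map (\<lambda>i. transpose i (Suc i)) ws)"

definition reduced_word :: "(nat \<Rightarrow> nat) \<Rightarrow> nat list \<Rightarrow> bool" where
  "reduced_word \<sigma> ws \<longleftrightarrow>
     word_perm ws = \<sigma> \<and> (\<forall>vs. word_perm vs = \<sigma> \<longrightarrow> length ws \<le> length vs)"

definition some_reduced_word :: "(nat \<Rightarrow> nat) \<Rightarrow> nat list" where
  "some_reduced_word \<sigma> = (SOME ws. reduced_word \<sigma> ws)"

definition perm_length :: "(nat \<Rightarrow> nat) \<Rightarrow> nat" where
  "perm_length \<sigma> = length (some_reduced_word \<sigma>)"

text \<open>
  These two operators do not depend on the reduced decomposition, by the braid relations.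
\<close>

definition K_perm :: "(nat \<Rightarrow> nat) \<Rightarrow> series \<Rightarrow> series" where
  "K_perm \<sigma> = compose_list (map (\<lambda>i. K_op i (Suc i)) (some_reduced_word \<sigma>))"

definition T_perm :: "(nat \<Rightarrow> nat) \<Rightarrow> series \<Rightarrow> series" where
  "T_perm \<sigma> = compose_list (map T_op (some_reduced_word \<sigma>))"

definition longest_perm :: "nat \<Rightarrow> nat \<Rightarrow> nat" where
  "longest_perm m i = (if i \<in> {1..m} then m + 1 - i else i)"

definition bruhat_less :: "nat \<Rightarrow> (nat \<Rightarrow> nat) \<Rightarrow> (nat \<Rightarrow> nat) \<Rightarrow> bool" where
  "bruhat_less N =
     (\<lambda>u w. \<exists>a\<in>{1..N}. \<exists>b\<in>{1..N}. w = u \<circ> transpose a b \<and> perm_length u < perm_length w)\<^sup>+\<^sup>+"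


section \<open>Non-symmetric Macdonald polynomials\<close>

text \<open>A composition with $N$ parts is an exponent vector supported in $\{1, \dots, N\}$.\<close>

definition compositions :: "nat \<Rightarrow> mono set" where
  "compositions N = {\<eta>. Poly_Mapping.keys \<eta> \<subseteq> {1..N}}"

definition decreasing :: "nat \<Rightarrow> mono \<Rightarrow> nat list" where
  "decreasing N \<eta> = rev (sort (map (Poly_Mapping.lookup \<eta>) [1..<Suc N]))"

definition dominance_less :: "nat list \<Rightarrow> nat list \<Rightarrow> bool" where
  "dominance_less xs ys \<longleftrightarrow>
     xs \<noteq> ys \<and> sum_list xs = sum_list ys \<and> (\<forall>k. sum_list (take k xs) \<le> sum_list (take k ys))"

text \<open>
  A permutation \<open>w\<close> moves the entry in position \<open>i\<close> to position \<open>w i\<close>; the list of entries of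
  \<open>\<eta>\<^sup>+\<close> is indexed from 0.
\<close>

definition min_perm :: "nat \<Rightarrow> mono \<Rightarrow> nat \<Rightarrow> nat" where
  "min_perm N \<eta> =
     (ARG_MIN perm_length w. w permutes {1..N} \<and>
        (\<forall>i\<in>{1..N}. Poly_Mapping.lookup \<eta> (w i) = decreasing N \<eta> ! (i - 1)))"

definition comp_less :: "nat \<Rightarrow> mono \<Rightarrow> mono \<Rightarrow> bool" where
  "comp_less N \<nu> \<eta> \<longleftrightarrow>
     dominance_less (decreasing N \<nu>) (decreasing N \<eta>) \<or>
     (decreasing N \<nu> = decreasing N \<eta> \<and> bruhat_less N (min_perm N \<eta>) (min_perm N \<nu>))"

definition omega_op :: "nat \<Rightarrow> series \<Rightarrow> series" where
  "omega_op N = compose_list (map (\<lambda>i. K_op i (Suc i)) (rev [1..<N])) \<circ> tau_op 1"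

definition Y_op :: "nat \<Rightarrow> nat \<Rightarrow> series \<Rightarrow> series" where
  "Y_op N i = scale (tt powi (int i - int N)) \<circ> compose_list (map T_op [i..<N]) \<circ> omega_op N \<circ>
     compose_list (map (\<lambda>j. inv (T_op j)) [1..<i])"

definition comp_rank :: "nat \<Rightarrow> mono \<Rightarrow> nat \<Rightarrow> nat" where
  "comp_rank N \<eta> i =
     card {j \<in> {1..N}. Poly_Mapping.lookup \<eta> j > Poly_Mapping.lookup \<eta> i} +
     card {j \<in> {1..i}. Poly_Mapping.lookup \<eta> j = Poly_Mapping.lookup \<eta> i}"

definition nonsym_macdonald :: "nat \<Rightarrow> mono \<Rightarrow> series" where
  "nonsym_macdonald N \<eta> =
     (THE E. finite {\<nu>. E \<nu> \<noteq> 0} \<and> E \<eta> = 1 \<and>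
        (\<forall>\<nu>. \<nu> \<noteq> \<eta> \<and> E \<nu> \<noteq> 0 \<longrightarrow> \<nu> \<in> compositions N \<and> comp_less N \<nu> \<eta>) \<and>
        (\<forall>i\<in>{1..N}. Y_op N i E =
           scale (qq ^ Poly_Mapping.lookup \<eta> i * tt powi (1 - int (comp_rank N \<eta> i))) E))"


section \<open>The m-symmetric Macdonald polynomials\<close>

definition is_partition :: "nat list \<Rightarrow> bool" where
  "is_partition lam \<longleftrightarrow> sorted_wrt (\<ge>) lam \<and> 0 \<notin> set lam"

definition inversions :: "nat list \<Rightarrow> nat" where
  "inversions a = card {(i, j). i < j \<and> j < length a \<and> a ! i < a ! j}"

text \<open>The list $(\lambda_1, \dots, \lambda_{N-m})$.\<close>

definition padded :: "nat \<Rightarrow> nat list \<Rightarrow> nat list" where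
  "padded k lam = lam @ replicate (k - length lam) 0"

text \<open>
  \<open>Poly_Mapping.nth\<close> numbers the entries of a list from 0, whence the entry 0 in front.
\<close>

definition eta_comp :: "nat \<Rightarrow> nat list \<Rightarrow> nat list \<Rightarrow> mono" where
  "eta_comp N a lam = Poly_Mapping.nth (0 # a @ rev (padded (N - length a) lam))"

definition t_fact :: "coef \<Rightarrow> nat \<Rightarrow> coef" where
  "t_fact p k = (\<Prod>j=1..k. (1 - p ^ j) / (1 - p))"

text \<open>
  In the product over all \<open>i \<ge> 0\<close> the factors for \<open>i\<close> not in the list are equal to 1.
\<close>

definition u_norm :: "nat \<Rightarrow> nat \<Rightarrow> nat list \<Rightarrow> coef" where
  "u_norm N m lam =
     (\<Prod>i\<in>set (padded (N - m) lam). t_fact (inverse tt) (count_list (padded (N - m) lam) i)) *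
     tt ^ ((N - m) * (N - m - 1) div 2)"

definition m_macdonald_fin :: "nat \<Rightarrow> nat list \<Rightarrow> nat list \<Rightarrow> series" where
  "m_macdonald_fin N a lam =
     (if length a + length lam \<le> N
      then (\<lambda>\<mu>. (\<Sum>\<sigma> | \<sigma> permutes {length a + 1..N}.
               T_perm \<sigma> (nonsym_macdonald N (eta_comp N a lam)) \<mu>) / u_norm N (length a) lam)
      else (\<lambda>\<mu>. 0))"

text \<open>
  The function in infinitely many variables: by stability, the coefficient of a monomial is the
  same in all the polynomials in $N \ge m$ variables such that the monomial only involves
  $x_1, \dots, x_N$; it is read off for the smallest such $N$.
\<close>

definition m_macdonald :: "nat list \<Rightarrow> nat list \<Rightarrow> series" where
  "m_macdonald a lam =
     (\<lambda>\<mu>. m_macdonald_fin (Max (insert (length a) (Poly_Mapping.keys \<mu>))) a lam \<mu>)"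

text \<open>
  The substitution $f(x_m q^{-1}, \dots, x_1 q^{-1}, x_{m+1}, x_{m+2}, \dots)$.
\<close>

definition subst_rev :: "nat \<Rightarrow> series \<Rightarrow> series" where
  "subst_rev m f =
     (\<lambda>\<mu>. inverse qq ^ (\<Sum>i=1..m. Poly_Mapping.lookup \<mu> i) * f (permute_mono (longest_perm m) \<mu>))"

end

theory Submission
  imports Defs
begin

text \<open>
  Put \<open>B = K\<^bsub>w\<^esub> T\<^bsub>w\<^esub>\<^bsup>-1\<^esup>\<close> for the longest permutation \<open>w\<close> of the \<open>N\<close> indices. Conjugation by the bar
  involution turns \<open>T\<^sub>i\<close> into \<open>K\<^sub>i T\<^sub>i\<^bsup>-1\<^esup> K\<^sub>i\<close>, hence intertwines through \<open>B\<close> with \<open>T\<^sub>i\<^bsup>-1\<^esup>\<close>. The non-symmetric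
  Macdonald polynomials are generated from \<open>1\<close> by the intertwiners \<open>T\<^sub>i + z\<close> and by \<open>x\<^sub>N \<omega>\<close>, and along
  this recursion the bar involution agrees with \<open>B\<close> up to an explicit power of \<open>t\<close>. The recursion
  only produces joint eigenvectors of the \<open>Y\<^sub>i\<close>; the required shape follows, since \<open>Y\<^sub>i\<close> is a product of
  triangular operators and the joint eigenvalues separate compositions, so that a maximal monomial
  of an eigenvector is determined by its eigenvalues.

  Symmetrization over the last \<open>N - m\<close> indices only changes the power of \<open>t\<close>. Finally the eigenvalue
  equations for \<open>Y\<^sub>1, \<dots>, Y\<^sub>m\<close> turn \<open>T\<^bsub>w\<^esub>\<^bsup>-1\<^esup>\<close> into \<open>\<omega>\<^bsup>m\<^esup>\<close> times the inverse of \<open>T\<close> at the longest permutation of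
  the first \<open>m\<close> indices, and \<open>K\<^bsub>w\<^esub> \<omega>\<^bsup>m\<^esup>\<close> is \<open>\<tau>\<^sub>1 \<cdots> \<tau>\<^sub>m\<close> followed by permutations. All operators on
  \<open>x\<^sub>1, \<dots>, x\<^sub>m\<close> preserve the set of the monomials whose coefficients are read off in the same number
  of variables, so stability plays no role.
\<close>

section \<open>The coefficient field\<close>

text \<open>Almost all of the work takes place in \<open>mpol\<close>, the polynomials as a ring
  without zero divisors: there an identity for \<open>T_i\<close> may be checked after
  multiplication by \<open>x_i - x_(i+1)\<close>, so that no division remains. Series of infinite
  support are reached only at the end, by truncation to finite sets of monomials.

  The exponent of \<open>t\<close> relating the bar involution to \<open>B\<close> is forced at the
  start and then followed. On the constant polynomial every \<open>T_i\<close> acts as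
  \<open>t\<close>, whence \<open>N choose 2\<close>. An intertwiner removes one pair of positions
  with ascending entries, and a raising step changes the number of such pairs by an amount that the
  first eigenvalue, used twice, exactly provides. Restricted to the first \<open>m\<close> positions
  this statistic survives as \<open>Inv(a)\<close>.

  The dependence on \<open>N\<close> must disappear. Ascending pairs between the two blocks of
  positions cancel against the eigenvalues of \<open>Y_1, ..., Y_m\<close>. What remains of the last
  \<open>N - m\<close> positions is the number of their equal pairs and a power of \<open>t\<close>
  depending on \<open>N - m\<close>, and this is what barring \<open>u_norm\<close>
  produces.\<close>

lemma poly_map_poly_pCons:
  assumes "h 0 = 0"
  shows "poly (map_poly h (pCons a p)) x = h a + x * poly (map_poly h p) x"
  using assms by (cases "a = 0 \<and> p = 0") (auto simp: map_poly_pCons)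

lemma poly_map_poly_add:
  fixes h :: "'a::comm_ring_1 \<Rightarrow> 'b::comm_ring_1"
  assumes "h 0 = 0" "\<And>a b. h (a + b) = h a + h b"
  shows "poly (map_poly h (p + r)) x = poly (map_poly h p) x + poly (map_poly h r) x"
  by (induction p r rule: poly_induct2)
    (simp_all add: poly_map_poly_pCons assms algebra_simps del: map_poly_pCons)

lemma poly_map_poly_mult:
  fixes h :: "'a::comm_ring_1 \<Rightarrow> 'b::comm_ring_1"
  assumes "h 0 = 0" "\<And>a b. h (a + b) = h a + h b" "\<And>a b. h (a * b) = h a * h b"
  shows "poly (map_poly h (p * r)) x = poly (map_poly h p) x * poly (map_poly h r) x"
proof (induction p)
  case (pCons a p)
  have "poly (map_poly h (smult a r)) x = h a * poly (map_poly h r) x"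
    by (induction r) (simp_all add: poly_map_poly_pCons assms algebra_simps del: map_poly_pCons)
  then show ?case
    using pCons by (simp add: poly_map_poly_pCons poly_map_poly_add assms algebra_simps
        del: map_poly_pCons)
qed simp

lemma poly_map_poly_altdef:
  fixes h :: "'a::comm_ring_1 \<Rightarrow> 'b::comm_ring_1"
  assumes "h 0 = 0" "degree p \<le> n"
  shows "poly (map_poly h p) x = (\<Sum>k\<le>n. h (coeff p k) * x ^ k)"
proof -
  have "poly (map_poly h p) x = (\<Sum>k\<le>n. coeff (map_poly h p) k * x ^ k)"
    unfolding poly_altdef using assms map_poly_degree_leq[of h p]
    by (intro sum.mono_neutral_left) (auto simp: coeff_eq_0)
  then show ?thesis
    using assms by (simp add: coeff_map_poly)
qed

text \<open>The evaluation in \<open>q\<close> alone. Split off, it makes both levels of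
  \<open>eval_inv\<close> instances of the same lemmas on evaluating along a ring
  homomorphism.\<close>

definition eval_inv_q :: "rat poly \<Rightarrow> coef" where
  "eval_inv_q c = poly (map_poly (\<lambda>r. to_fract [:[:r:]:]) c) (inverse qq)"

lemma eval_inv_q_hom [simp]:
  "eval_inv_q 0 = 0" "eval_inv_q 1 = 1"
  "eval_inv_q (c + d) = eval_inv_q c + eval_inv_q d"
  "eval_inv_q (c * d) = eval_inv_q c * eval_inv_q d"
proof -
  show "eval_inv_q 0 = 0"
    by (simp add: eval_inv_q_def)
  have "[:[:1:]:] = (1 :: rat poly poly)"
    by (simp add: one_pCons)
  then show "eval_inv_q 1 = 1"
    by (simp add: eval_inv_q_def map_poly_1)
  show "eval_inv_q (c + d) = eval_inv_q c + eval_inv_q d"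
    unfolding eval_inv_q_def by (rule poly_map_poly_add) (auto simp flip: to_fract_add)
  show "eval_inv_q (c * d) = eval_inv_q c * eval_inv_q d"
    unfolding eval_inv_q_def by (rule poly_map_poly_mult) (auto simp flip: to_fract_add to_fract_mult)
qed

lemma eval_inv_conv_q: "eval_inv p = poly (map_poly eval_inv_q p) (inverse tt)"
  by (simp add: eval_inv_def eval_inv_q_def[abs_def])

lemma eval_inv_hom [simp]:
  "eval_inv 0 = 0" "eval_inv 1 = 1"
  "eval_inv (p + r) = eval_inv p + eval_inv r"
  "eval_inv (p * r) = eval_inv p * eval_inv r"
  by (simp_all add: eval_inv_conv_q map_poly_1 poly_map_poly_add poly_map_poly_mult)

lemma qq_nonzero [simp]: "qq \<noteq> 0" and tt_nonzero [simp]: "tt \<noteq> 0"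
  by (simp_all add: qq_def tt_def)

lemma qq_tt_monom: "qq ^ i * tt ^ j = to_fract (monom (monom 1 i) j)"
proof -
  have "[:[:0, 1:]:] ^ i = [:monom (1::rat) i:]"
    by (induction i) (simp_all add: monom_Suc one_pCons)
  moreover have "[:0, 1:] ^ j = monom (1 :: rat poly) j"
    by (induction j) (simp_all add: monom_Suc)
  moreover have "to_fract x ^ k = to_fract (x ^ k)" for x :: "rat poly poly" and k
    by (induction k) simp_all
  ultimately show ?thesis
    by (simp add: qq_def tt_def smult_monom flip: to_fract_mult)
qed

text \<open>Multiplication by a high power of \<open>q\<close> and of \<open>t\<close> clears the
  denominators and yields the polynomial \<open>refl\<close>, whose coefficients are those of
  \<open>p\<close> in reversed order. Hence no nonzero denominator is sent to zero, and the
  substitution extends to the fraction field.\<close>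

lemma eval_inv_eq_0_iff [simp]: "eval_inv p = 0 \<longleftrightarrow> p = 0"
proof
  assume *: "eval_inv p = 0"
  define n where "n = degree p"
  define M where "M = Max ((\<lambda>k. degree (coeff p k)) ` {..n})"
  have M: "degree (coeff p k) \<le> M" if "k \<le> n" for k
    unfolding M_def using that by (intro Max_ge) auto
  define refl :: "rat poly poly" where
    "refl = (\<Sum>k\<le>n. \<Sum>l\<le>M. monom (monom (coeff (coeff p k) l) (M - l)) (n - k))"
  have const: "to_fract [:[:r:]:] * to_fract (monom (monom 1 i) j) = to_fract (monom (monom r i) j)"
    for r :: rat and i j
    by (simp add: smult_monom flip: to_fract_mult)
  have inv_pow: "inverse x ^ k * x ^ l = x ^ (l - k)" if "k \<le> l" "x \<noteq> 0" for x :: coef and k l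
    using that by (simp add: power_diff field_simps)
  have "eval_inv p * (qq ^ M * tt ^ n)
      = (\<Sum>k\<le>n. (\<Sum>l\<le>M. to_fract [:[:coeff (coeff p k) l:]:] * inverse qq ^ l) * inverse tt ^ k)
        * (qq ^ M * tt ^ n)"
    unfolding eval_inv_conv_q
    by (subst poly_map_poly_altdef[where n = n])
      (auto simp: n_def eval_inv_q_def poly_map_poly_altdef[where n = M] M[unfolded n_def] intro!: sum.cong)
  also have "\<dots> = (\<Sum>k\<le>n. \<Sum>l\<le>M. to_fract [:[:coeff (coeff p k) l:]:] *
                    ((inverse qq ^ l * qq ^ M) * (inverse tt ^ k * tt ^ n)))"
    by (simp add: sum_distrib_right sum_distrib_left mult_ac)
  also have "\<dots> = to_fract refl"
    unfolding refl_def to_fract_sum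
    by (intro sum.cong refl) (simp add: inv_pow qq_tt_monom const)
  finally have "refl = 0"
    using * by simp
  have "coeff (coeff p k) l = 0" if "k \<le> n" "l \<le> M" for k l
  proof -
    have "0 = coeff (coeff refl (n - k)) (M - l)"
      by (simp add: \<open>refl = 0\<close>)
    also have "\<dots> = (\<Sum>k'\<le>n. \<Sum>l'\<le>M. if l' = l then if k' = k then coeff (coeff p k) l else 0 else 0)"
      unfolding refl_def coeff_sum using that
      by (intro sum.cong refl) (auto simp: coeff_sum)
    also have "\<dots> = coeff (coeff p k) l"
      using that by (simp add: sum.delta)
    finally show ?thesis by simp
  qed
  then have "coeff (coeff p k) l = 0" for k l
    using M[of k] coeff_eq_0[of "coeff p k" l] coeff_eq_0[of p k] n_def
    by (cases "k \<le> n"; cases "l \<le> M") (auto simp: not_le)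
  then show "p = 0"
    by (simp add: poly_eq_iff)
qed simp

text \<open>\<open>quot_of_fract\<close> picks one particular representative. The cross-multiplied
  equation between two representatives passes through the homomorphism \<open>eval_inv\<close>, so
  any of them may be used.\<close>

lemma bar_coef_Fract: "r \<noteq> 0 \<Longrightarrow> bar_coef (to_fract p / to_fract r) = eval_inv p / eval_inv r"
proof -
  assume r: "r \<noteq> 0"
  define x where "x = to_fract p / to_fract r"
  obtain a b where ab: "quot_of_fract x = (a, b)"
    by fastforce
  have b: "b \<noteq> 0"
    using snd_quot_of_fract_nonzero[of x] ab by simp
  have "to_fract a / to_fract b = to_fract p / to_fract r"
    using Fract_quot_of_fract[of x] ab by (simp add: Fract_conv_to_fract x_def)
  then have "a * r = p * b"
    using r b by (simp add: frac_eq_eq flip: to_fract_mult)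
  then have "eval_inv a * eval_inv r = eval_inv p * eval_inv b"
    by (metis eval_inv_hom(4))
  then show ?thesis
    using r b ab by (simp add: bar_coef_def frac_eq_eq flip: x_def)
qed

lemma coef_cases:
  fixes x :: coef
  obtains p r where "r \<noteq> 0" "x = to_fract p / to_fract r"
  by (metis Fract_conv_to_fract Fract_quot_of_fract snd_quot_of_fract_nonzero)

lemma bar_coef_to_fract: "bar_coef (to_fract p) = eval_inv p"
  using bar_coef_Fract[of 1 p] by simp

lemma bar_coef_add [simp]: "bar_coef (x + y) = bar_coef x + bar_coef y"
proof -
  obtain p r where x: "r \<noteq> 0" "x = to_fract p / to_fract r" by (rule coef_cases)
  obtain p' r' where y: "r' \<noteq> 0" "y = to_fract p' / to_fract r'" by (rule coef_cases)
  have "x + y = to_fract (p * r' + p' * r) / to_fract (r * r')"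
    unfolding x y using x(1) y(1) by (simp add: field_simps)
  then have "bar_coef (x + y) = eval_inv (p * r' + p' * r) / eval_inv (r * r')"
    using x y by (simp only: bar_coef_Fract mult_eq_0_iff simp_thms)
  moreover have "bar_coef x = eval_inv p / eval_inv r" "bar_coef y = eval_inv p' / eval_inv r'"
    unfolding x y using x(1) y(1) by (simp_all add: bar_coef_Fract)
  ultimately show ?thesis
    using x(1) y(1) by (simp add: add_frac_eq)
qed

lemma bar_coef_mult [simp]: "bar_coef (x * y) = bar_coef x * bar_coef y"
proof -
  obtain p r where x: "r \<noteq> 0" "x = to_fract p / to_fract r" by (rule coef_cases)
  obtain p' r' where y: "r' \<noteq> 0" "y = to_fract p' / to_fract r'" by (rule coef_cases)
  have "x * y = to_fract (p * p') / to_fract (r * r')"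
    unfolding x y using x(1) y(1) by (simp add: field_simps)
  then have "bar_coef (x * y) = eval_inv (p * p') / eval_inv (r * r')"
    using x y by (simp only: bar_coef_Fract mult_eq_0_iff simp_thms)
  moreover have "bar_coef x = eval_inv p / eval_inv r" "bar_coef y = eval_inv p' / eval_inv r'"
    unfolding x y using x(1) y(1) by (simp_all add: bar_coef_Fract)
  ultimately show ?thesis
    using x(1) y(1) by (simp add: add_frac_eq)
qed

lemma bar_coef_0 [simp]: "bar_coef 0 = 0" and bar_coef_1 [simp]: "bar_coef 1 = 1"
  using bar_coef_to_fract[of 0] bar_coef_to_fract[of 1] by simp_all

lemma bar_coef_minus [simp]: "bar_coef (- x) = - bar_coef x"
  using bar_coef_add[of x "-x"] by (simp del: bar_coef_add add: eq_neg_iff_add_eq_0 add.commute)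

lemma bar_coef_diff [simp]: "bar_coef (x - y) = bar_coef x - bar_coef y"
  using bar_coef_add[of x "-y"] by (simp del: bar_coef_add)

lemma bar_coef_power [simp]: "bar_coef (x ^ n) = bar_coef x ^ n"
  by (induction n) simp_all

lemma bar_coef_inverse [simp]: "bar_coef (inverse x) = inverse (bar_coef x)"
proof (cases "x = 0")
  case False
  then have "bar_coef x * bar_coef (inverse x) = 1"
    using bar_coef_mult[of x "inverse x"] by (simp del: bar_coef_mult)
  then show ?thesis
    by (simp add: inverse_unique)
qed simp

lemma bar_coef_divide [simp]: "bar_coef (x / y) = bar_coef x / bar_coef y"
  by (simp add: divide_inverse)

lemma bar_coef_power_int [simp]: "bar_coef (x powi n) = bar_coef x powi n"
  by (simp add: power_int_def)

lemma bar_coef_prod [simp]: "bar_coef (prod f A) = (\<Prod>x\<in>A. bar_coef (f x))"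
  by (induction A rule: infinite_finite_induct) simp_all

lemma bar_coef_qq [simp]: "bar_coef qq = inverse qq"
proof -
  have "[:[:1:]:] = (1 :: rat poly poly)"
    by (simp add: one_pCons)
  then show ?thesis
    unfolding qq_def bar_coef_to_fract
    by (simp add: eval_inv_conv_q eval_inv_q_def poly_map_poly_pCons flip: qq_def)
qed

lemma bar_coef_tt [simp]: "bar_coef tt = inverse tt"
  unfolding tt_def bar_coef_to_fract
  by (simp add: eval_inv_conv_q poly_map_poly_pCons flip: tt_def)

section \<open>Independence of the powers of \<open>q\<close> and \<open>t\<close>\<close>

lemma qq_tt_power_eqD:
  assumes "qq ^ a * tt ^ b = qq ^ c * tt ^ d"
  shows "a = c \<and> b = d"
proof -
  have "monom (monom (1::rat) a) b = monom (monom 1 c) d"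
    using assms by (simp only: qq_tt_monom to_fract_eq_iff)
  moreover have "monom (1::rat) a \<noteq> 0" "monom (1::rat) c \<noteq> 0"
    by simp_all
  ultimately show ?thesis
    by (metis degree_monom_eq lead_coeff_monom one_neq_zero)
qed

text \<open>Adding \<open>\<bar>i\<bar> + \<bar>j\<bar>\<close> to both exponents of
  \<open>t\<close> makes them nonnegative. The eigenvalues of the Cherednik operators have this
  form, so they can be compared by exponents.\<close>

lemma qq_tt_powi_eqD:
  assumes "qq ^ a * tt powi i = qq ^ c * tt powi j"
  shows "a = c \<and> i = j"
proof -
  define k where "k = \<bar>i\<bar> + \<bar>j\<bar>"
  have "qq ^ a * tt powi (i + k) = qq ^ c * tt powi (j + k)"
    using assms by (simp add: power_int_add mult.assoc[symmetric])
  then have "qq ^ a * tt ^ nat (i + k) = qq ^ c * tt ^ nat (j + k)"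
    by (simp add: power_int_def k_def split: if_splits)
  from qq_tt_power_eqD[OF this] show ?thesis
    by (auto simp: k_def)
qed

lemma tt_ne_1 [simp]: "tt \<noteq> 1"
  using qq_tt_power_eqD[of 0 1 0 0] by auto

section \<open>The polynomial ring\<close>

text \<open>The finitely supported series again, but with the convolution product: the type class
  instances supply an integral domain, whereas \<open>series\<close> carries no product.\<close>

type_synonym mpol = "mono \<Rightarrow>\<^sub>0 coef"

abbreviation "lookup \<equiv> Poly_Mapping.lookup"
abbreviation "keys \<equiv> Poly_Mapping.keys"
abbreviation "single \<equiv> Poly_Mapping.single"

definition cc :: "coef \<Rightarrow> mpol" where "cc c = single 0 c"

definition xx :: "nat \<Rightarrow> mpol" where "xx i = single (single i 1) 1"

lemma cc_simps:
  "cc 0 = 0" "cc 1 = 1" "cc (a + b) = cc a + cc b" "cc (a - b) = cc a - cc b"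
  "cc (- a) = - cc a" "cc (a * b) = cc a * cc b"
  by (simp_all add: cc_def single_add single_diff single_uminus mult_single)

lemma cc_eq_0_iff [simp]: "cc c = 0 \<longleftrightarrow> c = 0"
  unfolding cc_def by (metis lookup_single_eq lookup_zero single_zero)

lemma single_1_eq_iff [simp]: "single a (Suc 0) = single b (Suc 0) \<longleftrightarrow> a = b"
proof
  assume "single a (Suc 0) = single b (Suc 0)"
  then have "lookup (single a (Suc 0)) a = lookup (single b (Suc 0)) a" by simp
  then show "a = b" by (simp add: lookup_single when_def split: if_splits)
qed simp

lemma poly_mapping_induct_single [case_names single add]:
  fixes p :: "'a \<Rightarrow>\<^sub>0 'b::comm_monoid_add"
  assumes single: "\<And>k v. P (single k v)" and add: "\<And>p r. P p \<Longrightarrow> P r \<Longrightarrow> P (p + r)"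
  shows "P p"
proof (induction p rule: update_induct)
  case const
  show ?case using single[of undefined 0] by simp
next
  case (update f a b)
  have "Poly_Mapping.update a b f = f + single a b"
    using update by (intro poly_mapping_eqI)
      (auto simp: lookup_add lookup_update lookup_single when_def not_in_keys_iff_lookup_eq_zero)
  then show ?case using update add single by simp
qed

lemma lookup_single_mult: "lookup (single \<nu> c * p) (\<nu> + \<mu>) = c * lookup p \<mu>" for p :: mpol
  by (simp add: lookup_mult lookup_single when_mult)

lemma lookup_single_mult_notin:
  "(\<And>\<kappa>. \<mu> \<noteq> \<nu> + \<kappa>) \<Longrightarrow> lookup (single \<nu> c * p) \<mu> = 0" for p :: mpol
  by (simp add: lookup_mult lookup_single when_mult)

lemma lookup_cc_mult [simp]: "lookup (cc c * p) \<mu> = c * lookup p \<mu>"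
  using lookup_single_mult[of 0 c p \<mu>] by (simp add: cc_def)

lemma lookup_xx_mult: "lookup (xx i * p) = mult_var i (lookup p)"
proof
  fix \<mu> :: mono
  show "lookup (xx i * p) \<mu> = mult_var i (lookup p) \<mu>"
  proof (cases "lookup \<mu> i = 0")
    case True
    then have "\<mu> \<noteq> single i 1 + \<kappa>" for \<kappa>
      by (auto simp: lookup_add)
    then show ?thesis
      using True by (simp add: xx_def mult_var_def lookup_single_mult_notin)
  next
    case False
    then have "\<mu> = single i 1 + (\<mu> - single i 1)"
      by (intro poly_mapping_eqI) (auto simp: lookup_add lookup_minus lookup_single when_def)
    then show ?thesis
      using False lookup_single_mult[of "single i 1" 1 p "\<mu> - single i 1"]
      by (simp add: xx_def mult_var_def)
  qed
qed

lemma single_conv_cc: "single \<nu> c = cc c * single \<nu> 1"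
  by (simp add: cc_def mult_single)

lemma single_single_power: "single (single i k) 1 = xx i ^ k"
proof (induction k)
  case (Suc k)
  have "single i (Suc k) = single i 1 + single i k"
    by (simp flip: single_add)
  then show ?case
    using Suc[symmetric] by (simp add: xx_def mult_single)
qed simp

lemma mpol_induct [case_names const var add mult]:
  assumes "\<And>c. P (cc c)" "\<And>i. P (xx i)"
    and "\<And>p r. P p \<Longrightarrow> P r \<Longrightarrow> P (p + r)" "\<And>p r. P p \<Longrightarrow> P r \<Longrightarrow> P (p * r)"
  shows "P p"
proof (induction p rule: poly_mapping_induct_single)
  case (single \<nu> c)
  have pow: "P (xx i ^ k)" for i k
    using assms(1)[of 1] by (induction k) (auto simp: cc_simps intro: assms)
  have "P (single \<nu> 1)"
  proof (induction \<nu> rule: poly_mapping_induct_single)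
    case (single i k)
    then show ?case using pow by (simp add: single_single_power)
  next
    case (add \<nu> \<mu>)
    then show ?case using assms(4)[of "single \<nu> 1" "single \<mu> 1"] by (simp add: mult_single)
  qed
  then show ?case
    by (subst single_conv_cc) (intro assms)
qed (intro assms)

section \<open>Substitutions\<close>

lemma lookup_permute_mono: "inj \<sigma> \<Longrightarrow> lookup (permute_mono \<sigma> \<mu>) i = lookup \<mu> (\<sigma> i)"
  by (simp add: permute_mono_def map_key.rep_eq)

lemma permute_mono_comp:
  "inj \<sigma> \<Longrightarrow> inj \<tau> \<Longrightarrow> permute_mono \<tau> (permute_mono \<sigma> \<mu>) = permute_mono (\<sigma> \<circ> \<tau>) \<mu>"
  by (intro poly_mapping_eqI) (simp add: lookup_permute_mono inj_compose)

lemma permute_mono_id [simp]: "permute_mono id \<mu> = \<mu>" "permute_mono (\<lambda>x. x) \<mu> = \<mu>"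
  by (intro poly_mapping_eqI, simp add: lookup_permute_mono)+

lemma permute_mono_inv [simp]:
  assumes "bij \<sigma>"
  shows "permute_mono \<sigma> (permute_mono (inv \<sigma>) \<mu>) = \<mu>" "permute_mono (inv \<sigma>) (permute_mono \<sigma> \<mu>) = \<mu>"
proof -
  have "inv \<sigma> \<circ> \<sigma> = id" "\<sigma> \<circ> inv \<sigma> = id" "inj \<sigma>" "inj (inv \<sigma>)"
    using assms by (auto simp: bij_is_inj bij_is_surj bij_imp_bij_inv simp flip: surj_iff)
  then show "permute_mono \<sigma> (permute_mono (inv \<sigma>) \<mu>) = \<mu>" "permute_mono (inv \<sigma>) (permute_mono \<sigma> \<mu>) = \<mu>"
    by (simp_all add: permute_mono_comp)
qed

lemma permute_mono_add: "inj \<sigma> \<Longrightarrow> permute_mono \<sigma> (\<mu> + \<nu>) = permute_mono \<sigma> \<mu> + permute_mono \<sigma> \<nu>"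
  by (intro poly_mapping_eqI) (simp add: lookup_permute_mono lookup_add)

lemma permute_mono_0 [simp]: "inj \<sigma> \<Longrightarrow> permute_mono \<sigma> 0 = 0"
  by (intro poly_mapping_eqI) (simp add: lookup_permute_mono)

lemma permute_mono_inv_single:
  assumes "bij \<sigma>"
  shows "permute_mono (inv \<sigma>) (single i k) = single (\<sigma> i) k"
  using assms
  by (intro poly_mapping_eqI)
    (auto simp: lookup_permute_mono lookup_single when_def bij_imp_bij_inv bij_is_inj bij_inv_eq_iff)

text \<open>The exponent of \<open>q\<close> that a monomial acquires when \<open>x_j\<close> is
  replaced by \<open>q^(e j) x_j\<close>. Integer weights are taken because the bar involution
  negates them.\<close>

definition wt :: "(nat \<Rightarrow> int) \<Rightarrow> mono \<Rightarrow> int" where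
  "wt e \<mu> = (\<Sum>j\<in>keys \<mu>. e j * int (lookup \<mu> j))"

lemma wt_eq_sum:
  assumes "finite A" "keys \<mu> \<subseteq> A"
  shows "wt e \<mu> = (\<Sum>j\<in>A. e j * int (lookup \<mu> j))"
  unfolding wt_def using assms by (intro sum.mono_neutral_left) (auto simp: in_keys_iff)

lemma wt_add [simp]: "wt e (\<mu> + \<nu>) = wt e \<mu> + wt e \<nu>"
proof -
  have "keys (\<mu> + \<nu>) \<subseteq> keys \<mu> \<union> keys \<nu>"
    by (rule keys_add)
  then show ?thesis
    by (simp add: wt_eq_sum[where A = "keys \<mu> \<union> keys \<nu>"] lookup_add sum.distrib algebra_simps)
qed

lemma wt_0 [simp]: "wt e 0 = 0" "wt (\<lambda>_. 0) \<mu> = 0"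
  by (simp_all add: wt_def)

lemma wt_single [simp]: "wt e (single i k) = e i * int k"
  by (simp add: wt_def)

lemma wt_plus_fun: "wt (\<lambda>j. e j + f j) \<mu> = wt e \<mu> + wt f \<mu>"
  by (simp add: wt_def algebra_simps sum.distrib)

lemma wt_minus_fun: "wt (\<lambda>j. - e j) \<mu> = - wt e \<mu>"
  by (simp add: wt_def sum_negf)

lemma wt_permute:
  assumes "bij \<sigma>"
  shows "wt (e \<circ> \<sigma>) (permute_mono \<sigma> \<mu>) = wt e \<mu>"
proof -
  have "inj \<sigma>" using assms by (simp add: bij_is_inj)
  have "keys \<mu> = \<sigma> ` keys (permute_mono \<sigma> \<mu>)"
    using \<open>inj \<sigma>\<close> bij_is_surj[OF assms]
    by (simp add: permute_mono_def keys_map_key surj_image_vimage_eq)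
  moreover have "inj_on \<sigma> A" for A
    using \<open>inj \<sigma>\<close> by (simp add: inj_on_def)
  ultimately show ?thesis
    unfolding wt_def using \<open>inj \<sigma>\<close> by (simp add: sum.reindex lookup_permute_mono)
qed

text \<open>For a bijection \<open>\<sigma>\<close> this substitutes \<open>q\<^bsup>e j\<^esup> x\<^bsub>\<sigma> j\<^esub>\<close> for \<open>x\<^sub>j\<close>.\<close>

definition subst :: "(nat \<Rightarrow> nat) \<Rightarrow> (nat \<Rightarrow> int) \<Rightarrow> mpol \<Rightarrow> mpol" where
  "subst \<sigma> e p =
     Abs_poly_mapping (\<lambda>\<mu>. qq powi wt e (permute_mono \<sigma> \<mu>) * lookup p (permute_mono \<sigma> \<mu>))"

lemma lookup_subst:
  assumes "bij \<sigma>"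
  shows "lookup (subst \<sigma> e p) \<mu> = qq powi wt e (permute_mono \<sigma> \<mu>) * lookup p (permute_mono \<sigma> \<mu>)"
proof -
  have "{\<mu>. qq powi wt e (permute_mono \<sigma> \<mu>) * lookup p (permute_mono \<sigma> \<mu>) \<noteq> 0}
      \<subseteq> permute_mono (inv \<sigma>) ` keys p"
  proof
    fix \<mu> assume "\<mu> \<in> {\<mu>. qq powi wt e (permute_mono \<sigma> \<mu>) * lookup p (permute_mono \<sigma> \<mu>) \<noteq> 0}"
    then have "permute_mono \<sigma> \<mu> \<in> keys p"
      by (simp add: in_keys_iff)
    then have "permute_mono (inv \<sigma>) (permute_mono \<sigma> \<mu>) \<in> permute_mono (inv \<sigma>) ` keys p"
      by blast
    then show "\<mu> \<in> permute_mono (inv \<sigma>) ` keys p"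
      using assms by simp
  qed
  then have "finite {\<mu>. qq powi wt e (permute_mono \<sigma> \<mu>) * lookup p (permute_mono \<sigma> \<mu>) \<noteq> 0}"
    by (rule finite_subset) simp
  then show ?thesis
    by (simp add: subst_def)
qed

lemma subst_add: "bij \<sigma> \<Longrightarrow> subst \<sigma> e (p + r) = subst \<sigma> e p + subst \<sigma> e r"
  by (intro poly_mapping_eqI) (simp add: lookup_subst lookup_add algebra_simps)

lemma subst_single:
  assumes "bij \<sigma>"
  shows "subst \<sigma> e (single \<nu> c) = single (permute_mono (inv \<sigma>) \<nu>) (c * qq powi wt e \<nu>)"
proof (intro poly_mapping_eqI)
  fix \<mu>
  have "permute_mono \<sigma> \<mu> = \<nu> \<longleftrightarrow> \<mu> = permute_mono (inv \<sigma>) \<nu>"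
    using assms by auto
  then show "lookup (subst \<sigma> e (single \<nu> c)) \<mu> =
      lookup (single (permute_mono (inv \<sigma>) \<nu>) (c * qq powi wt e \<nu>)) \<mu>"
    using assms by (auto simp: lookup_subst lookup_single when_def)
qed

lemma subst_mult:
  assumes "bij \<sigma>"
  shows "subst \<sigma> e (p * r) = subst \<sigma> e p * subst \<sigma> e r"
proof (induction p rule: poly_mapping_induct_single)
  case (single \<mu> c)
  show ?case
  proof (induction r rule: poly_mapping_induct_single)
    case (single \<nu> d)
    have "inj (inv \<sigma>)"
      using assms by (simp add: bij_imp_bij_inv bij_is_inj)
    then show ?case
      using assms by (simp add: mult_single subst_single permute_mono_add power_int_add mult_ac)
  qed (use assms in \<open>simp add: subst_add algebra_simps\<close>)
qed (use assms in \<open>simp add: subst_add algebra_simps\<close>)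

lemma subst_cc [simp]: "bij \<sigma> \<Longrightarrow> subst \<sigma> e (cc c) = cc c"
  using bij_imp_bij_inv[of \<sigma>] by (simp add: cc_def subst_single bij_is_inj)

lemma subst_xx: "bij \<sigma> \<Longrightarrow> subst \<sigma> e (xx j) = cc (qq powi e j) * xx (\<sigma> j)"
  by (simp add: xx_def cc_def subst_single permute_mono_inv_single mult_single)

lemma subst_0 [simp]: "bij \<sigma> \<Longrightarrow> subst \<sigma> e 0 = 0"
  using subst_cc[of \<sigma> e 0] by (simp add: cc_simps)

lemma subst_1 [simp]: "bij \<sigma> \<Longrightarrow> subst \<sigma> e 1 = 1"
  using subst_cc[of \<sigma> e 1] by (simp add: cc_simps)

lemma subst_minus: "bij \<sigma> \<Longrightarrow> subst \<sigma> e (- p) = - subst \<sigma> e p"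
  using subst_add[of \<sigma> e p "-p"] by (simp add: eq_neg_iff_add_eq_0 add.commute)

lemma subst_diff: "bij \<sigma> \<Longrightarrow> subst \<sigma> e (p - r) = subst \<sigma> e p - subst \<sigma> e r"
  using subst_add[of \<sigma> e p "-r"] by (simp add: subst_minus)

text \<open>The inner substitution sends \<open>x_j\<close> to \<open>q^(f j) x_(\<tau> j)\<close>,
  and the outer one then contributes \<open>q^(e (\<tau> j))\<close>; this is the weight of the
  composite.\<close>

lemma subst_subst:
  assumes "bij \<sigma>" "bij \<tau>"
  shows "subst \<sigma> e (subst \<tau> f p) = subst (\<sigma> \<circ> \<tau>) (\<lambda>j. f j + e (\<tau> j)) p"
proof (intro poly_mapping_eqI)
  fix \<mu>
  have inj: "inj \<sigma>" "inj \<tau>" and "bij (\<sigma> \<circ> \<tau>)"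
    using assms by (auto simp: bij_is_inj bij_comp)
  moreover have "wt e (permute_mono \<sigma> \<mu>) = wt (e \<circ> \<tau>) (permute_mono (\<sigma> \<circ> \<tau>) \<mu>)"
    using inj assms wt_permute[of \<tau> e "permute_mono \<sigma> \<mu>"] by (simp add: permute_mono_comp)
  ultimately show "lookup (subst \<sigma> e (subst \<tau> f p)) \<mu> =
      lookup (subst (\<sigma> \<circ> \<tau>) (\<lambda>j. f j + e (\<tau> j)) p) \<mu>"
    using assms
    by (simp add: lookup_subst permute_mono_comp wt_plus_fun power_int_add comp_def)
qed

lemma subst_id [simp]: "subst id (\<lambda>_. 0) p = p" "subst (\<lambda>x. x) (\<lambda>_. 0) p = p"
proof -
  show "subst id (\<lambda>_. 0) p = p"
    by (intro poly_mapping_eqI) (simp add: lookup_subst)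
  then show "subst (\<lambda>x. x) (\<lambda>_. 0) p = p" by (simp add: id_def)
qed

section \<open>Exchange of two variables\<close>

definition KK :: "nat \<Rightarrow> nat \<Rightarrow> mpol \<Rightarrow> mpol" where
  "KK a b = subst (transpose a b) (\<lambda>_. 0)"

lemma KK_add: "KK a b (p + r) = KK a b p + KK a b r"
  and KK_mult: "KK a b (p * r) = KK a b p * KK a b r"
  and KK_diff: "KK a b (p - r) = KK a b p - KK a b r"
  and KK_cc [simp]: "KK a b (cc c) = cc c"
  and KK_xx: "KK a b (xx j) = xx (transpose a b j)"
  by (simp_all add: KK_def subst_add subst_mult subst_diff subst_xx cc_simps)

lemma KK_commute: "KK a b = KK b a"
  by (simp add: KK_def transpose_commute)

lemma KK_KK [simp]: "KK a b (KK a b p) = p"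
  by (simp add: KK_def subst_subst)

text \<open>Conjugating a transposition by \<open>\<sigma>\<close> transports its two points. Equal
  weights at \<open>a\<close> and \<open>b\<close> keep the powers of \<open>q\<close> out of the
  exchange.\<close>

lemma subst_KK:
  assumes "bij \<sigma>" "e a = e b"
  shows "subst \<sigma> e (KK a b p) = KK (\<sigma> a) (\<sigma> b) (subst \<sigma> e p)"
proof -
  have "\<sigma> \<circ> transpose a b = transpose (\<sigma> a) (\<sigma> b) \<circ> \<sigma>"
    using assms by (auto simp: fun_eq_iff transpose_def bij_is_inj inj_eq)
  moreover have "(\<lambda>j. e (transpose a b j)) = e"
    using assms(2) by (auto simp: fun_eq_iff transpose_def)
  ultimately show ?thesis
    using assms(1) by (simp add: KK_def subst_subst)
qed

lemma lookup_KK: "lookup (KK a b p) = K_op a b (lookup p)"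
  by (auto simp: KK_def K_op_def lookup_subst)

section \<open>Demazure--Lusztig operators\<close>

lemma xx_diff_nonzero: "a \<noteq> b \<Longrightarrow> xx a - xx b \<noteq> 0"
proof
  assume ab: "a \<noteq> b" "xx a - xx b = 0"
  have "lookup (xx a - xx b) (single a 1) = 1"
    using ab(1) by (auto simp: xx_def lookup_minus lookup_single when_def)
  then show False using ab(2) by simp
qed

text \<open>Divisibility passes to products by the twisted Leibniz rule
  \<open>K(p r) - p r = K p (K r - r) + (K p - p) r\<close>, so it suffices to check constants and
  variables.\<close>

lemma dvd_KK_minus: "(xx a - xx b) dvd (KK a b p - p)"
proof (induction p rule: mpol_induct)
  case (var i)
  have "xx b - xx a = - (xx a - xx b)" by simp
  then have "(xx a - xx b) dvd (xx b - xx a)"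
    by (metis dvd_minus_iff dvd_refl)
  then show ?case
    by (auto simp: KK_xx transpose_def)
next
  case (add p r)
  have "KK a b (p + r) - (p + r) = (KK a b p - p) + (KK a b r - r)"
    by (simp add: KK_add)
  then show ?case using add by (simp only: dvd_add)
next
  case (mult p r)
  have "KK a b (p * r) - p * r = KK a b p * (KK a b r - r) + (KK a b p - p) * r"
    by (simp add: KK_mult algebra_simps)
  then show ?case using mult by (simp only: dvd_add dvd_mult dvd_mult2)
qed simp

definition dd :: "nat \<Rightarrow> nat \<Rightarrow> mpol \<Rightarrow> mpol" where
  "dd a b p = (SOME g. (xx a - xx b) * g = KK a b p - p)"

lemma dd_eq: "(xx a - xx b) * dd a b p = KK a b p - p"
proof -
  have "\<exists>g. (xx a - xx b) * g = KK a b p - p"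
    using dvd_KK_minus[of a b p] by (metis dvdE)
  then show ?thesis
    unfolding dd_def by (rule someI_ex)
qed

text \<open>Arbitrary positions instead of neighbours: substitutions carry the operator to other
  pairs, in particular to the reversed pair \<open>(i+1, i)\<close> and to the pairs
  \<open>(i, j)\<close> in the triangular form of the Cherednik operators.\<close>

definition TT :: "nat \<Rightarrow> nat \<Rightarrow> mpol \<Rightarrow> mpol" where
  "TT a b p = cc tt * p + (cc tt * xx a - xx b) * dd a b p"

text \<open>With the denominator cleared this equation characterizes \<open>TT a b p\<close>, since
  \<open>xx a - xx b\<close> can be cancelled. The algebraic relations for \<open>T\<close> are
  derived from it and not from \<open>dd\<close>.\<close>

lemma TT_eq:
  "(xx a - xx b) * TT a b p = (1 - cc tt) * xx b * p + (cc tt * xx a - xx b) * KK a b p"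
proof -
  have "(xx a - xx b) * TT a b p = (xx a - xx b) * cc tt * p +
      (cc tt * xx a - xx b) * ((xx a - xx b) * dd a b p)"
    by (simp add: TT_def algebra_simps)
  then show ?thesis
    unfolding dd_eq by (simp add: algebra_simps)
qed

lemma mult_cancel_xx_diff: "a \<noteq> b \<Longrightarrow> (xx a - xx b) * p = (xx a - xx b) * r \<Longrightarrow> p = r"
  using xx_diff_nonzero by (simp only: mult_cancel_left) blast

lemma TT_unique:
  assumes "a \<noteq> b"
    "(xx a - xx b) * r = (1 - cc tt) * xx b * p + (cc tt * xx a - xx b) * KK a b p"
  shows "TT a b p = r"
  by (rule mult_cancel_xx_diff[OF assms(1)]) (simp only: TT_eq assms(2))

lemma TT_add: "a \<noteq> b \<Longrightarrow> TT a b (p + r) = TT a b p + TT a b r"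
  by (rule TT_unique, assumption, simp only: distrib_left TT_eq KK_add) (simp only: ac_simps)

lemma TT_mult_sym:
  assumes "a \<noteq> b" "KK a b e = e"
  shows "TT a b (e * p) = e * TT a b p"
proof (rule TT_unique[OF assms(1)])
  have "(xx a - xx b) * (e * TT a b p) = e * ((xx a - xx b) * TT a b p)"
    by (simp add: mult_ac)
  also have "\<dots> = (1 - cc tt) * xx b * (e * p) + (cc tt * xx a - xx b) * KK a b (e * p)"
    unfolding TT_eq by (simp add: KK_mult assms algebra_simps)
  finally show "(xx a - xx b) * (e * TT a b p) =
    (1 - cc tt) * xx b * (e * p) + (cc tt * xx a - xx b) * KK a b (e * p)" .
qed

lemma TT_cc: "a \<noteq> b \<Longrightarrow> TT a b (cc c * p) = cc c * TT a b p"
  by (rule TT_mult_sym) simp_all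

lemma TT_fixed:
  assumes "a \<noteq> b" "KK a b e = e"
  shows "TT a b e = cc tt * e"
  by (rule TT_unique) (use assms in \<open>simp_all add: algebra_simps\<close>)

text \<open>With equal weights, \<open>x_a\<close> and \<open>x_b\<close> acquire the same power of
  \<open>q\<close>, which cancels from the characterizing equation and leaves that of the
  transported operator.\<close>

lemma TT_subst:
  assumes \<sigma>: "bij \<sigma>" and "e a = e b" "a \<noteq> b"
  shows "subst \<sigma> e (TT a b p) = TT (\<sigma> a) (\<sigma> b) (subst \<sigma> e p)"
proof -
  have "\<sigma> a \<noteq> \<sigma> b"
    using assms by (simp add: bij_is_inj inj_eq)
  define c where "c = cc (qq powi e b)"
  have c: "c \<noteq> 0"
    by (simp add: c_def)
  have "c * ((xx (\<sigma> a) - xx (\<sigma> b)) * subst \<sigma> e (TT a b p)) = subst \<sigma> e ((xx a - xx b) * TT a b p)"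
    using assms(1,2) by (simp add: subst_mult subst_diff subst_xx c_def) (simp add: algebra_simps)
  also have "\<dots> = c * ((1 - cc tt) * xx (\<sigma> b) * subst \<sigma> e p +
           (cc tt * xx (\<sigma> a) - xx (\<sigma> b)) * KK (\<sigma> a) (\<sigma> b) (subst \<sigma> e p))"
    unfolding TT_eq using assms(1,2)
    by (simp add: subst_mult subst_diff subst_add subst_xx subst_KK c_def) (simp add: algebra_simps)
  finally have "c * ((xx (\<sigma> a) - xx (\<sigma> b)) * subst \<sigma> e (TT a b p)) =
      c * ((1 - cc tt) * xx (\<sigma> b) * subst \<sigma> e p +
           (cc tt * xx (\<sigma> a) - xx (\<sigma> b)) * KK (\<sigma> a) (\<sigma> b) (subst \<sigma> e p))" .
  then have "(xx (\<sigma> a) - xx (\<sigma> b)) * subst \<sigma> e (TT a b p) =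
      (1 - cc tt) * xx (\<sigma> b) * subst \<sigma> e p +
           (cc tt * xx (\<sigma> a) - xx (\<sigma> b)) * KK (\<sigma> a) (\<sigma> b) (subst \<sigma> e p)"
    using c by (simp only: mult_cancel_left) blast
  then show ?thesis
    using TT_unique[OF \<open>\<sigma> a \<noteq> \<sigma> b\<close>] by metis
qed

lemma KK_TT_eq:
  assumes "a \<noteq> b"
  shows "(xx b - xx a) * KK a b (TT a b p) = (1 - cc tt) * xx a * KK a b p + (cc tt * xx b - xx a) * p"
proof -
  have "KK a b ((xx a - xx b) * TT a b p) =
      KK a b ((1 - cc tt) * xx b * p + (cc tt * xx a - xx b) * KK a b p)"
    by (simp add: TT_eq)
  moreover have "KK a b 1 = 1"
    by (simp add: KK_def)
  ultimately show ?thesis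
    by (simp add: KK_mult KK_diff KK_add KK_xx)
qed

text \<open>Once the values are treated as free unknowns tied by their characterizing equations, a
  relation for \<open>T\<close> is a polynomial identity. Here \<open>X = T p\<close>,
  \<open>K = K p\<close>, \<open>Y = K (T p)\<close> and \<open>Z = T (T p)\<close>.\<close>

lemma quadratic_relation_aux:
  fixes A B t p X Y Z K :: "'a::idom"
  assumes "(A - B) * X = (1 - t) * B * p + (t * A - B) * K"
    and "(B - A) * Y = (1 - t) * A * K + (t * B - A) * p"
    and "(A - B) * Z = (1 - t) * B * X + (t * A - B) * Y"
  shows "(A - B) * ((A - B) * Z) = (A - B) * ((A - B) * ((t - 1) * X + t * p))"
  using assms by algebra

lemma TT_xx_TT_aux:
  fixes A B t p X Y Z K :: "'a::idom"
  assumes "(A - B) * X = (1 - t) * B * p + (t * A - B) * K"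
    and "(B - A) * Y = (1 - t) * A * K + (t * B - A) * p"
    and "(A - B) * Z = (1 - t) * B * (A * X) + (t * A - B) * (B * Y)"
  shows "(A - B) * ((A - B) * Z) = (A - B) * ((A - B) * (t * B * p))"
  using assms by algebra

text \<open>One side of the braid relation, expanded in the six images of \<open>p\<close> under
  permutations of the three variables. The \<open>k\<close> are images of intermediate results:
  \<open>k1\<close> and \<open>k2\<close> of \<open>u1\<close> under the two exchanges,
  \<open>k12\<close> under both, and \<open>k2u1\<close> of \<open>u2\<close>. The factor on the
  left is the common denominator.\<close>

lemma braid_relation_aux1:
  fixes A B C t p f1 f2 f12 f21 f121 u1 u2 u3 k1 k2 k12 k2u1 :: "'a::idom"
  assumes u1: "(A - B) * u1 = (1 - t) * B * p + (t * A - B) * f1"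
    and u1_2: "(A - C) * k2 = (1 - t) * C * f2 + (t * A - C) * f21"
    and u1_1: "(B - A) * k1 = (1 - t) * A * f1 + (t * B - A) * p"
    and u1_12: "(B - C) * k12 = (1 - t) * C * f12 + (t * B - C) * f121"
    and u2_1: "(A - C) * k2u1 = (1 - t) * C * k1 + (t * A - C) * k12"
    and u2: "(B - C) * u2 = (1 - t) * C * u1 + (t * B - C) * k2"
    and u3: "(A - B) * u3 = (1 - t) * B * u2 + (t * A - B) * k2u1"
  shows "(A - B) * (A - B) * (B - C) * (A - C) * u3 =
      (1 - t) * B * ((A - C) * (1 - t) * C * ((1 - t) * B * p + (t * A - B) * f1)
                  + (A - B) * (t * B - C) * ((1 - t) * C * f2 + (t * A - C) * f21))
    + (t * A - B) * (- (B - C) * (1 - t) * C * ((1 - t) * A * f1 + (t * B - A) * p)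
                  + (A - B) * (t * A - C) * ((1 - t) * C * f12 + (t * B - C) * f121))"
proof -
  have "(A - B) * (A - B) * (B - C) * (A - C) * u3 = (A - B) * (B - C) * (A - C) * ((A - B) * u3)" by (simp only: mult_ac)
  also have "\<dots> = (A - B) * ((1 - t) * B * (A - C) * ((B - C) * u2) + (t * A - B) * (B - C) * ((A - C) * k2u1))"
    unfolding u3 by (simp only: distrib_left mult_ac)
  also have "\<dots> = (1 - t) * B * ((A - C) * (1 - t) * C * ((A - B) * u1) + (A - B) * (t * B - C) * ((A - C) * k2))
   + (t * A - B) * (- (B - C) * (1 - t) * C * ((B - A) * k1) + (A - B) * (t * A - C) * ((B - C) * k12))"
    unfolding u2 u2_1 by algebra
  finally show ?thesis unfolding u1 u1_1 u1_12 u1_2 .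
qed

lemma braid_relation_aux2:
  fixes A B C t p f1 f2 f12 f21 f121 v1 v2 v3 k1 k2 k21 k2v :: "'a::idom"
  assumes v1: "(B - C) * v1 = (1 - t) * C * p + (t * B - C) * f2"
    and v1_1: "(A - C) * k1 = (1 - t) * C * f1 + (t * A - C) * f12"
    and v1_2: "(C - B) * k2 = (1 - t) * B * f2 + (t * C - B) * p"
    and v1_21: "(A - B) * k21 = (1 - t) * B * f21 + (t * A - B) * f121"
    and v2_2: "(A - C) * k2v = (1 - t) * C * k2 + (t * A - C) * k21"
    and v2: "(A - B) * v2 = (1 - t) * B * v1 + (t * A - B) * k1"
    and v3: "(B - C) * v3 = (1 - t) * C * v2 + (t * B - C) * k2v"
  shows "(B - C) * (B - C) * (A - B) * (A - C) * v3 =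
      (1 - t) * C * ((A - C) * (1 - t) * B * ((1 - t) * C * p + (t * B - C) * f2)
                  + (B - C) * (t * A - B) * ((1 - t) * C * f1 + (t * A - C) * f12))
    + (t * B - C) * (- (A - B) * (1 - t) * C * ((1 - t) * B * f2 + (t * C - B) * p)
                  + (B - C) * (t * A - C) * ((1 - t) * B * f21 + (t * A - B) * f121))"
proof -
  have "(B - C) * (B - C) * (A - B) * (A - C) * v3 = (B - C) * (A - B) * (A - C) * ((B - C) * v3)"
    by (simp only: mult_ac)
  also have "\<dots> = (B - C) * ((1 - t) * C * (A - C) * ((A - B) * v2) + (t * B - C) * (A - B) * ((A - C) * k2v))"
    unfolding v3 by (simp only: distrib_left mult_ac)
  also have "\<dots> = (1 - t) * C * ((A - C) * (1 - t) * B * ((B - C) * v1) + (B - C) * (t * A - B) * ((A - C) * k1))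
   + (t * B - C) * (- (A - B) * (1 - t) * C * ((C - B) * k2) + (B - C) * (t * A - C) * ((A - B) * k21))"
    unfolding v2 v2_2 by algebra
  finally show ?thesis unfolding v1 v1_1 v1_2 v1_21 .
qed

lemma braid_relation_aux3:
  fixes A B C t p f1 f2 f12 f21 f121 :: "'a::idom"
  shows "(B - C) * (
      (1 - t) * B * ((A - C) * (1 - t) * C * ((1 - t) * B * p + (t * A - B) * f1)
                  + (A - B) * (t * B - C) * ((1 - t) * C * f2 + (t * A - C) * f21))
    + (t * A - B) * (- (B - C) * (1 - t) * C * ((1 - t) * A * f1 + (t * B - A) * p)
                  + (A - B) * (t * A - C) * ((1 - t) * C * f12 + (t * B - C) * f121)))
  = (A - B) * (
      (1 - t) * C * ((A - C) * (1 - t) * B * ((1 - t) * C * p + (t * B - C) * f2)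
                  + (B - C) * (t * A - B) * ((1 - t) * C * f1 + (t * A - C) * f12))
    + (t * B - C) * (- (A - B) * (1 - t) * C * ((1 - t) * B * f2 + (t * C - B) * p)
                  + (B - C) * (t * A - C) * ((1 - t) * B * f21 + (t * A - B) * f121)))"
  by algebra
lemma TT_quadratic:
  assumes "a \<noteq> b"
  shows "TT a b (TT a b p) = (cc tt - 1) * TT a b p + cc tt * p"
proof -
  note 1 = TT_eq[of a b p] and 2 = KK_TT_eq[OF assms, of p] and 3 = TT_eq[of a b "TT a b p"]
  have "(xx a - xx b) * ((xx a - xx b) * TT a b (TT a b p)) =
    (xx a - xx b) * ((xx a - xx b) * ((cc tt - 1) * TT a b p + cc tt * p))"
    by (rule quadratic_relation_aux[OF 1 2 3])
  then show ?thesis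
    using mult_cancel_xx_diff[OF assms] by blast
qed

text \<open>The cross relation of the affine Hecke algebra. It is what allows a variable to pass
  through an operator that acts on it.\<close>

lemma TT_xx_TT:
  assumes "a \<noteq> b"
  shows "TT a b (xx a * TT a b p) = cc tt * xx b * p"
proof -
  note 1 = TT_eq[of a b p] and 2 = KK_TT_eq[OF assms, of p] and 3 = TT_eq[of a b "xx a * TT a b p"]
  have "KK a b (xx a * TT a b p) = xx b * KK a b (TT a b p)"
    by (simp add: KK_mult KK_xx)
  with 3 have 4: "(xx a - xx b) * TT a b (xx a * TT a b p) =
      (1 - cc tt) * xx b * (xx a * TT a b p) + (cc tt * xx a - xx b) * (xx b * KK a b (TT a b p))"
    by simp
  have "(xx a - xx b) * ((xx a - xx b) * TT a b (xx a * TT a b p)) =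
    (xx a - xx b) * ((xx a - xx b) * (cc tt * xx b * p))"
    by (rule TT_xx_TT_aux[OF 1 2 4])
  then show ?thesis
    using mult_cancel_xx_diff[OF assms] by blast
qed

text \<open>The difference \<open>T p - t p\<close> is \<open>K p - p\<close> times
  \<open>(t x_a - x_b) / (x_a - x_b)\<close>, whose numerator does not vanish.\<close>

lemma TT_fixed_iff:
  assumes "a \<noteq> b" "TT a b p = cc tt * p"
  shows "KK a b p = p"
proof -
  have "lookup (cc tt * xx a - xx b) (single b 1) = -1"
    using assms(1) by (simp add: lookup_minus) (simp add: xx_def lookup_single when_def)
  then have nz: "cc tt * xx a - xx b \<noteq> 0"
    by (metis lookup_zero zero_neq_neg_one)
  have "(cc tt * xx a - xx b) * (KK a b p - p)
      = ((1 - cc tt) * xx b * p + (cc tt * xx a - xx b) * KK a b p) - (xx a - xx b) * (cc tt * p)"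
    by (simp add: algebra_simps)
  then have "(cc tt * xx a - xx b) * (KK a b p - p) = 0"
    using TT_eq[of a b p] unfolding assms(2) by simp
  then show ?thesis using nz by simp
qed

lemma TT_commute:
  assumes "a \<noteq> b" "c \<noteq> d" "{a, b} \<inter> {c, d} = {}"
  shows "TT a b (TT c d p) = TT c d (TT a b p)"
proof -
  have "KK a b ((xx c - xx d) * TT c d p) =
      KK a b ((1 - cc tt) * xx d * p + (cc tt * xx c - xx d) * KK c d p)"
    by (simp add: TT_eq)
  moreover have "KK a b 1 = 1"
    by (simp add: KK_def)
  ultimately have "(xx c - xx d) * KK a b (TT c d p) =
      (1 - cc tt) * xx d * KK a b p + (cc tt * xx c - xx d) * KK c d (KK a b p)"
    using assms subst_KK[of "transpose a b" "\<lambda>_. 0" c d p]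
    by (simp add: KK_mult KK_diff KK_add KK_xx transpose_apply_other flip: KK_def)
  then have 1: "KK a b (TT c d p) = TT c d (KK a b p)"
    using TT_unique[OF assms(2)] by metis
  have "TT c d (TT a b p) = TT a b (TT c d p)" if "(xx a - xx b) * TT c d (TT a b p) =
      (xx a - xx b) * TT a b (TT c d p)"
    using mult_cancel_xx_diff[OF assms(1)] that by blast
  moreover have "(xx a - xx b) * TT c d (TT a b p) = TT c d ((xx a - xx b) * TT a b p)"
    using assms by (intro TT_mult_sym[symmetric]) (simp_all add: KK_diff KK_xx transpose_apply_other)
  moreover have "\<dots> = (1 - cc tt) * xx b * TT c d p + (cc tt * xx a - xx b) * KK a b (TT c d p)"
  proof -
    have "KK c d 1 = 1" by (simp add: KK_def)
    then show ?thesis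
      unfolding TT_eq 1 using assms
      by (simp add: TT_add) (simp add: TT_mult_sym KK_diff KK_mult KK_xx transpose_apply_other)
  qed
  ultimately show ?thesis
    by (simp add: TT_eq)
qed

lemma TT_braid:
  assumes "a \<noteq> b" "b \<noteq> c" "a \<noteq> c"
  shows "TT a b (TT b c (TT a b p)) = TT b c (TT a b (TT b c p))"
proof -
  have KK1: "KK i j 1 = 1" for i j by (simp add: KK_def)
  note hom = KK_mult KK_diff KK_add KK_xx KK1 KK_cc
  have tr: "transpose a b a = b" "transpose a b b = a" "transpose a b c = c"
      "transpose b c a = a" "transpose b c b = c" "transpose b c c = b"
    using assms by (auto simp: transpose_def)
  have app1: "KK a b p = KK a b r" and app2: "KK b c p = KK b c r" if "p = r" for p r
    using that by simp_all
  define f1 f2 f12 f21 f121 where "f1 = KK a b p" and "f2 = KK b c p" and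
    "f12 = KK a b f2" and "f21 = KK b c f1" and "f121 = KK a b f21"
  \<comment> \<open>This closes the list of the six images of \<open>p\<close>. The last one,
    \<open>f121\<close>, is reached along both reduced words, because both composites of three
    exchanges equal the exchange of \<open>a\<close> and \<open>c\<close>.\<close>
  have ids: "KK a b f1 = p" "KK b c f2 = p" "KK b c f12 = f121" "KK b c f21 = f1" "KK a b f12 = f2"
  proof -
    have "KK b c (KK a b (KK b c p)) = KK a c p"
      using subst_KK[of "transpose b c" "\<lambda>_. 0" a b "KK b c p"] tr by (simp flip: KK_def)
    moreover have "KK a b (KK b c (KK a b p)) = KK a c p"
      using subst_KK[of "transpose a b" "\<lambda>_. 0" b c "KK a b p"] tr by (simp flip: KK_def)
    ultimately have "KK b c (KK a b (KK b c p)) = KK a b (KK b c (KK a b p))"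
      by simp
    then show "KK b c f12 = f121"
      by (simp add: f12_def f2_def f121_def f21_def f1_def)
  qed (simp_all add: f1_def f2_def f12_def f21_def)
  define t A B C where "t = cc tt" and "A = xx a" and "B = xx b" and "C = xx c"
  define u1 v1 where "u1 = TT a b p" and "v1 = TT b c p"
  define u2 v2 where "u2 = TT b c u1" and "v2 = TT a b v1"
  define u3 v3 where "u3 = TT a b u2" and "v3 = TT b c v2"
  have u1: "(A - B) * u1 = (1 - t) * B * p + (t * A - B) * f1"
    using TT_eq[of a b p] by (simp add: u1_def f1_def t_def A_def B_def C_def)
  have v1: "(B - C) * v1 = (1 - t) * C * p + (t * B - C) * f2"
    using TT_eq[of b c p] by (simp add: v1_def f2_def t_def A_def B_def C_def)
  have u2: "(B - C) * u2 = (1 - t) * C * u1 + (t * B - C) * KK b c u1"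
    using TT_eq[of b c u1] by (simp add: u2_def t_def A_def B_def C_def)
  have v2: "(A - B) * v2 = (1 - t) * B * v1 + (t * A - B) * KK a b v1"
    using TT_eq[of a b v1] by (simp add: v2_def t_def A_def B_def C_def)
  have u3: "(A - B) * u3 = (1 - t) * B * u2 + (t * A - B) * KK a b u2"
    using TT_eq[of a b u2] by (simp add: u3_def t_def A_def B_def C_def)
  have v3: "(B - C) * v3 = (1 - t) * C * v2 + (t * B - C) * KK b c v2"
    using TT_eq[of b c v2] by (simp add: v3_def t_def A_def B_def C_def)
  have u1_2: "(A - C) * KK b c u1 = (1 - t) * C * f2 + (t * A - C) * f21"
    using app2[OF u1] by (simp add: hom tr A_def B_def C_def t_def ids f2_def f21_def)
  have u1_1: "(B - A) * KK a b u1 = (1 - t) * A * f1 + (t * B - A) * p"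
    using app1[OF u1] by (simp add: hom tr A_def B_def C_def t_def ids f1_def)
  have u1_12: "(B - C) * KK a b (KK b c u1) = (1 - t) * C * f12 + (t * B - C) * f121"
    using app1[OF u1_2] by (simp add: hom tr A_def B_def C_def t_def f121_def f12_def)
  have u2_1: "(A - C) * KK a b u2 = (1 - t) * C * KK a b u1 + (t * A - C) * KK a b (KK b c u1)"
    using app1[OF u2] by (simp add: hom tr A_def B_def C_def t_def)
  have v1_1: "(A - C) * KK a b v1 = (1 - t) * C * f1 + (t * A - C) * f12"
    using app1[OF v1] by (simp add: hom tr A_def B_def C_def t_def f12_def f1_def)
  have v1_2: "(C - B) * KK b c v1 = (1 - t) * B * f2 + (t * C - B) * p"
    using app2[OF v1] by (simp add: hom tr A_def B_def C_def t_def ids f2_def)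
  have v1_21: "(A - B) * KK b c (KK a b v1) = (1 - t) * B * f21 + (t * A - B) * f121"
    using app2[OF v1_1] by (simp add: hom tr A_def B_def C_def t_def ids f21_def)
  have v2_2: "(A - C) * KK b c v2 = (1 - t) * C * KK b c v1 + (t * A - C) * KK b c (KK a b v1)"
    using app2[OF v2] by (simp add: hom tr A_def B_def C_def t_def)
  let ?V = "(A - B) * (A - B) * (B - C) * (B - C) * (A - C)"
  have "?V * u3 = (B - C) * ((A - B) * (A - B) * (B - C) * (A - C) * u3)"
    by (simp only: mult_ac)
  also have "\<dots> = (A - B) * ((B - C) * (B - C) * (A - B) * (A - C) * v3)"
    unfolding braid_relation_aux1[OF u1 u1_2 u1_1 u1_12 u2_1 u2 u3]
      braid_relation_aux2[OF v1 v1_1 v1_2 v1_21 v2_2 v2 v3]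
    by (rule braid_relation_aux3)
  also have "\<dots> = ?V * v3"
    by (simp only: mult_ac)
  finally have "?V * u3 = ?V * v3" .
  moreover have "?V \<noteq> 0"
    using assms xx_diff_nonzero[of a b] xx_diff_nonzero[of b c] xx_diff_nonzero[of a c]
    by (simp add: A_def B_def C_def)
  ultimately have "u3 = v3" by (simp only: mult_cancel_left) blast
  then show ?thesis
    by (simp add: u3_def u2_def u1_def v3_def v2_def v1_def)
qed

text \<open>The inverse read off from the quadratic relation
  \<open>T^2 = (t - 1) T + t\<close>.\<close>

definition TI :: "nat \<Rightarrow> nat \<Rightarrow> mpol \<Rightarrow> mpol" where
  "TI a b p = cc (inverse tt) * (TT a b p + cc (1 - tt) * p)"

lemma cc_inverse_mult [simp]: "c \<noteq> 0 \<Longrightarrow> cc (inverse c) * (cc c * p) = p"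
  "c \<noteq> 0 \<Longrightarrow> cc c * (cc (inverse c) * p) = p"
  by (simp_all flip: mult.assoc cc_simps(6)) (simp_all add: cc_simps(2))

lemma TI_eq_iff:
  shows "TI a b p = r \<longleftrightarrow> TT a b p + cc (1 - tt) * p = cc tt * r"
proof -
  have "cc (inverse tt) * u = r \<longleftrightarrow> u = cc tt * r" for u
    by (metis cc_inverse_mult tt_nonzero)
  then show ?thesis unfolding TI_def .
qed

lemma TI_add: "a \<noteq> b \<Longrightarrow> TI a b (p + r) = TI a b p + TI a b r"
  by (simp add: TI_def TT_add algebra_simps)

lemma TI_mult_sym: "a \<noteq> b \<Longrightarrow> KK a b e = e \<Longrightarrow> TI a b (e * p) = e * TI a b p"
  by (simp add: TI_def TT_mult_sym algebra_simps)

lemma TI_cc: "a \<noteq> b \<Longrightarrow> TI a b (cc c * p) = cc c * TI a b p"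
  by (rule TI_mult_sym) simp_all

lemma TT_TI [simp]:
  assumes "a \<noteq> b"
  shows "TT a b (TI a b p) = p"
proof -
  have "TT a b (TI a b p) = cc (inverse tt) * (TT a b (TT a b p) + cc (1 - tt) * TT a b p)"
    by (simp only: TI_def TT_cc[OF assms] TT_add[OF assms])
  also have "TT a b (TT a b p) + cc (1 - tt) * TT a b p = cc tt * p"
    using assms by (simp add: TT_quadratic cc_simps algebra_simps)
  finally show ?thesis by simp
qed

lemma TI_TT [simp]: "a \<noteq> b \<Longrightarrow> TI a b (TT a b p) = p"
  unfolding TI_eq_iff by (simp add: TT_quadratic cc_simps algebra_simps)

lemma TI_subst:
  assumes "bij \<sigma>" "e a = e b" "a \<noteq> b"
  shows "subst \<sigma> e (TI a b p) = TI (\<sigma> a) (\<sigma> b) (subst \<sigma> e p)"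
  using assms by (simp add: TI_def subst_mult subst_add TT_subst)

lemma TI_fixed:
  assumes "a \<noteq> b" "TT a b p = cc tt * p"
  shows "TI a b p = cc (inverse tt) * p"
  by (simp add: TI_def assms cc_simps algebra_simps)

lemma TT_TI_commute:
  assumes "a \<noteq> b" "c \<noteq> d" "{a, b} \<inter> {c, d} = {}"
  shows "TT a b (TI c d p) = TI c d (TT a b p)"
  using assms by (simp add: TI_def TT_cc TT_add TT_commute[of a b c d])

lemma TI_mult_xx:
  assumes "a \<noteq> b"
  shows "TI a b (xx b * p) = cc (inverse tt) * (xx a * TT a b p)"
proof -
  have "TT a b (xx a * TT a b p) = cc tt * (xx b * p)"
    using TT_xx_TT[OF assms, of p] by (simp add: mult.assoc)
  then have "TI a b (cc tt * (xx b * p)) = xx a * TT a b p"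
    using assms by (metis TI_TT)
  then show ?thesis
    using assms by (metis TI_cc cc_inverse_mult(1) tt_nonzero)
qed

section \<open>The bar involution on polynomials\<close>

definition mbar :: "mpol \<Rightarrow> mpol" where
  "mbar p = Poly_Mapping.map bar_coef p"

lemma lookup_mbar: "lookup (mbar p) = bar (lookup p)"
  by (auto simp: mbar_def bar_def map.rep_eq when_def)

lemma mbar_add: "mbar (p + r) = mbar p + mbar r"
  by (intro poly_mapping_eqI) (simp add: lookup_mbar bar_def lookup_add)

lemma mbar_single: "mbar (single \<nu> c) = single \<nu> (bar_coef c)"
  by (intro poly_mapping_eqI) (simp add: lookup_mbar bar_def lookup_single when_def)

lemma mbar_mult: "mbar (p * r) = mbar p * mbar r"
proof (induction p rule: poly_mapping_induct_single)
  case (single \<mu> c)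
  show ?case
    by (induction r rule: poly_mapping_induct_single)
      (simp_all add: mult_single mbar_single mbar_add algebra_simps)
qed (simp add: mbar_add algebra_simps)

lemma mbar_cc [simp]: "mbar (cc c) = cc (bar_coef c)"
  by (simp add: cc_def mbar_single)

lemma mbar_xx [simp]: "mbar (xx i) = xx i"
  by (simp add: xx_def mbar_single)

lemma mbar_0 [simp]: "mbar 0 = 0" and mbar_1 [simp]: "mbar 1 = 1"
  using mbar_cc[of 0] mbar_cc[of 1] by (simp_all add: cc_simps)

lemma mbar_diff: "mbar (p - r) = mbar p - mbar r"
  using mbar_add[of "p - r" r] by (simp add: algebra_simps)

lemma mbar_subst: "bij \<sigma> \<Longrightarrow> mbar (subst \<sigma> e p) = subst \<sigma> (\<lambda>j. - e j) (mbar p)"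
  by (intro poly_mapping_eqI)
    (simp add: lookup_mbar bar_def lookup_subst wt_minus_fun power_int_minus power_int_inverse)

lemma mbar_KK: "mbar (KK a b p) = KK a b (mbar p)"
  by (simp add: KK_def mbar_subst)

lemma TI_unique:
  assumes "a \<noteq> b"
    "(xx a - xx b) * r = cc (inverse tt) * ((1 - cc tt) * xx a * p + (cc tt * xx a - xx b) * KK a b p)"
  shows "TI a b p = r"
proof -
  have "(xx a - xx b) * (TT a b p + cc (1 - tt) * p) = (xx a - xx b) * (cc tt * r)"
  proof -
    have "(xx a - xx b) * (cc tt * r) = cc tt * ((xx a - xx b) * r)"
      by (simp only: mult_ac)
    also have "\<dots> = (1 - cc tt) * xx a * p + (cc tt * xx a - xx b) * KK a b p"
      by (simp add: assms(2))
    finally show ?thesis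
      unfolding distrib_left TT_eq by (simp add: cc_simps algebra_simps)
  qed
  then show ?thesis
    unfolding TI_eq_iff using mult_cancel_xx_diff[OF assms(1)] by blast
qed

text \<open>Barring turns the numerator \<open>t x_a - x_b\<close> into
  \<open>-t^-1 (t x_b - x_a)\<close>, the numerator belonging to the reversed pair. This is why the
  indices come out exchanged and why a reversal of the variables must enter later.\<close>

lemma mbar_TT:
  assumes "a \<noteq> b"
  shows "mbar (TT a b p) = TI b a (mbar p)"
proof (rule TI_unique[symmetric])
  have "mbar ((xx a - xx b) * TT a b p) =
      (1 - cc (inverse tt)) * xx b * mbar p + (cc (inverse tt) * xx a - xx b) * KK a b (mbar p)"
    unfolding TT_eq by (simp add: mbar_mult mbar_add mbar_diff mbar_KK)
  then have 1: "(xx a - xx b) * mbar (TT a b p) =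
      (1 - cc (inverse tt)) * xx b * mbar p + (cc (inverse tt) * xx a - xx b) * KK a b (mbar p)"
    by (simp add: mbar_mult mbar_diff)
  have "(xx b - xx a) * mbar (TT a b p) = - ((xx a - xx b) * mbar (TT a b p))"
    by (simp add: algebra_simps)
  also have "\<dots> = (cc (inverse tt) - 1) * xx b * mbar p + (xx b - cc (inverse tt) * xx a) * KK a b (mbar p)"
    unfolding 1 by (simp add: algebra_simps)
  also have "\<dots> = cc (inverse tt) * ((1 - cc tt) * xx b * mbar p + (cc tt * xx b - xx a) * KK b a (mbar p))"
  proof -
    have "cc (inverse tt) * cc tt = 1"
      by (simp add: cc_simps(2) flip: cc_simps(6))
    then show ?thesis
      unfolding KK_commute[of b a] by algebra
  qed
  finally show "(xx b - xx a) * mbar (TT a b p) =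
      cc (inverse tt) * ((1 - cc tt) * xx b * mbar p + (cc tt * xx b - xx a) * KK b a (mbar p))" .
qed (use assms in simp)

section \<open>Comparison with the operators on series\<close>

text \<open>Comparing the coefficients at \<open>\<mu> + single (Suc i) 1\<close> expresses the one
  of \<open>g\<close> at \<open>\<mu>\<close> through one with a smaller exponent of
  \<open>x_i\<close>, so the induction runs on that exponent.\<close>

lemma mult_var_diff_inject:
  assumes "\<And>\<mu>. mult_var i g \<mu> - mult_var (Suc i) g \<mu> = mult_var i h \<mu> - mult_var (Suc i) h \<mu>"
  shows "g = h"
proof
  fix \<mu>
  show "g \<mu> = h \<mu>"
  proof (induction "lookup \<mu> i" arbitrary: \<mu>)
    case 0
    let ?\<nu> = "\<mu> + single (Suc i) 1"
    have "lookup ?\<nu> i = 0" "lookup ?\<nu> (Suc i) \<noteq> 0"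
      using 0 by (simp_all add: lookup_add lookup_single)
    then show ?case
      using assms[of ?\<nu>] by (simp add: mult_var_def)
  next
    case (Suc n)
    let ?\<nu> = "\<mu> + single (Suc i) 1"
    have nz: "lookup ?\<nu> i \<noteq> 0" "lookup ?\<nu> (Suc i) \<noteq> 0"
      using Suc(2)[symmetric] by (simp_all add: lookup_add lookup_single)
    have "g (?\<nu> - single i 1) = h (?\<nu> - single i 1)"
      by (rule Suc(1)) (use Suc(2)[symmetric] in \<open>simp add: lookup_add lookup_minus lookup_single\<close>)
    then show ?case
      using assms[of ?\<nu>] nz by (simp add: mult_var_def)
  qed
qed

lemma div_diff_eqI:
  assumes "\<And>\<mu>. mult_var i g \<mu> - mult_var (Suc i) g \<mu> = f \<mu>"
  shows "div_diff i f = g"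
  unfolding div_diff_def
  by (rule the_equality) (use assms mult_var_diff_inject[of i _ g] in auto)

lemma T_op_lookup: "T_op i (lookup p) = lookup (TT i (Suc i) p)"
proof -
  have "div_diff i (\<lambda>\<mu>. K_op i (Suc i) (lookup p) \<mu> - lookup p \<mu>) = lookup (dd i (Suc i) p)"
  proof (rule div_diff_eqI)
    fix \<mu>
    have "lookup ((xx i - xx (Suc i)) * dd i (Suc i) p) \<mu> = lookup (KK i (Suc i) p - p) \<mu>"
      by (simp add: dd_eq)
    then show "mult_var i (lookup (dd i (Suc i) p)) \<mu> - mult_var (Suc i) (lookup (dd i (Suc i) p)) \<mu> =
       K_op i (Suc i) (lookup p) \<mu> - lookup p \<mu>"
      by (simp add: left_diff_distrib lookup_minus lookup_xx_mult lookup_KK)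
  qed
  then show ?thesis
    by (intro ext)
      (simp add: T_op_def Let_def TT_def lookup_add left_diff_distrib lookup_minus lookup_xx_mult mult.assoc)
qed

lemma tau_op_lookup: "tau_op i (lookup p) = lookup (subst id (\<lambda>j. of_bool (j = i)) p)"
proof -
  have "wt (\<lambda>j. of_bool (j = i)) \<mu> = int (lookup \<mu> i)" for \<mu>
    by (simp add: wt_eq_sum[of "insert i (keys \<mu>)"] of_bool_def if_distrib[of "\<lambda>x. x * _"]
        subset_insertI sum.delta cong: if_cong)
  then show ?thesis
    by (auto simp: tau_op_def lookup_subst)
qed

section \<open>The action on monomials\<close>

text \<open>The strict interior of the segment from \<open>\<nu>\<close> to its image under the
  exchange. It carries the terms of \<open>TT a b\<close> on a monomial other than the two end
  points.\<close>

definition inner :: "nat \<Rightarrow> nat \<Rightarrow> mono \<Rightarrow> mono set" where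
  "inner a b \<nu> = {\<kappa>. (\<forall>j. j \<noteq> a \<and> j \<noteq> b \<longrightarrow> lookup \<kappa> j = lookup \<nu> j) \<and>
     lookup \<kappa> a + lookup \<kappa> b = lookup \<nu> a + lookup \<nu> b \<and>
     min (lookup \<nu> a) (lookup \<nu> b) < lookup \<kappa> a \<and> lookup \<kappa> a < max (lookup \<nu> a) (lookup \<nu> b)}"

abbreviation swap_mono :: "nat \<Rightarrow> nat \<Rightarrow> mono \<Rightarrow> mono" where
  "swap_mono a b \<equiv> permute_mono (transpose a b)"

lemma lookup_swap_mono: "lookup (swap_mono a b \<nu>) j = lookup \<nu> (transpose a b j)"
  by (simp add: lookup_permute_mono)

lemma swap_mono_swap_mono [simp]: "swap_mono a b (swap_mono a b \<nu>) = \<nu>"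
  by (simp add: permute_mono_comp)

lemma inner_swap_mono: "inner a b (swap_mono a b \<nu>) = inner a b \<nu>"
  by (auto simp: inner_def lookup_swap_mono transpose_apply_other)

lemma swap_mono_inner: "\<kappa> \<in> inner a b \<nu> \<Longrightarrow> swap_mono a b \<kappa> \<in> inner a b \<nu>"
  by (auto simp: inner_def lookup_swap_mono transpose_apply_other)

lemma KK_single: "KK a b (single \<nu> c) = single (swap_mono a b \<nu>) c"
  by (simp add: KK_def subst_single)

lemma keys_KK: "keys (KK a b p) = swap_mono a b ` keys p"
proof -
  have "lookup (KK a b p) \<mu> = lookup p (swap_mono a b \<mu>)" for \<mu>
    by (simp add: lookup_KK K_op_def)
  then show ?thesis
    by (force simp: in_keys_iff image_iff)
qed

lemma keys_cc_mult: "keys (cc c * p) \<subseteq> keys p"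
  by (auto simp: in_keys_iff)

lemma keys_sum_subset: "(\<And>i. i \<in> I \<Longrightarrow> keys (f i) \<subseteq> S) \<Longrightarrow> keys (sum f I) \<subseteq> S"
  for f :: "'i \<Rightarrow> 'a \<Rightarrow>\<^sub>0 'b::comm_monoid_add"
proof (induction I rule: infinite_finite_induct)
  case (insert x F)
  then show ?case using keys_add[of "f x" "sum f F"] by auto
qed auto

lemma keys_diff_subset: "keys (p - r) \<subseteq> keys p \<union> keys r" for p r :: mpol
  by (auto simp: in_keys_iff lookup_minus)

lemma mult_pow_diff_sum:
  fixes A B :: "'a::comm_ring_1"
  shows "(A - B) * (A * B * (\<Sum>i<m. B ^ (m - Suc i) * A ^ i)) = A ^ Suc m * B - A * B ^ Suc m"
proof -
  have "(A - B) * (\<Sum>i<m. B ^ (m - Suc i) * A ^ i) = A ^ m - B ^ m"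
    by (rule power_diff_sumr2[symmetric])
  then have "A * B * ((A - B) * (\<Sum>i<m. B ^ (m - Suc i) * A ^ i)) = A * B * (A ^ m - B ^ m)"
    by simp
  then show ?thesis
    by (simp only: mult_ac right_diff_distrib power_Suc)
qed

text \<open>Every monomial is one symmetric in \<open>x_a, x_b\<close> times a power of one of these
  variables, so these two values determine \<open>TT a b\<close> on monomials. Here \<open>h\<close>
  collects the mixed monomials of degree \<open>m + 1\<close>.\<close>

lemma TT_xx_power:
  fixes m :: nat
  assumes "a \<noteq> b"
  defines "h \<equiv> xx a * xx b * (\<Sum>i<m. xx b ^ (m - Suc i) * xx a ^ i)"
  shows "TT a b (xx a ^ Suc m) = xx b ^ Suc m + (1 - cc tt) * h"
    and "TT a b (xx b ^ Suc m) = (cc tt - 1) * xx b ^ Suc m + cc tt * xx a ^ Suc m + (cc tt - 1) * h"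
proof -
  have KK_pow: "KK a b (xx i ^ k) = xx (transpose a b i) ^ k" for i k
    by (induction k) (simp_all add: KK_mult KK_xx, simp add: KK_def)
  have h: "(xx a - xx b) * h = xx a ^ Suc m * xx b - xx a * xx b ^ Suc m"
    unfolding h_def by (rule mult_pow_diff_sum)
  have "(xx a - xx b) * (xx b ^ Suc m + (1 - cc tt) * h) = (xx a - xx b) * xx b ^ Suc m + (1 - cc tt) * ((xx a - xx b) * h)"
    by (simp only: distrib_left mult_ac)
  also have "\<dots> = (1 - cc tt) * xx b * xx a ^ Suc m + (cc tt * xx a - xx b) * KK a b (xx a ^ Suc m)"
    unfolding h KK_pow transpose_apply_first by algebra
  finally show "TT a b (xx a ^ Suc m) = xx b ^ Suc m + (1 - cc tt) * h"
    by (rule TT_unique[OF assms(1)])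
  have "(xx a - xx b) * ((cc tt - 1) * xx b ^ Suc m + cc tt * xx a ^ Suc m + (cc tt - 1) * h) =
     (xx a - xx b) * ((cc tt - 1) * xx b ^ Suc m + cc tt * xx a ^ Suc m) + (cc tt - 1) * ((xx a - xx b) * h)"
    by (simp only: distrib_left mult_ac)
  also have "\<dots> = (1 - cc tt) * xx b * xx b ^ Suc m + (cc tt * xx a - xx b) * KK a b (xx b ^ Suc m)"
    unfolding h KK_pow transpose_apply_second by algebra
  finally show "TT a b (xx b ^ Suc m) = (cc tt - 1) * xx b ^ Suc m + cc tt * xx a ^ Suc m + (cc tt - 1) * h"
    by (rule TT_unique[OF assms(1)])
qed

text \<open>The part of \<open>TT a b\<close> applied to a monomial that is supported on the two end
  points of the segment.\<close>

definition TT_lead :: "nat \<Rightarrow> nat \<Rightarrow> mono \<Rightarrow> mpol" where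
  "TT_lead a b \<nu> =
    (if lookup \<nu> b < lookup \<nu> a then single (swap_mono a b \<nu>) 1
     else if lookup \<nu> a < lookup \<nu> b then single \<nu> (tt - 1) + single (swap_mono a b \<nu>) tt
     else single \<nu> tt)"

lemma keys_TT_single:
  assumes "a \<noteq> b"
  shows "keys (TT a b (single \<nu> 1) - TT_lead a b \<nu>) \<subseteq> inner a b \<nu>"
proof (cases "lookup \<nu> a = lookup \<nu> b")
  case True
  then have "swap_mono a b \<nu> = \<nu>"
    by (intro poly_mapping_eqI) (auto simp: lookup_swap_mono transpose_def)
  then have "TT a b (single \<nu> 1) = single \<nu> tt"
    using TT_fixed[OF assms, of "single \<nu> 1"] single_conv_cc[of \<nu> tt] by (simp add: KK_single)
  then show ?thesis
    using True by (simp add: TT_lead_def)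
next
  case False
  define lo where "lo = min (lookup \<nu> a) (lookup \<nu> b)"
  define m where "m = max (lookup \<nu> a) (lookup \<nu> b) - lo - 1"
  \<comment> \<open>Removing the excess of the larger exponent leaves a monomial symmetric in
    \<open>x_a, x_b\<close>, which can be pulled out of \<open>TT a b\<close>.\<close>
  define \<rho> where "\<rho> = \<nu> - (if lookup \<nu> b < lookup \<nu> a then single a (Suc m) else single b (Suc m))"
  define h where "h = xx a * xx b * (\<Sum>i<m. xx b ^ (m - Suc i) * xx a ^ i)"
  have hi: "max (lookup \<nu> a) (lookup \<nu> b) = lo + Suc m"
    using False by (auto simp: m_def lo_def)
  have \<rho>: "lookup \<rho> j = (if j = a \<or> j = b then lo else lookup \<nu> j)" for j
    using hi assms by (auto simp: \<rho>_def lookup_minus lookup_single when_def lo_def max_def min_def split: if_splits)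
  then have sym: "KK a b (single \<rho> 1) = single \<rho> 1"
    unfolding KK_single
    by (intro arg_cong2[of _ _ _ _ single] poly_mapping_eqI) (auto simp: lookup_swap_mono transpose_def)
  have pow: "single \<rho> 1 * xx i ^ k = single (\<rho> + single i k) 1" for i k
    by (simp add: mult_single flip: single_single_power)
  have inn: "keys (single \<rho> 1 * (cc c * h)) \<subseteq> inner a b \<nu>" for c
  proof -
    have "single \<rho> 1 * (cc c * h) = cc c * (\<Sum>i<m. single \<rho> 1 * (xx a ^ Suc i * xx b ^ (m - i)))"
    proof -
      have "xx a * xx b * (xx b ^ (m - Suc i) * xx a ^ i) = xx a ^ Suc i * xx b ^ (m - i)" if "i < m" for i
      proof -
        have "m - i = Suc (m - Suc i)" using that by simp
        then show ?thesis by (simp add: mult_ac)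
      qed
      then have "h = (\<Sum>i<m. xx a ^ Suc i * xx b ^ (m - i))"
        unfolding h_def sum_distrib_left by (intro sum.cong) auto
      then show ?thesis
        by (simp add: sum_distrib_left mult_ac del: power_Suc)
    qed
    also have "\<dots> = cc c * (\<Sum>i<m. single (\<rho> + single a (Suc i) + single b (m - i)) 1)"
      by (simp add: mult_single add.assoc del: power_Suc flip: single_single_power)
    finally have eq: "single \<rho> 1 * (cc c * h) = cc c * (\<Sum>i<m. single (\<rho> + single a (Suc i) + single b (m - i)) 1)" .
    have "keys (\<Sum>i<m. single (\<rho> + single a (Suc i) + single b (m - i)) (1::coef)) \<subseteq> inner a b \<nu>"
    proof (rule keys_sum_subset)
      fix i assume "i \<in> {..<m}"
      then have "\<rho> + single a (Suc i) + single b (m - i) \<in> inner a b \<nu>"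
        using assms hi unfolding inner_def
        by (auto simp: lookup_add lookup_single \<rho> when_def lo_def max_def min_def split: if_splits)
      then show "keys (single (\<rho> + single a (Suc i) + single b (m - i)) (1::coef)) \<subseteq> inner a b \<nu>"
        by simp
    qed
    then show ?thesis
      unfolding eq using keys_cc_mult by blast
  qed
  show ?thesis
  proof (cases "lookup \<nu> b < lookup \<nu> a")
    case True
    have \<nu>: "\<nu> = \<rho> + single a (Suc m)" "swap_mono a b \<nu> = \<rho> + single b (Suc m)"
      using True hi assms
      by (intro poly_mapping_eqI; auto simp: lookup_swap_mono lookup_add \<rho> lookup_single when_def lo_def transpose_def)+
    have "TT a b (single \<nu> 1) = single \<rho> 1 * TT a b (xx a ^ Suc m)"
      using TT_mult_sym[OF assms sym] by (simp only: \<nu>(1) flip: pow)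
    also have "\<dots> = TT_lead a b \<nu> + single \<rho> 1 * (cc (1 - tt) * h)"
      using True unfolding TT_xx_power[OF assms] TT_lead_def \<nu>(2)
      by (simp add: h_def cc_simps distrib_left del: power_Suc flip: pow)
    finally show ?thesis using inn by simp
  next
    case c: False
    have \<nu>: "\<nu> = \<rho> + single b (Suc m)" "swap_mono a b \<nu> = \<rho> + single a (Suc m)"
      using c hi assms False
      by (intro poly_mapping_eqI; auto simp: lookup_swap_mono lookup_add \<rho> lookup_single when_def lo_def transpose_def max_def min_def split: if_splits)+
    have "TT a b (single \<nu> 1) = single \<rho> 1 * TT a b (xx b ^ Suc m)"
      using TT_mult_sym[OF assms sym] by (simp only: \<nu>(1) flip: pow)
    also have "\<dots> = cc (tt - 1) * single \<nu> 1 + cc tt * single (swap_mono a b \<nu>) 1 + single \<rho> 1 * (cc (tt - 1) * h)"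
      unfolding TT_xx_power[OF assms] \<nu>(2) unfolding \<nu>(1)
      by (simp add: h_def cc_simps algebra_simps del: power_Suc flip: pow)
    also have "cc (tt - 1) * single \<nu> 1 + cc tt * single (swap_mono a b \<nu>) 1 = TT_lead a b \<nu>"
      using c False by (simp add: TT_lead_def flip: single_conv_cc)
    finally show ?thesis using inn by simp
  qed
qed

text \<open>
  Unlike \<open>TT a b\<close> itself, the operators \<open>KK a b \<circ> TI a b\<close> and \<open>TT a b \<circ> KK a b\<close> are triangular on
  monomials; the Cherednik operators are products of such factors.
\<close>

lemma keys_KK_TI_single:
  assumes "a \<noteq> b"
  shows "keys (KK a b (TI a b (single \<nu> 1)) - cc (if lookup \<nu> b \<le> lookup \<nu> a then inverse tt else 1) * single \<nu> 1)
    \<subseteq> inner a b \<nu> \<union> (if lookup \<nu> b < lookup \<nu> a then {swap_mono a b \<nu>} else {})"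
proof -
  define r where "r = TT a b (single \<nu> 1) - TT_lead a b \<nu>"
  have r: "keys r \<subseteq> inner a b \<nu>"
    unfolding r_def by (rule keys_TT_single[OF assms])
  have sr: "keys (cc (inverse tt) * KK a b r) \<subseteq> inner a b \<nu>"
  proof -
    have "swap_mono a b ` keys r \<subseteq> inner a b \<nu>"
      using r swap_mono_inner by blast
    then show ?thesis
      using keys_cc_mult[of "inverse tt" "KK a b r"] unfolding keys_KK by blast
  qed
  have TT: "TT a b (single \<nu> 1) = TT_lead a b \<nu> + r"
    by (simp add: r_def)
  have eq_swap: "swap_mono a b \<nu> = \<nu>" if "lookup \<nu> a = lookup \<nu> b"
    using that by (intro poly_mapping_eqI) (auto simp: lookup_swap_mono transpose_def)
  have "KK a b (TI a b (single \<nu> 1)) =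
    cc (inverse tt) * (KK a b (TT_lead a b \<nu>) + cc (1 - tt) * single (swap_mono a b \<nu>) 1) + cc (inverse tt) * KK a b r"
    by (simp add: TI_def TT KK_mult KK_add KK_single algebra_simps)
  also have "cc (inverse tt) * (KK a b (TT_lead a b \<nu>) + cc (1 - tt) * single (swap_mono a b \<nu>) 1)
    = cc (if lookup \<nu> b \<le> lookup \<nu> a then inverse tt else 1) * single \<nu> 1
      + (if lookup \<nu> b < lookup \<nu> a then single (swap_mono a b \<nu>) (inverse tt * (1 - tt)) else 0)"
    using eq_swap
    by (auto simp: TT_lead_def KK_add KK_single distrib_left cc_def mult_single field_simps simp flip: single_add)
  finally have "KK a b (TI a b (single \<nu> 1)) - cc (if lookup \<nu> b \<le> lookup \<nu> a then inverse tt else 1) * single \<nu> 1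
    = (if lookup \<nu> b < lookup \<nu> a then single (swap_mono a b \<nu>) (inverse tt * (1 - tt)) else 0) + cc (inverse tt) * KK a b r"
    by simp
  moreover have "keys \<dots> \<subseteq> keys (if lookup \<nu> b < lookup \<nu> a then single (swap_mono a b \<nu>) (inverse tt * (1 - tt)) else 0)
      \<union> keys (cc (inverse tt) * KK a b r)"
    by (rule keys_add)
  ultimately show ?thesis
    using sr by (auto split: if_splits)
qed

lemma keys_TT_KK_single:
  assumes "a \<noteq> b"
  shows "keys (TT a b (KK a b (single \<nu> 1)) - cc (if lookup \<nu> b \<le> lookup \<nu> a then tt else 1) * single \<nu> 1)
    \<subseteq> inner a b \<nu> \<union> (if lookup \<nu> b < lookup \<nu> a then {swap_mono a b \<nu>} else {})"
proof -
  define \<mu> where "\<mu> = swap_mono a b \<nu>"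
  define r where "r = TT a b (single \<mu> 1) - TT_lead a b \<mu>"
  have r: "keys r \<subseteq> inner a b \<nu>"
    using keys_TT_single[OF assms, of \<mu>] by (simp add: r_def \<mu>_def inner_swap_mono)
  have \<mu>: "lookup \<mu> a = lookup \<nu> b" "lookup \<mu> b = lookup \<nu> a" "swap_mono a b \<mu> = \<nu>"
    by (simp_all add: \<mu>_def lookup_swap_mono)
  have eq_swap: "\<mu> = \<nu>" if "lookup \<nu> a = lookup \<nu> b"
    unfolding \<mu>_def using that by (intro poly_mapping_eqI) (auto simp: lookup_swap_mono transpose_def)
  have "TT a b (KK a b (single \<nu> 1)) = TT_lead a b \<mu> + r"
    by (simp add: r_def KK_single \<mu>_def)
  also have "TT_lead a b \<mu> = cc (if lookup \<nu> b \<le> lookup \<nu> a then tt else 1) * single \<nu> 1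
      + (if lookup \<nu> b < lookup \<nu> a then single \<mu> (tt - 1) else 0)"
    using eq_swap
    by (auto simp: TT_lead_def \<mu> cc_def mult_single)
  finally have "TT a b (KK a b (single \<nu> 1)) - cc (if lookup \<nu> b \<le> lookup \<nu> a then tt else 1) * single \<nu> 1
    = (if lookup \<nu> b < lookup \<nu> a then single \<mu> (tt - 1) else 0) + r"
    by simp
  moreover have "keys \<dots> \<subseteq> keys (if lookup \<nu> b < lookup \<nu> a then single \<mu> (tt - 1) else 0) \<union> keys r"
    by (rule keys_add)
  ultimately show ?thesis
    using r by (auto simp: \<mu>_def split: if_splits)
qed

section \<open>Lengths of permutations and Matsumoto's theorem\<close>

abbreviation adj :: "nat \<Rightarrow> nat \<Rightarrow> nat" where "adj i \<equiv> transpose i (Suc i)"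

text \<open>Words may use arbitrary letters, so lengths have to be studied for all finitely
  supported permutations of the naturals and not inside one fixed symmetric group.\<close>

definition finperm :: "(nat \<Rightarrow> nat) \<Rightarrow> bool" where
  "finperm \<sigma> \<longleftrightarrow> (\<exists>n. \<sigma> permutes {..<n})"

definition invs :: "(nat \<Rightarrow> nat) \<Rightarrow> (nat \<times> nat) set" where
  "invs \<sigma> = {(i, j). i < j \<and> \<sigma> j < \<sigma> i}"

definition ninv :: "(nat \<Rightarrow> nat) \<Rightarrow> nat" where
  "ninv \<sigma> = card (invs \<sigma>)"

lemma finperm_permutes: "\<sigma> permutes A \<Longrightarrow> finite A \<Longrightarrow> finperm \<sigma>"
  unfolding finperm_def by (meson finite_nat_iff_bounded permutes_subset)

lemma finperm_id [simp]: "finperm id" "finperm (\<lambda>x. x)"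
  unfolding finperm_def using permutes_id by (auto simp: id_def)

lemma finperm_transpose [simp]: "finperm (transpose i j)"
  by (rule finperm_permutes[of _ "{i, j}"]) (auto intro: permutes_swap_id)

lemma finperm_comp: "finperm \<sigma> \<Longrightarrow> finperm \<tau> \<Longrightarrow> finperm (\<sigma> \<circ> \<tau>)"
proof -
  assume "finperm \<sigma>" "finperm \<tau>"
  then obtain n m where "\<sigma> permutes {..<n}" "\<tau> permutes {..<m}"
    by (auto simp: finperm_def)
  then have "\<sigma> permutes {..<max n m}" "\<tau> permutes {..<max n m}"
    by (auto intro: permutes_subset)
  then show ?thesis
    unfolding finperm_def using permutes_compose by blast
qed

lemma finperm_inv: "finperm \<sigma> \<Longrightarrow> finperm (inv \<sigma>)"
  unfolding finperm_def using permutes_inv by blast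

lemma finperm_bij: "finperm \<sigma> \<Longrightarrow> bij \<sigma>"
  unfolding finperm_def using permutes_bij by blast

lemma finperm_inj: "finperm \<sigma> \<Longrightarrow> \<sigma> i = \<sigma> j \<longleftrightarrow> i = j"
  using finperm_bij by (metis bij_pointE)

lemma finperm_comp_transpose: "finperm \<sigma> \<Longrightarrow> \<sigma> \<circ> transpose i j = transpose (\<sigma> i) (\<sigma> j) \<circ> \<sigma>"
  by (auto simp: fun_eq_iff transpose_def finperm_inj)

lemma finite_invs:
  assumes "finperm \<sigma>"
  shows "finite (invs \<sigma>)"
proof -
  obtain n where n: "\<sigma> permutes {..<n}"
    using assms by (auto simp: finperm_def)
  have "j < n" if "i < j" "\<sigma> j < \<sigma> i" for i j
  proof (rule ccontr)
    assume "\<not> j < n"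
    then have "\<sigma> j = j"
      using n by (simp add: permutes_not_in)
    moreover have "\<sigma> i < n \<or> \<sigma> i = i"
      using n by (metis lessThan_iff permutes_in_image permutes_not_in)
    ultimately show False
      using that \<open>\<not> j < n\<close> by auto
  qed
  then have "invs \<sigma> \<subseteq> {..<n} \<times> {..<n}"
    by (force simp: invs_def)
  then show ?thesis
    by (rule finite_subset) simp
qed

lemma ninv_id [simp]: "ninv (\<lambda>x. x) = 0" "ninv id = 0"
proof -
  have "invs (\<lambda>x. x) = {}"
    by (auto simp: invs_def)
  then show "ninv (\<lambda>x. x) = 0" "ninv id = 0"
    by (simp_all add: ninv_def id_def)
qed

text \<open>The map \<open>f\<close> transports an inversion by the transposition if the order of
  its positions is preserved and leaves it alone otherwise. It is injective, takes inversions of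
  \<open>\<sigma>\<close> to inversions of the product, and misses \<open>(a, b)\<close>.\<close>

lemma ninv_comp_transpose_less:
  assumes \<sigma>: "finperm \<sigma>" and ab: "a < b" "\<sigma> a < \<sigma> b"
  shows "ninv \<sigma> < ninv (\<sigma> \<circ> transpose a b)"
proof -
  define s where "s = transpose a b"
  define f where "f = (\<lambda>(i, j). if s i < s j then (s i, s j) else (i, j))"
  have s: "s a = b" "s b = a" "\<And>i. i \<noteq> a \<Longrightarrow> i \<noteq> b \<Longrightarrow> s i = i" "\<And>i. s (s i) = i"
    by (auto simp: s_def transpose_apply_other)
  have "inj_on f (invs \<sigma>)"
  proof (rule inj_onI)
    fix x y assume xy: "x \<in> invs \<sigma>" "y \<in> invs \<sigma>" "f x = f y"
    obtain i j k l where "x = (i, j)" "y = (k, l)" by fastforce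
    then show "x = y"
      using xy s(4) by (auto simp: f_def invs_def split: if_splits) (metis s(4) nat_neq_iff)+
  qed
  moreover have "f ` invs \<sigma> \<subseteq> invs (\<sigma> \<circ> s) - {(a, b)}"
  proof
    fix z assume "z \<in> f ` invs \<sigma>"
    then obtain i j where z: "z = f (i, j)" and ij: "i < j" "\<sigma> j < \<sigma> i"
      by (auto simp: invs_def)
    show "z \<in> invs (\<sigma> \<circ> s) - {(a, b)}"
    proof (cases "s i < s j")
      case True
      then have "(s i, s j) \<noteq> (a, b)"
        using s ij ab by (metis Pair_inject less_asym)
      then show ?thesis
        using True ij s(4) by (auto simp: z f_def invs_def)
    next
      case False
      then have "s j < s i"
        using ij s(4) by (metis linorder_neqE_nat less_irrefl)
      have "\<sigma> (s j) < \<sigma> (s i)"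
      proof (cases "i = a")
        case True
        then have "j \<noteq> b" using ij ab by auto
        then show ?thesis
          using True s ij ab by auto
      next
        case ia: False
        show ?thesis
        proof (cases "i = b")
          case True
          then show ?thesis using s ij ab \<open>s j < s i\<close> by (metis order.strict_trans less_asym)
        next
          case False
          then have "s i = i" using ia s by auto
          then show ?thesis
            using s ij ab \<open>s j < s i\<close> by (metis order.strict_trans less_asym)
        qed
      qed
      moreover have "(i, j) \<noteq> (a, b)" using ij ab by auto
      ultimately show ?thesis
        using False ij by (auto simp: z f_def invs_def)
    qed
  qed
  moreover have fin: "finite (invs (\<sigma> \<circ> s))"
    using \<sigma> by (intro finite_invs finperm_comp) (simp_all add: s_def)
  ultimately have "ninv \<sigma> \<le> card (invs (\<sigma> \<circ> s) - {(a, b)})"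
    unfolding ninv_def by (metis card_inj_on_le finite_Diff)
  moreover have "(a, b) \<in> invs (\<sigma> \<circ> s)"
    using ab s by (auto simp: invs_def)
  ultimately show ?thesis
    using fin by (simp add: ninv_def s_def)
      (metis One_nat_def Suc_pred card_gt_0_iff empty_iff le_imp_less_Suc)
qed

text \<open>A neighbouring transposition preserves the order of every pair of positions except
  \<open>(i, Suc i)\<close>, so apart from this pair the inversions correspond bijectively.\<close>

lemma ninv_comp_adj:
  assumes \<sigma>: "finperm \<sigma>" and "\<sigma> i < \<sigma> (Suc i)"
  shows "ninv (\<sigma> \<circ> adj i) = Suc (ninv \<sigma>)"
proof -
  let ?s = "adj i"
  have s: "?s i = Suc i" "?s (Suc i) = i" "\<And>j. j \<noteq> i \<Longrightarrow> j \<noteq> Suc i \<Longrightarrow> ?s j = j"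
    by (auto simp: transpose_apply_other)
  have mono: "?s k < ?s l" if "k < l" "(k, l) \<noteq> (i, Suc i)" for k l
    using that by (auto simp: transpose_def)
  let ?f = "map_prod ?s ?s"
  have "bij_betw ?f (invs \<sigma>) (invs (\<sigma> \<circ> ?s) - {(i, Suc i)})"
  proof (rule bij_betw_byWitness[where f' = ?f])
    show "?f ` invs \<sigma> \<subseteq> invs (\<sigma> \<circ> ?s) - {(i, Suc i)}"
    proof
      fix z assume "z \<in> ?f ` invs \<sigma>"
      then obtain k l where z: "z = ?f (k, l)" and "(k, l) \<in> invs \<sigma>" by auto
      then have kl: "k < l" "\<sigma> l < \<sigma> k" by (auto simp: invs_def)
      then have "(k, l) \<noteq> (i, Suc i)" using assms by auto
      then have "?s k < ?s l" using kl mono by blast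
      moreover have "(?s k, ?s l) \<noteq> (i, Suc i)"
      proof
        assume "(?s k, ?s l) = (i, Suc i)"
        then have "?s (?s k) = ?s i" "?s (?s l) = ?s (Suc i)" by simp_all
        then show False using kl by simp
      qed
      ultimately show "z \<in> invs (\<sigma> \<circ> ?s) - {(i, Suc i)}"
        using kl by (simp add: z invs_def)
    qed
    show "?f ` (invs (\<sigma> \<circ> ?s) - {(i, Suc i)}) \<subseteq> invs \<sigma>"
    proof
      fix z assume "z \<in> ?f ` (invs (\<sigma> \<circ> ?s) - {(i, Suc i)})"
      then obtain k l where z: "z = (?s k, ?s l)" and kl: "k < l" "\<sigma> (?s l) < \<sigma> (?s k)" "(k, l) \<noteq> (i, Suc i)"
        by (auto simp: invs_def)
      then show "z \<in> invs \<sigma>"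
        using mono[OF kl(1,3)] by (simp add: invs_def)
    qed
  qed auto
  then have "ninv \<sigma> = card (invs (\<sigma> \<circ> ?s) - {(i, Suc i)})"
    unfolding ninv_def by (rule bij_betw_same_card)
  moreover have "finite (invs (\<sigma> \<circ> ?s))"
    using \<sigma> by (intro finite_invs finperm_comp) simp_all
  moreover have "(i, Suc i) \<in> invs (\<sigma> \<circ> ?s)"
    using assms by (auto simp: invs_def)
  ultimately show ?thesis
    unfolding ninv_def by (metis card_Suc_Diff1)
qed

lemma comp_adj_adj [simp]: "(\<sigma> \<circ> adj i) \<circ> adj i = \<sigma>"
  by (simp add: comp_assoc)

lemma ninv_comp_adj':
  assumes \<sigma>: "finperm \<sigma>" and "\<sigma> (Suc i) < \<sigma> i"
  shows "ninv \<sigma> = Suc (ninv (\<sigma> \<circ> adj i))"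
  using ninv_comp_adj[of "\<sigma> \<circ> adj i" i] assms by (simp add: finperm_comp)

section \<open>Words and the length function\<close>

lemma word_perm_simps [simp]:
  "word_perm [] = id" "word_perm (i # ws) = adj i \<circ> word_perm ws"
  by (simp_all add: word_perm_def compose_list_def)

lemma word_perm_append [simp]: "word_perm (ws @ vs) = word_perm ws \<circ> word_perm vs"
  by (induction ws) (auto simp: comp_assoc)

lemma word_perm_snoc: "word_perm (ws @ [i]) = word_perm ws \<circ> adj i"
  by (simp add: fun_eq_iff)

lemma finperm_word_perm [simp]: "finperm (word_perm ws)"
  by (induction ws) (simp_all only: word_perm_simps finperm_id finperm_comp finperm_transpose)

lemma word_perm_rev: "word_perm (rev ws) = inv (word_perm ws)"
proof (induction ws)
  case (Cons i ws)
  then show ?case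
    by (simp only: rev.simps word_perm_snoc word_perm_simps o_inv_distrib finperm_bij
        finperm_word_perm finperm_transpose inv_transpose_eq)
qed simp

lemma ninv_word_perm_le: "ninv (word_perm ws) \<le> length ws"
proof (induction ws rule: rev_induct)
  case (snoc i ws)
  consider "word_perm ws i < word_perm ws (Suc i)" | "word_perm ws (Suc i) < word_perm ws i"
    using finperm_inj[OF finperm_word_perm, of ws i "Suc i"] by linarith
  then show ?case
    using snoc ninv_comp_adj[OF finperm_word_perm, of ws i] ninv_comp_adj'[OF finperm_word_perm, of ws i]
    unfolding word_perm_snoc length_append_singleton by cases linarith+
qed simp

text \<open>Without a descent the permutation is strictly increasing on all naturals, as it fixes
  the points outside the interval, and an increasing bijection is the identity.\<close>

lemma exists_descent:
  assumes "\<sigma> permutes {a..b}" "\<sigma> \<noteq> id"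
  shows "\<exists>i\<in>{a..<b}. \<sigma> (Suc i) < \<sigma> i"
proof (rule ccontr)
  assume *: "\<not> (\<exists>i\<in>{a..<b}. \<sigma> (Suc i) < \<sigma> i)"
  have fp: "finperm \<sigma>"
    using assms(1) by (rule finperm_permutes) simp
  have "\<sigma> i < \<sigma> (Suc i)" for i
  proof (cases "i \<in> {a..<b}")
    case True
    then show ?thesis
      using * finperm_inj[OF fp, of i "Suc i"] by force
  next
    case False
    then consider "i < a" "Suc i < a" | "i < a" "Suc i = a" | "b \<le> i" by force
    then show ?thesis
    proof cases
      case 1
      then show ?thesis using permutes_not_in[OF assms(1)] by simp
    next
      case 2
      then have "\<sigma> i = i" using permutes_not_in[OF assms(1)] by simp
      moreover have "a \<le> \<sigma> a"
        using assms(1) by (metis atLeastAtMost_iff order_refl permutes_in_image permutes_not_in)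
      ultimately show ?thesis using 2 by auto
    next
      case 3
      then have "\<sigma> (Suc i) = Suc i" using permutes_not_in[OF assms(1)] by simp
      moreover have "\<sigma> i \<le> i"
        using 3 assms(1) by (metis atLeastAtMost_iff order_refl order.trans permutes_in_image permutes_not_in)
      ultimately show ?thesis by simp
    qed
  qed
  then have mono: "strict_mono \<sigma>"
    by (simp add: strict_mono_Suc_iff)
  have "\<sigma> i = i" for i
  proof (induction i rule: less_induct)
    case (less i)
    have surj: "surj \<sigma>" using fp finperm_bij bij_is_surj by blast
    then obtain k where k: "\<sigma> k = i" by (metis surjD)
    have "i \<le> \<sigma> i"
      using mono by (rule strict_mono_imp_increasing)
    moreover have "k = i"
      using less[of k] k mono calculation by (metis linorder_neqE_nat strict_mono_less leD)
    ultimately show ?case using k by simp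
  qed
  then show False
    using assms(2) by auto
qed

lemma exists_word:
  assumes "\<sigma> permutes {a..b}"
  shows "\<exists>ws. word_perm ws = \<sigma> \<and> length ws = ninv \<sigma> \<and> set ws \<subseteq> {a..<b}"
  using assms
proof (induction "ninv \<sigma>" arbitrary: \<sigma> rule: less_induct)
  case less
  show ?case
  proof (cases "\<sigma> = id")
    case True
    then show ?thesis
      by (intro exI[of _ "[]"]) simp
  next
    case False
    then obtain i where i: "i \<in> {a..<b}" "\<sigma> (Suc i) < \<sigma> i"
      using exists_descent less(2) by blast
    have fp: "finperm \<sigma>"
      using less(2) by (rule finperm_permutes) simp
    have "(\<sigma> \<circ> adj i) permutes {a..b}"
      using i less(2) by (intro permutes_compose permutes_swap_id) auto
    then obtain ws where ws: "word_perm ws = \<sigma> \<circ> adj i" "length ws = ninv (\<sigma> \<circ> adj i)" "set ws \<subseteq> {a..<b}"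
      using less(1)[of "\<sigma> \<circ> adj i"] ninv_comp_adj'[OF fp i(2)] by auto
    then have "word_perm (ws @ [i]) = \<sigma>"
      by simp
    moreover have "length (ws @ [i]) = ninv \<sigma>"
      using ws ninv_comp_adj'[OF fp i(2)] by simp
    ultimately show ?thesis
      using ws(3) i(1) by (metis Un_subset_iff empty_subsetI insert_subset list.set(1) list.simps(15) set_append)
  qed
qed

lemma finperm_exists_word: "finperm \<sigma> \<Longrightarrow> \<exists>ws. word_perm ws = \<sigma> \<and> length ws = ninv \<sigma>"
proof -
  assume "finperm \<sigma>"
  then obtain n where "\<sigma> permutes {..<n}" by (auto simp: finperm_def)
  then have "\<sigma> permutes {0..n}"
    by (rule permutes_subset) auto
  from exists_word[OF this] show ?thesis by blast
qed

lemma reduced_word_iff: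
  assumes "finperm \<sigma>"
  shows "reduced_word \<sigma> ws \<longleftrightarrow> word_perm ws = \<sigma> \<and> length ws = ninv \<sigma>"
  using finperm_exists_word[OF assms] ninv_word_perm_le
  by (metis (mono_tags, lifting) le_antisym reduced_word_def)

lemma some_reduced_word:
  assumes "finperm \<sigma>"
  shows "word_perm (some_reduced_word \<sigma>) = \<sigma>" "length (some_reduced_word \<sigma>) = ninv \<sigma>"
proof -
  have "reduced_word \<sigma> (some_reduced_word \<sigma>)"
    unfolding some_reduced_word_def
    using finperm_exists_word[OF assms] reduced_word_iff[OF assms] by (metis someI_ex)
  then show "word_perm (some_reduced_word \<sigma>) = \<sigma>" "length (some_reduced_word \<sigma>) = ninv \<sigma>"
    by (simp_all add: reduced_word_iff assms)
qed

lemma perm_length_eq_ninv: "finperm \<sigma> \<Longrightarrow> perm_length \<sigma> = ninv \<sigma>"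
  by (simp add: perm_length_def some_reduced_word)

lemma ninv_inv:
  assumes "finperm \<sigma>"
  shows "ninv (inv \<sigma>) = ninv \<sigma>"
proof -
  have le: "ninv (inv \<tau>) \<le> ninv \<tau>" if "finperm \<tau>" for \<tau>
    using finperm_exists_word[OF that] ninv_word_perm_le word_perm_rev by (metis length_rev)
  show ?thesis
    using le[OF assms] le[OF finperm_inv[OF assms]] inv_inv_eq[OF finperm_bij[OF assms]] by simp
qed

lemma ninv_comp_le:
  assumes "finperm \<sigma>" "finperm \<tau>"
  shows "ninv (\<sigma> \<circ> \<tau>) \<le> ninv \<sigma> + ninv \<tau>"
  using finperm_exists_word[OF assms(1)] finperm_exists_word[OF assms(2)] ninv_word_perm_le
  by (metis length_append word_perm_append)

section \<open>Words acting through operators\<close>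

lemma compose_list_simps [simp]:
  "compose_list [] = id" "compose_list (f # fs) = f \<circ> compose_list fs"
  by (simp_all add: compose_list_def)

lemma compose_list_append [simp]: "compose_list (fs @ gs) = compose_list fs \<circ> compose_list gs"
  by (induction fs) (auto simp: comp_assoc)

definition word_act :: "(nat \<Rightarrow> 'a \<Rightarrow> 'a) \<Rightarrow> nat list \<Rightarrow> 'a \<Rightarrow> 'a" where
  "word_act T ws = compose_list (map T ws)"

lemma word_act_simps [simp]:
  "word_act T [] = id" "word_act T (i # ws) = T i \<circ> word_act T ws"
  "word_act T (ws @ vs) = word_act T ws \<circ> word_act T vs"
  by (simp_all add: word_act_def)

lemma word_act_commute:
  assumes "\<And>i x. i \<in> set ws \<Longrightarrow> T i (f x) = f (T' i x)"
  shows "word_act T ws (f x) = f (word_act T' ws x)"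
  using assms by (induction ws) auto

section \<open>The longest permutation of an interval\<close>

definition revp :: "nat \<Rightarrow> nat \<Rightarrow> nat \<Rightarrow> nat" where
  "revp a b i = (if i \<in> {a..b} then a + b - i else i)"

lemma revp_revp [simp]: "revp a b (revp a b i) = i"
  by (auto simp: revp_def)

lemma revp_comp_revp [simp]: "revp a b \<circ> revp a b = id"
  by auto

lemma revp_permutes: "revp a b permutes {a..b}"
  unfolding permutes_def
proof (intro conjI allI impI)
  fix y
  show "\<exists>!x. revp a b x = y"
    by (rule ex1I[of _ "revp a b y"]) auto
qed (auto simp: revp_def)

lemma finperm_revp [simp]: "finperm (revp a b)"
  by (rule finperm_permutes[OF revp_permutes]) simp

lemma inv_revp [simp]: "inv (revp a b) = revp a b"
  by (rule inv_unique_comp) simp_all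

lemma longest_perm_eq_revp: "longest_perm m = revp 1 m"
  by (auto simp: longest_perm_def revp_def)

lemma card_pairs:
  fixes A :: "nat set"
  assumes "finite A"
  shows "card {(i, j). i < j \<and> i \<in> A \<and> j \<in> A} = card A choose 2"
proof -
  let ?P = "{(i, j). i < j \<and> i \<in> A \<and> j \<in> A}"
  have "bij_betw (\<lambda>(i, j). {i, j}) ?P {B. B \<subseteq> A \<and> card B = 2}"
    unfolding bij_betw_def
  proof
    show "inj_on (\<lambda>(i, j). {i, j}) ?P"
      by (rule inj_onI) (auto simp: doubleton_eq_iff)
    have "y \<in> (\<lambda>(i, j). {i, j}) ` ?P" if y: "y \<subseteq> A" "card y = 2" for y
    proof -
      obtain i j where ij: "y = {i, j}" "i \<noteq> j"
        using y(2) by (auto simp: card_2_iff)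
      then have "(min i j, max i j) \<in> ?P" and "y = {min i j, max i j}"
        using y(1) by (auto simp: min_def max_def)
      then show ?thesis
        by (intro image_eqI[of _ _ "(min i j, max i j)"]) simp_all
    qed
    then show "(\<lambda>(i, j). {i, j}) ` ?P = {B. B \<subseteq> A \<and> card B = 2}"
      by auto
  qed
  then have "card ?P = card {B. B \<subseteq> A \<and> card B = 2}"
    by (rule bij_betw_same_card)
  then show ?thesis
    using assms by (simp add: n_subsets)
qed

lemma invs_subset_interval:
  assumes "\<sigma> permutes {a..b}"
  shows "invs \<sigma> \<subseteq> {(i, j). i < j \<and> i \<in> {a..b} \<and> j \<in> {a..b}}"
proof
  fix z assume "z \<in> invs \<sigma>"
  then obtain i j where z: "z = (i, j)" and ij: "i < j" "\<sigma> j < \<sigma> i" by (auto simp: invs_def)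
  have range: "a \<le> \<sigma> k \<and> \<sigma> k \<le> b \<longleftrightarrow> a \<le> k \<and> k \<le> b" for k
    using permutes_in_image[OF assms, of k] by simp
  have out: "a \<le> k \<and> k \<le> b \<or> \<sigma> k = k" for k
    using permutes_not_in[OF assms, of k] by auto
  have "a \<le> i \<and> i \<le> b \<and> a \<le> j \<and> j \<le> b"
    using ij range[of i] range[of j] out[of i] out[of j] by linarith
  then show "z \<in> {(i, j). i < j \<and> i \<in> {a..b} \<and> j \<in> {a..b}}"
    using z ij by simp
qed

text \<open>Composition with the reversal complements the set of inversions inside the pairs of the
  interval.\<close>

lemma ninv_revp_comp:
  assumes "\<sigma> permutes {a..b}"
  shows "ninv (revp a b \<circ> \<sigma>) + ninv \<sigma> = (Suc b - a) choose 2"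
proof -
  let ?P = "{(i, j). i < j \<and> i \<in> {a..b} \<and> j \<in> {a..b}}"
  have in_iff: "\<sigma> k \<in> {a..b} \<longleftrightarrow> k \<in> {a..b}" for k
    by (rule permutes_in_image[OF assms])
  have inj: "\<sigma> k = \<sigma> l \<longleftrightarrow> k = l" for k l
    using permutes_inj[OF assms] by (simp add: inj_eq)
  have fin: "finite ?P"
    by (rule finite_subset[of _ "{a..b} \<times> {a..b}"]) auto
  have "(revp a b \<circ> \<sigma>) permutes {a..b}"
    using assms revp_permutes by (rule permutes_compose)
  then have "invs (revp a b \<circ> \<sigma>) \<subseteq> ?P" and sub: "invs \<sigma> \<subseteq> ?P"
    using assms invs_subset_interval by blast+
  moreover have "(i, j) \<in> invs (revp a b \<circ> \<sigma>) \<longleftrightarrow> (i, j) \<notin> invs \<sigma>" if "(i, j) \<in> ?P" for i j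
    using that in_iff[of i] in_iff[of j] inj[of i j] by (auto simp: invs_def revp_def)
  ultimately have "invs (revp a b \<circ> \<sigma>) = ?P - invs \<sigma>"
    by blast
  then have "card (invs (revp a b \<circ> \<sigma>)) = card ?P - card (invs \<sigma>)"
    using card_Diff_subset[OF finite_subset[OF sub fin] sub] by simp
  moreover have "card ?P = (Suc b - a) choose 2"
    using card_pairs[of "{a..b}"] by simp
  ultimately show ?thesis
    using card_mono[OF fin sub] unfolding ninv_def by linarith
qed

lemma ninv_revp: "ninv (revp a b) = (Suc b - a) choose 2"
  using ninv_revp_comp[OF permutes_id, of a b] by (simp add: comp_def)

lemma word_perm_upt: "a \<le> b \<Longrightarrow> word_perm [a..<b] = (\<lambda>x. if x = b then a else if x \<in> {a..<b} then Suc x else x)"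
proof (induction b)
  case (Suc b)
  show ?case
  proof (cases "a \<le> b")
    case True
    then show ?thesis
      using Suc by (auto simp: transpose_def)
  next
    case False
    then show ?thesis
      using Suc by auto
  qed
qed auto

lemma revp_split_last: "a \<le> Suc b \<Longrightarrow> revp a (Suc b) = word_perm [a..<Suc b] \<circ> revp a b"
  by (subst word_perm_upt) (auto simp: revp_def fun_eq_iff)

lemma revp_split_first: "a \<le> Suc b \<Longrightarrow> revp a (Suc b) = word_perm (rev [a..<Suc b]) \<circ> revp (Suc a) (Suc b)"
proof -
  assume ab: "a \<le> Suc b"
  have "word_perm [a..<Suc b] \<circ> revp a (Suc b) = revp (Suc a) (Suc b)"
    using ab by (subst word_perm_upt) (auto simp: revp_def fun_eq_iff)
  then have "inv (word_perm [a..<Suc b]) \<circ> (word_perm [a..<Suc b] \<circ> revp a (Suc b))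
      = inv (word_perm [a..<Suc b]) \<circ> revp (Suc a) (Suc b)"
    by (simp only:)
  then have "revp a (Suc b) = inv (word_perm [a..<Suc b]) \<circ> revp (Suc a) (Suc b)"
    using finperm_bij[OF finperm_word_perm, of "[a..<Suc b]"]
    by (simp only: comp_assoc[symmetric] bij_is_inj inv_o_cancel id_comp)
  then show ?thesis by (simp only: word_perm_rev)
qed

text \<open>Abstract over the set acted upon, because Matsumoto's theorem is needed twice: for the
  operators on polynomials and for \<open>T_op\<close> on arbitrary series.\<close>

locale braid_action =
  fixes T :: "nat \<Rightarrow> 'a \<Rightarrow> 'a"
  assumes far: "\<bar>int i - int j\<bar> > 1 \<Longrightarrow> T i (T j x) = T j (T i x)"
    and braid: "T i (T (Suc i) (T i x)) = T (Suc i) (T i (T (Suc i) x))"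
begin

definition perm_act :: "(nat \<Rightarrow> nat) \<Rightarrow> 'a \<Rightarrow> 'a" where
  "perm_act \<sigma> = word_act T (some_reduced_word \<sigma>)"

text \<open>Both last letters are descents of the permutation. Two distant descents can be split off
  in either order, two neighbouring ones as a whole braid word; the induction hypothesis rewrites
  both prefixes so that the two words agree up to this final commutation or braid.\<close>

lemma matsumoto_aux:
  assumes "word_perm ws = word_perm vs" "length ws = ninv (word_perm ws)" "length vs = ninv (word_perm vs)"
  shows "word_act T ws = word_act T vs"
  using assms
proof (induction "length ws" arbitrary: ws vs rule: less_induct)
  case less
  let ?\<sigma> = "word_perm ws"
  have len: "length vs = length ws"
    using less.prems by simp
  show ?case
  proof (cases ws rule: rev_cases)
    case Nil
    then show ?thesis using len by simp
  next
    case ws: (snoc ws' i)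
    then obtain vs' j where vs: "vs = vs' @ [j]"
      using len by (cases vs rule: rev_cases) auto
    \<comment> \<open>Removing the last letter of a reduced word leaves a reduced word, and that
      letter is a descent.\<close>
    have red: "length us = ninv (word_perm us) \<and> ?\<sigma> (Suc k) < ?\<sigma> k"
      if "?\<sigma> = word_perm (us @ [k])" "length (us @ [k]) = ninv ?\<sigma>" for us k
    proof -
      have "\<not> word_perm us (Suc k) < word_perm us k"
        using that ninv_word_perm_le[of us] ninv_comp_adj'[of "word_perm us" k]
        unfolding word_perm_snoc by auto
      then have "word_perm us k < word_perm us (Suc k)"
        using finperm_inj[OF finperm_word_perm, of us k "Suc k"] by linarith
      then show ?thesis
        using that ninv_comp_adj[of "word_perm us" k] unfolding word_perm_snoc by simp
    qed
    have i: "length ws' = ninv (word_perm ws')" "?\<sigma> (Suc i) < ?\<sigma> i"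
      using red[of ws' i] less.prems(2) unfolding ws[symmetric] by simp_all
    have j: "length vs' = ninv (word_perm vs')" "?\<sigma> (Suc j) < ?\<sigma> j"
      using red[of vs' j] less.prems unfolding vs[symmetric] by simp_all
    have ws': "word_perm ws' = ?\<sigma> \<circ> adj i"
      by (simp only: ws word_perm_snoc comp_adj_adj)
    have vs': "word_perm vs' = ?\<sigma> \<circ> adj j"
      by (simp only: less.prems(1) vs word_perm_snoc comp_adj_adj)
    have IH: "word_act T us = word_act T us'"
      if "length us < length ws" "word_perm us = word_perm us'" "length us = ninv (word_perm us)"
        "length us' = ninv (word_perm us')" for us us'
      using less.hyps[OF that] .
    have lens: "length ws' < length ws" "length vs' < length ws"
      using ws vs len by simp_all
    have far_case: ?thesis if far_ij: "\<bar>int i - int j\<bar> > 1"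
    proof -
      have tr: "adj i j = j" "adj i (Suc j) = Suc j" "adj j i = i" "adj j (Suc i) = Suc i"
        using far_ij by (auto simp: transpose_def)
      have comm: "adj i \<circ> adj j = adj j \<circ> adj i"
        using far_ij by (auto simp: fun_eq_iff transpose_def)
      define \<rho> where "\<rho> = ?\<sigma> \<circ> adj i \<circ> adj j"
      have \<rho>': "\<rho> = ?\<sigma> \<circ> adj j \<circ> adj i"
        unfolding \<rho>_def comp_assoc comm by simp
      have fp: "finperm (?\<sigma> \<circ> adj i)" "finperm \<rho>"
        by (auto simp: \<rho>_def intro!: finperm_comp)
      have n1: "ninv ?\<sigma> = Suc (ninv (?\<sigma> \<circ> adj i))" and n2: "ninv (?\<sigma> \<circ> adj i) = Suc (ninv \<rho>)"
        and n3: "ninv ?\<sigma> = Suc (ninv (?\<sigma> \<circ> adj j))"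
        using ninv_comp_adj'[OF finperm_word_perm i(2)] ninv_comp_adj'[OF finperm_word_perm j(2)]
          ninv_comp_adj'[OF fp(1), of j] j(2) by (simp_all add: tr \<rho>_def)
      obtain us where us: "word_perm us = \<rho>" "length us = ninv \<rho>"
        using finperm_exists_word fp by blast
      have e1: "word_perm (us @ [j]) = ?\<sigma> \<circ> adj i"
        by (simp only: word_perm_snoc us(1) \<rho>_def comp_adj_adj)
      have e2: "word_perm (us @ [i]) = ?\<sigma> \<circ> adj j"
        by (simp only: word_perm_snoc us(1) \<rho>' comp_adj_adj)
      have len_ws: "length (us @ [j]) = ninv (word_perm (us @ [j]))"
            unfolding e1 n2 by (simp add: us(2))
      have act1: "word_act T ws' = word_act T (us @ [j])"
        by (rule IH[OF lens(1) trans[OF ws' e1[symmetric]] i(1) len_ws])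
      have len_vs: "length (us @ [i]) = ninv (word_perm (us @ [i]))"
            unfolding e2 using n1 n2 n3 by (simp add: us(2))
      have act2: "word_act T vs' = word_act T (us @ [i])"
        by (rule IH[OF lens(2) trans[OF vs' e2[symmetric]] j(1) len_vs])
      show ?thesis
        unfolding ws vs using act1 act2 by (simp add: fun_eq_iff far[OF far_ij])
    qed
    \<comment> \<open>Stated for \<open>k\<close> and \<open>Suc k\<close> so that it serves
      whichever of the two words ends in the smaller letter.\<close>
    have near_case: "word_act T (xs @ [k]) = word_act T (ys @ [Suc k])"
      if k: "?\<sigma> (Suc k) < ?\<sigma> k" "?\<sigma> (Suc (Suc k)) < ?\<sigma> (Suc k)"
        and xs: "word_perm xs = ?\<sigma> \<circ> adj k" "length xs = ninv (word_perm xs)" "length xs < length ws"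
        and ys: "word_perm ys = ?\<sigma> \<circ> adj (Suc k)" "length ys = ninv (word_perm ys)" "length ys < length ws"
      for k xs ys
    proof -
      define \<rho> where "\<rho> = ?\<sigma> \<circ> adj k \<circ> adj (Suc k) \<circ> adj k"
      have br: "adj k \<circ> adj (Suc k) \<circ> adj k = adj (Suc k) \<circ> adj k \<circ> adj (Suc k)"
        by (auto simp: fun_eq_iff transpose_def)
      have \<rho>': "\<rho> = ?\<sigma> \<circ> adj (Suc k) \<circ> adj k \<circ> adj (Suc k)"
        unfolding \<rho>_def using br by (simp add: comp_assoc)
      have fp: "finperm (?\<sigma> \<circ> adj k)" "finperm (?\<sigma> \<circ> adj k \<circ> adj (Suc k))" "finperm \<rho>"
        by (auto simp: \<rho>_def intro!: finperm_comp)
      have tr: "adj k (Suc (Suc k)) = Suc (Suc k)" "adj (Suc k) k = k"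
        by (auto simp: transpose_def)
      have n: "ninv (?\<sigma> \<circ> adj k) = Suc (ninv (?\<sigma> \<circ> adj k \<circ> adj (Suc k)))"
        "ninv (?\<sigma> \<circ> adj k \<circ> adj (Suc k)) = Suc (ninv \<rho>)" "ninv ?\<sigma> = Suc (ninv (?\<sigma> \<circ> adj k))"
        "ninv ?\<sigma> = Suc (ninv (?\<sigma> \<circ> adj (Suc k)))"
        using ninv_comp_adj'[OF finperm_word_perm k(1)] ninv_comp_adj'[OF fp(1), of "Suc k"]
          ninv_comp_adj'[OF fp(2), of k] ninv_comp_adj'[OF finperm_word_perm k(2)] k
        by (simp_all add: tr \<rho>_def)
      obtain us where us: "word_perm us = \<rho>" "length us = ninv \<rho>"
        using finperm_exists_word fp by blast
      have "word_perm ((us @ [k]) @ [Suc k]) = ?\<sigma> \<circ> adj k"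
        by (simp only: word_perm_snoc us(1) \<rho>_def comp_adj_adj)
      then have e1: "word_perm (us @ [k, Suc k]) = ?\<sigma> \<circ> adj k"
        by (simp only: append.assoc append_Cons append_Nil)
      have "word_perm ((us @ [Suc k]) @ [k]) = ?\<sigma> \<circ> adj (Suc k)"
        by (simp only: word_perm_snoc us(1) \<rho>' comp_adj_adj)
      then have e2: "word_perm (us @ [Suc k, k]) = ?\<sigma> \<circ> adj (Suc k)"
        by (simp only: append.assoc append_Cons append_Nil)
      have len_xs: "length (us @ [k, Suc k]) = ninv (word_perm (us @ [k, Suc k]))"
            unfolding e1 using n by (simp add: us(2))
      have act1: "word_act T xs = word_act T (us @ [k, Suc k])"
        by (rule IH[OF xs(3) trans[OF xs(1) e1[symmetric]] xs(2) len_xs])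
      have len_ys: "length (us @ [Suc k, k]) = ninv (word_perm (us @ [Suc k, k]))"
            unfolding e2 using n by (simp add: us(2))
      have act2: "word_act T ys = word_act T (us @ [Suc k, k])"
        by (rule IH[OF ys(3) trans[OF ys(1) e2[symmetric]] ys(2) len_ys])
      show ?thesis
        using act1 act2 by (simp add: fun_eq_iff braid)
    qed
    consider "i = j" | "\<bar>int i - int j\<bar> > 1" | "j = Suc i" | "i = Suc j" by linarith
    then show ?thesis
    proof cases
      case 1
      have "word_act T ws' = word_act T vs'"
        using ws' vs' by (intro IH[OF lens(1) _ i(1) j(1)]) (simp only: 1)
      then show ?thesis using 1 by (simp add: ws vs)
    next
      case 2
      then show ?thesis by (rule far_case)
    next
      case 3
      have "word_act T (ws' @ [i]) = word_act T (vs' @ [Suc i])"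
        by (rule near_case) (use i j ws' vs' lens 3 in simp_all)
      then show ?thesis by (simp only: ws vs 3)
    next
      case 4
      have "word_act T (vs' @ [j]) = word_act T (ws' @ [Suc j])"
        by (rule near_case) (use i j ws' vs' lens 4 in simp_all)
      then show ?thesis by (simp only: ws vs 4)
    qed
  qed
qed

lemma perm_act_word:
  assumes "length ws = ninv (word_perm ws)"
  shows "perm_act (word_perm ws) = word_act T ws"
  unfolding perm_act_def
  by (rule matsumoto_aux) (use assms some_reduced_word[OF finperm_word_perm, of ws] in auto)

lemma perm_act_comp:
  assumes "finperm \<sigma>" "finperm \<tau>" "ninv (\<sigma> \<circ> \<tau>) = ninv \<sigma> + ninv \<tau>"
  shows "perm_act (\<sigma> \<circ> \<tau>) = perm_act \<sigma> \<circ> perm_act \<tau>"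
proof -
  let ?w = "some_reduced_word"
  have "word_perm (?w \<sigma> @ ?w \<tau>) = \<sigma> \<circ> \<tau>" "length (?w \<sigma> @ ?w \<tau>) = ninv (\<sigma> \<circ> \<tau>)"
    using assms by (simp_all add: some_reduced_word)
  then have "perm_act (\<sigma> \<circ> \<tau>) = word_act T (?w \<sigma> @ ?w \<tau>)"
    by (metis perm_act_word)
  then show ?thesis
    by (simp add: perm_act_def)
qed

lemma perm_act_id [simp]: "perm_act id = id"
  using perm_act_word[of "[]"] by simp

lemma perm_act_adj: "perm_act (adj i) = T i"
proof -
  have "length [i] = ninv (word_perm [i])"
    using ninv_comp_adj[of id i] by simp
  from perm_act_word[OF this] show ?thesis by simp
qed

lemma perm_act_adj_comp:
  assumes "finperm \<sigma>" "inv \<sigma> i < inv \<sigma> (Suc i)"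
  shows "perm_act (adj i \<circ> \<sigma>) = T i \<circ> perm_act \<sigma>"
proof -
  have "inv (adj i \<circ> \<sigma>) = inv \<sigma> \<circ> adj i"
    using assms by (simp add: o_inv_distrib finperm_bij)
  then have "ninv (adj i \<circ> \<sigma>) = ninv (inv \<sigma> \<circ> adj i)"
    using ninv_inv[of "adj i \<circ> \<sigma>"] assms by (simp add: finperm_comp)
  also have "\<dots> = ninv (adj i) + ninv \<sigma>"
    using ninv_comp_adj[OF finperm_inv[OF assms(1)] assms(2)] ninv_comp_adj[of id i] ninv_inv[OF assms(1)]
    by simp
  finally show ?thesis
    using assms by (simp add: perm_act_comp perm_act_adj)
qed

text \<open>Lengths add in every factorization of the longest element, by complementation of
  inversions.\<close>

lemma perm_act_revp_factor_right:
  assumes "\<sigma> permutes {a..b}"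
  shows "perm_act (revp a b) = perm_act (revp a b \<circ> inv \<sigma>) \<circ> perm_act \<sigma>"
proof -
  have fp: "finperm \<sigma>" by (rule finperm_permutes[OF assms]) simp
  have *: "revp a b \<circ> inv \<sigma> \<circ> \<sigma> = revp a b"
    using finperm_bij[OF fp] by (simp add: comp_assoc bij_is_inj)
  have "ninv (revp a b) = ninv (revp a b \<circ> inv \<sigma>) + ninv \<sigma>"
    using ninv_revp_comp[OF permutes_inv[OF assms]] ninv_inv[OF fp] ninv_revp[of a b] by simp
  then show ?thesis
    using perm_act_comp[of "revp a b \<circ> inv \<sigma>" \<sigma>] fp by (simp add: * finperm_comp finperm_inv)
qed

lemma perm_act_revp_factor_left:
  assumes "\<sigma> permutes {a..b}"
  shows "perm_act (revp a b) = perm_act \<sigma> \<circ> perm_act (inv \<sigma> \<circ> revp a b)"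
proof -
  have fp: "finperm \<sigma>" by (rule finperm_permutes[OF assms]) simp
  have *: "\<sigma> \<circ> (inv \<sigma> \<circ> revp a b) = revp a b"
    using finperm_bij[OF fp] by (simp add: comp_assoc[symmetric] bij_is_surj surj_iff[THEN iffD1])
  have "ninv (inv \<sigma> \<circ> revp a b) = ninv (revp a b \<circ> \<sigma>)"
    using ninv_inv[of "inv \<sigma> \<circ> revp a b"] fp finperm_bij[OF fp]
    by (simp add: o_inv_distrib finperm_comp finperm_inv finperm_bij bij_imp_bij_inv inv_inv_eq)
  then have "ninv (revp a b) = ninv \<sigma> + ninv (inv \<sigma> \<circ> revp a b)"
    using ninv_revp_comp[OF assms] ninv_revp[of a b] by simp
  then show ?thesis
    using perm_act_comp[of \<sigma> "inv \<sigma> \<circ> revp a b"] fp by (simp add: * finperm_comp finperm_inv)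
qed

text \<open>With \<open>w\<close> the reversal, \<open>s_i w = w s_j\<close> for the mirrored letter
  \<open>j\<close>. Factoring \<open>w\<close> once with \<open>s_i\<close> on the left and once
  with \<open>s_j\<close> on the right leaves the same middle element, so \<open>T_i T_w\<close> and
  \<open>T_w T_j\<close> are the same triple product.\<close>

lemma T_perm_act_revp:
  assumes "i \<in> {a..<b}"
  shows "T i (perm_act (revp a b) x) = perm_act (revp a b) (T (a + b - Suc i) x)"
proof -
  define j where "j = a + b - Suc i"
  have j: "j \<in> {a..<b}" using assms by (auto simp: j_def)
  have "revp a b j = Suc i" "revp a b (Suc j) = i"
    using assms by (auto simp: revp_def j_def)
  then have "adj i \<circ> revp a b = revp a b \<circ> adj j"
    using finperm_comp_transpose[of "revp a b" j "Suc j"] by (simp add: transpose_commute)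
  moreover have "adj i permutes {a..b}" "adj j permutes {a..b}"
    using assms j by (auto intro: permutes_swap_id)
  ultimately have "perm_act (revp a b) = T i \<circ> perm_act (adj i \<circ> revp a b)"
    "perm_act (revp a b) = perm_act (adj i \<circ> revp a b) \<circ> T j"
    using perm_act_revp_factor_left[of "adj i" a b] perm_act_revp_factor_right[of "adj j" a b]
    by (simp_all add: perm_act_adj)
  then show ?thesis
    unfolding j_def[symmetric] by (metis comp_apply)
qed

text \<open>The length of the cycle is not computed: subadditivity and the length of the word bound
  the two factors from above, and these bounds add up to the known length of the reversal. Hence all
  of them are equalities.\<close>

lemma perm_act_revp_last:
  assumes "a \<le> Suc b"
  shows "perm_act (revp a (Suc b)) = word_act T [a..<Suc b] \<circ> perm_act (revp a b)"
proof -
  have "Suc (Suc b) - a = Suc (Suc b - a)" using assms by simp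
  then have "ninv (revp a (Suc b)) = ninv (revp a b) + (Suc b - a)"
    by (simp add: ninv_revp numeral_2_eq_2)
  moreover have "ninv (revp a (Suc b)) \<le> ninv (word_perm [a..<Suc b]) + ninv (revp a b)"
    unfolding revp_split_last[OF assms] by (rule ninv_comp_le) (rule finperm_word_perm, simp)
  moreover have "ninv (word_perm [a..<Suc b]) \<le> Suc b - a"
    using ninv_word_perm_le[of "[a..<Suc b]"] by (simp del: upt_Suc)
  ultimately have *: "ninv (word_perm [a..<Suc b]) = Suc b - a"
    "ninv (revp a (Suc b)) = ninv (word_perm [a..<Suc b]) + ninv (revp a b)"
    by linarith+
  have "perm_act (word_perm [a..<Suc b] \<circ> revp a b) = perm_act (word_perm [a..<Suc b]) \<circ> perm_act (revp a b)"
    by (rule perm_act_comp[OF finperm_word_perm finperm_revp]) (use * revp_split_last[OF assms] in metis)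
  moreover have "perm_act (word_perm [a..<Suc b]) = word_act T [a..<Suc b]"
    by (rule perm_act_word) (use * in \<open>simp del: upt_Suc\<close>)
  ultimately show ?thesis
    unfolding revp_split_last[OF assms] by simp
qed

lemma perm_act_revp_first:
  assumes "a \<le> Suc b"
  shows "perm_act (revp a (Suc b)) = word_act T (rev [a..<Suc b]) \<circ> perm_act (revp (Suc a) (Suc b))"
proof -
  have "Suc (Suc b) - a = Suc (Suc b - a)" using assms by simp
  then have "ninv (revp a (Suc b)) = ninv (revp (Suc a) (Suc b)) + (Suc b - a)"
    by (simp add: ninv_revp numeral_2_eq_2)
  moreover have "ninv (revp a (Suc b)) \<le> ninv (word_perm (rev [a..<Suc b])) + ninv (revp (Suc a) (Suc b))"
    unfolding revp_split_first[OF assms] by (rule ninv_comp_le) (rule finperm_word_perm, simp)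
  moreover have "ninv (word_perm (rev [a..<Suc b])) \<le> Suc b - a"
    using ninv_word_perm_le[of "rev [a..<Suc b]"] by (simp del: upt_Suc)
  ultimately have *: "ninv (word_perm (rev [a..<Suc b])) = Suc b - a"
    "ninv (revp a (Suc b)) = ninv (word_perm (rev [a..<Suc b])) + ninv (revp (Suc a) (Suc b))"
    by linarith+
  have "perm_act (word_perm (rev [a..<Suc b]) \<circ> revp (Suc a) (Suc b)) =
      perm_act (word_perm (rev [a..<Suc b])) \<circ> perm_act (revp (Suc a) (Suc b))"
    by (rule perm_act_comp[OF finperm_word_perm finperm_revp]) (use * revp_split_first[OF assms] in metis)
  moreover have "perm_act (word_perm (rev [a..<Suc b])) = word_act T (rev [a..<Suc b])"
    by (rule perm_act_word) (use * in \<open>simp del: upt_Suc\<close>)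
  ultimately show ?thesis
    unfolding revp_split_first[OF assms] by simp
qed

lemma perm_act_in_range:
  assumes "\<sigma> permutes {a..b}"
  obtains ws where "set ws \<subseteq> {a..<b}" "perm_act \<sigma> = word_act T ws" "length ws = ninv \<sigma>" "word_perm ws = \<sigma>"
  using exists_word[OF assms] perm_act_word by metis

end

section \<open>The order on compositions\<close>

lemma in_compositions_iff: "\<eta> \<in> compositions N \<longleftrightarrow> (\<forall>j. j \<notin> {1..N} \<longrightarrow> lookup \<eta> j = 0)"
  by (auto simp: compositions_def in_keys_iff)

lemma permute_mono_compositions:
  assumes "\<eta> \<in> compositions N" "\<sigma> permutes {1..N}"
  shows "permute_mono \<sigma> \<eta> \<in> compositions N"
  using assms by (simp add: in_compositions_iff lookup_permute_mono permutes_inj permutes_not_in)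

lemma swap_mono_compositions:
  "\<eta> \<in> compositions N \<Longrightarrow> a \<in> {1..N} \<Longrightarrow> b \<in> {1..N} \<Longrightarrow> swap_mono a b \<eta> \<in> compositions N"
  by (rule permute_mono_compositions) (auto intro: permutes_swap_id)

lemma inner_compositions:
  assumes "\<eta> \<in> compositions N" "a \<in> {1..N}" "b \<in> {1..N}" "\<kappa> \<in> inner a b \<eta>"
  shows "\<kappa> \<in> compositions N"
  unfolding in_compositions_iff
proof (intro allI impI)
  fix j assume "j \<notin> {1..N}"
  moreover from this have "j \<noteq> a \<and> j \<noteq> b" using assms by blast
  ultimately show "lookup \<kappa> j = 0"
    using assms by (simp add: inner_def in_compositions_iff)
qed

section \<open>Decreasing rearrangements and dominance\<close>

lemma mset_decreasing: "mset (decreasing N \<eta>) = image_mset (lookup \<eta>) (mset_set {1..N})"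
  by (simp add: decreasing_def atLeastLessThanSuc_atLeastAtMost del: upt_Suc)

lemma sum_list_decreasing: "(\<Sum>x\<leftarrow>decreasing N \<eta>. f x) = (\<Sum>j\<in>{1..N}. f (lookup \<eta> j))"
proof -
  have "(\<Sum>x\<leftarrow>decreasing N \<eta>. f x) = sum_mset (image_mset f (mset (decreasing N \<eta>)))"
    by (metis mset_map sum_mset_sum_list)
  then show ?thesis
    by (simp add: mset_decreasing sum_unfold_sum_mset image_mset.compositionality comp_def)
qed

lemma length_decreasing [simp]: "length (decreasing N \<eta>) = N"
  by (simp add: decreasing_def)

lemma sorted_decreasing: "sorted_wrt (\<ge>) (decreasing N \<eta>)"
  using sorted_sort[of "map (lookup \<eta>) [1..<Suc N]"]
  by (simp add: decreasing_def sorted_wrt_rev del: upt_Suc)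

lemma decreasing_eqI:
  assumes "image_mset (lookup \<eta>) (mset_set {1..N}) = image_mset (lookup \<nu>) (mset_set {1..N})"
  shows "decreasing N \<eta> = decreasing N \<nu>"
proof -
  have "mset (map (lookup \<eta>) [1..<Suc N]) = mset (map (lookup \<nu>) [1..<Suc N])"
    using assms by (simp add: atLeastLessThanSuc_atLeastAtMost del: upt_Suc)
  then have "sort (map (lookup \<eta>) [1..<Suc N]) = sort (map (lookup \<nu>) [1..<Suc N])"
    by (metis mset_sort properties_for_sort sorted_sort)
  then show ?thesis by (simp add: decreasing_def)
qed

lemma decreasing_permute_mono:
  assumes "\<sigma> permutes {1..N}"
  shows "decreasing N (permute_mono \<sigma> \<eta>) = decreasing N \<eta>"
proof (rule decreasing_eqI)
  have "mset_set {1..N} = image_mset \<sigma> (mset_set {1..N})"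
    using permutes_inj_on[OF assms] permutes_image[OF assms] by (simp add: image_mset_mset_set)
  then have "image_mset (lookup \<eta>) (mset_set {1..N}) = image_mset (lookup \<eta>) (image_mset \<sigma> (mset_set {1..N}))"
    by (rule arg_cong)
  also have "\<dots> = image_mset (lookup (permute_mono \<sigma> \<eta>)) (mset_set {1..N})"
    unfolding image_mset.compositionality
    by (intro image_mset_cong) (simp add: lookup_permute_mono permutes_inj[OF assms])
  finally show "image_mset (lookup (permute_mono \<sigma> \<eta>)) (mset_set {1..N}) = image_mset (lookup \<eta>) (mset_set {1..N})"
    by simp
qed

text \<open>Take for \<open>c\<close> the first entry of \<open>ys\<close> left out by
  \<open>take k\<close>. For \<open>ys\<close> the truncated differences then measure the partial
  sum exactly, as earlier entries are at least \<open>c\<close> and later ones at most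
  \<open>c\<close>; for \<open>xs\<close> they bound it from above.\<close>

lemma sorted_desc_take_sum_le:
  fixes xs ys :: "nat list"
  assumes "length xs = length ys" "sorted_wrt (\<ge>) ys"
    and le: "\<And>c. (\<Sum>x\<leftarrow>xs. x - c) \<le> (\<Sum>y\<leftarrow>ys. y - c)"
  shows "sum_list (take k xs) \<le> sum_list (take k ys)"
proof (cases "k < length ys")
  case False
  then show ?thesis using assms(1) le[of 0] by simp
next
  case True
  define c where "c = ys ! k"
  have split: "(\<Sum>x\<leftarrow>zs. x - c) = (\<Sum>x\<leftarrow>take k zs. x - c) + (\<Sum>x\<leftarrow>drop k zs. x - c)" for zs
    by (metis append_take_drop_id map_append sum_list_append)
  have bound: "sum_list zs \<le> length zs * c + (\<Sum>x\<leftarrow>zs. x - c)" for zs :: "nat list"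
    by (induction zs) auto
  have exact: "sum_list zs = length zs * c + (\<Sum>x\<leftarrow>zs. x - c)" if "\<forall>x\<in>set zs. c \<le> x" for zs :: "nat list"
    using that by (induction zs) auto
  have "sum_list (take k xs) \<le> k * c + (\<Sum>x\<leftarrow>take k xs. x - c)"
    using bound[of "take k xs"] True assms(1) by simp
  also have "\<dots> \<le> k * c + (\<Sum>y\<leftarrow>ys. y - c)"
    using le[of c] split[of xs] by linarith
  also have "(\<Sum>x\<leftarrow>drop k ys. x - c) = 0"
  proof -
    have "x \<le> c" if "x \<in> set (drop k ys)" for x
    proof -
      have "\<exists>i. i < length ys - k \<and> x = ys ! (k + i)"
        using that by (auto simp: in_set_conv_nth)
      then obtain i where "i < length ys - k" "x = ys ! (k + i)" by blast
      then show ?thesis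
        using assms(2) by (cases "i = 0") (auto simp: c_def sorted_wrt_iff_nth_less)
    qed
    then show ?thesis by (simp add: sum_list_eq_0_iff)
  qed
  then have "k * c + (\<Sum>y\<leftarrow>ys. y - c) = k * c + (\<Sum>y\<leftarrow>take k ys. y - c)"
    using split[of ys] by simp
  also have "\<dots> = sum_list (take k ys)"
  proof -
    have "c \<le> x" if "x \<in> set (take k ys)" for x
      using that assms(2) True by (auto simp: c_def in_set_conv_nth sorted_wrt_iff_nth_less)
    then show ?thesis using exact[of "take k ys"] True by simp
  qed
  finally show ?thesis .
qed

text \<open>Comparing the sums of the truncated differences \<open>x - c\<close> avoids sorting.\<close>

lemma dominance_less_decreasingI:
  assumes "\<And>c. (\<Sum>j\<in>{1..N}. lookup \<nu> j - c) \<le> (\<Sum>j\<in>{1..N}. lookup \<eta> j - c)"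
    and "(\<Sum>j\<in>{1..N}. lookup \<nu> j) = (\<Sum>j\<in>{1..N}. lookup \<eta> j)"
    and "(\<Sum>j\<in>{1..N}. (lookup \<nu> j)\<^sup>2) < (\<Sum>j\<in>{1..N}. (lookup \<eta> j)\<^sup>2)"
  shows "dominance_less (decreasing N \<nu>) (decreasing N \<eta>)"
  unfolding dominance_less_def
proof (intro conjI allI)
  \<comment> \<open>The sum of squares depends on the rearrangement only, so a strict inequality
    excludes equality.\<close>
  show "decreasing N \<nu> \<noteq> decreasing N \<eta>"
    using assms(3) sum_list_decreasing[of "\<lambda>x. x\<^sup>2" N] by (metis less_irrefl)
  show "sum_list (decreasing N \<nu>) = sum_list (decreasing N \<eta>)"
    using assms(2) sum_list_decreasing[of "\<lambda>x. x" N] by simp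
  fix k
  show "sum_list (take k (decreasing N \<nu>)) \<le> sum_list (take k (decreasing N \<eta>))"
    by (rule sorted_desc_take_sum_le)
      (use assms(1) sum_list_decreasing[of "\<lambda>x. x - _" N] in \<open>simp_all add: sorted_decreasing\<close>)
qed

lemma sum_remove2:
  fixes f :: "nat \<Rightarrow> nat"
  assumes "a \<noteq> b" "a \<in> {1..N}" "b \<in> {1..N}"
  shows "sum f {1..N} = f a + f b + sum f ({1..N} - {a, b})"
proof -
  have "sum f {1..N} = sum f {a, b} + sum f ({1..N} - {a, b})"
    using assms by (metis empty_subsetI finite_atLeastAtMost insert_subset sum.subset_diff add.commute)
  then show ?thesis using assms(1) by simp
qed

lemma sum_squares_less_of_between:
  fixes x y u v :: nat
  assumes "x + y = u + v" "min u v < x" "x < max u v"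
  shows "x\<^sup>2 + y\<^sup>2 < u\<^sup>2 + v\<^sup>2"
proof -
  have aux: "x\<^sup>2 + y\<^sup>2 < u\<^sup>2 + v\<^sup>2" if xy: "x + y = u + v" "u < x" "x < v" for x y u v :: nat
  proof -
    obtain d where d: "x = u + d" "d > 0" using xy(2) less_imp_add_positive by blast
    obtain e where e: "v = x + e" "e > 0" using xy(3) less_imp_add_positive by blast
    have "y = u + e" using xy(1) d e by simp
    then have "u\<^sup>2 + v\<^sup>2 = x\<^sup>2 + y\<^sup>2 + 2 * d * e"
      using d e by (simp add: power2_eq_square algebra_simps)
    then show ?thesis using d e by simp
  qed
  show ?thesis
  proof (cases "u \<le> v")
    case True
    then show ?thesis using assms aux[of x y u v] by (simp add: min_def max_def)
  next
    case False
    then show ?thesis using assms aux[of x y v u] by (simp add: min_def max_def)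
  qed
qed

lemma inner_dominance_less:
  assumes "a \<noteq> b" "a \<in> {1..N}" "b \<in> {1..N}" "\<kappa> \<in> inner a b \<eta>"
  shows "dominance_less (decreasing N \<kappa>) (decreasing N \<eta>)"
proof (rule dominance_less_decreasingI)
  have \<kappa>: "lookup \<kappa> a + lookup \<kappa> b = lookup \<eta> a + lookup \<eta> b"
    "min (lookup \<eta> a) (lookup \<eta> b) < lookup \<kappa> a" "lookup \<kappa> a < max (lookup \<eta> a) (lookup \<eta> b)"
    using assms(4) by (simp_all add: inner_def)
  have rest: "sum (\<lambda>j. f (lookup \<kappa> j)) ({1..N} - {a, b}) = sum (\<lambda>j. f (lookup \<eta> j)) ({1..N} - {a, b})"
    for f :: "nat \<Rightarrow> nat"
    using assms(4) by (intro sum.cong) (auto simp: inner_def)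
  note split = sum_remove2[OF assms(1-3)]
  show "(\<Sum>j\<in>{1..N}. lookup \<kappa> j - c) \<le> (\<Sum>j\<in>{1..N}. lookup \<eta> j - c)" for c
    using \<kappa> rest[of "\<lambda>x. x - c"] split[of "\<lambda>j. lookup \<kappa> j - c"] split[of "\<lambda>j. lookup \<eta> j - c"]
    by linarith
  show "(\<Sum>j\<in>{1..N}. lookup \<kappa> j) = (\<Sum>j\<in>{1..N}. lookup \<eta> j)"
    using \<kappa> rest[of "\<lambda>x. x"] split[of "lookup \<kappa>"] split[of "lookup \<eta>"] by linarith
  show "(\<Sum>j\<in>{1..N}. (lookup \<kappa> j)\<^sup>2) < (\<Sum>j\<in>{1..N}. (lookup \<eta> j)\<^sup>2)"
    using sum_squares_less_of_between[OF \<kappa>] rest[of "\<lambda>x. x\<^sup>2"]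
      split[of "\<lambda>j. (lookup \<kappa> j)\<^sup>2"] split[of "\<lambda>j. (lookup \<eta> j)\<^sup>2"] by linarith
qed

section \<open>The strict order on compositions\<close>

lemma dominance_less_trans:
  assumes "dominance_less xs ys" "dominance_less ys zs" "length xs = length ys" "length ys = length zs"
  shows "dominance_less xs zs"
proof -
  have "xs \<noteq> zs"
  proof
    assume "xs = zs"
    then have eq: "sum_list (take k xs) = sum_list (take k ys)" for k
      using assms(1,2) by (auto simp: dominance_less_def intro: le_antisym)
    have "xs ! k = ys ! k" if "k < length xs" for k
      using eq[of k] eq[of "Suc k"] that assms(3) by (simp add: take_Suc_conv_app_nth)
    then have "xs = ys"
      using assms(3) by (simp add: list_eq_iff_nth_eq)
    then show False
      using assms(1) by (simp add: dominance_less_def)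
  qed
  then show ?thesis
    using assms(1,2) by (auto simp: dominance_less_def intro: order.trans)
qed

lemma comp_less_trans:
  assumes "comp_less N \<kappa> \<nu>" "comp_less N \<nu> \<eta>"
  shows "comp_less N \<kappa> \<eta>"
  using assms dominance_less_trans[of "decreasing N \<kappa>" "decreasing N \<nu>" "decreasing N \<eta>"]
  unfolding comp_less_def bruhat_less_def by (auto intro: tranclp_trans)

lemma bruhat_less_imp_length: "bruhat_less N u w \<Longrightarrow> perm_length u < perm_length w"
  unfolding bruhat_less_def by (induction rule: tranclp_induct) auto

lemma comp_less_irrefl: "\<not> comp_less N \<eta> \<eta>"
  using bruhat_less_imp_length[of N "min_perm N \<eta>" "min_perm N \<eta>"]
  by (auto simp: comp_less_def dominance_less_def)

section \<open>Minimal permutations in terms of ranks\<close>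

definition rank_perm :: "nat \<Rightarrow> mono \<Rightarrow> nat \<Rightarrow> nat" where
  "rank_perm N \<eta> k = (if k \<in> {1..N} then comp_rank N \<eta> k else k)"

text \<open>The rank of \<open>k\<close> counts the positions \<open>j\<close> that beat \<open>k\<close>, larger entries and then earlier ones first.\<close>

definition beats :: "mono \<Rightarrow> nat \<Rightarrow> nat \<Rightarrow> bool" where
  "beats \<eta> j k \<longleftrightarrow> lookup \<eta> k < lookup \<eta> j \<or> (lookup \<eta> j = lookup \<eta> k \<and> j \<le> k)"

lemma comp_rank_eq_card:
  assumes "k \<le> N"
  shows "comp_rank N \<eta> k = card {j \<in> {1..N}. beats \<eta> j k}"
proof -
  have "{j \<in> {1..N}. beats \<eta> j k} =
      {j \<in> {1..N}. lookup \<eta> k < lookup \<eta> j} \<union> {j \<in> {1..k}. lookup \<eta> j = lookup \<eta> k}"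
    using assms by (auto simp: beats_def)
  then show ?thesis
    by (simp add: comp_rank_def card_Un_disjoint[symmetric] disjoint_iff)
qed

lemma rank_perm_permutes: "rank_perm N \<eta> permutes {1..N}"
proof -
  let ?B = "\<lambda>k. {j \<in> {1..N}. beats \<eta> j k}"
  have less: "comp_rank N \<eta> j < comp_rank N \<eta> k" if "j \<in> {1..N}" "k \<in> {1..N}" "beats \<eta> j k" "j \<noteq> k" for j k
  proof -
    have "?B j \<subset> ?B k"
    proof
      show "?B j \<subseteq> ?B k" using that by (auto simp: beats_def)
      have "k \<in> ?B k" "k \<notin> ?B j" using that by (auto simp: beats_def)
      then show "?B j \<noteq> ?B k" by blast
    qed
    then have "card (?B j) < card (?B k)" by (intro psubset_card_mono) auto
    then show ?thesis using that by (simp add: comp_rank_eq_card)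
  qed
  have "inj_on (rank_perm N \<eta>) {1..N}"
  proof (rule inj_onI, rule ccontr)
    fix j k assume "j \<in> {1..N}" "k \<in> {1..N}" "rank_perm N \<eta> j = rank_perm N \<eta> k" "j \<noteq> k"
    moreover have "beats \<eta> j k \<or> beats \<eta> k j" by (auto simp: beats_def)
    ultimately show False
      using less[of j k] less[of k j] by (auto simp: rank_perm_def)
  qed
  moreover have "rank_perm N \<eta> ` {1..N} \<subseteq> {1..N}"
  proof
    fix r assume "r \<in> rank_perm N \<eta> ` {1..N}"
    then obtain k where k: "k \<in> {1..N}" "r = card (?B k)"
      by (auto simp: rank_perm_def comp_rank_eq_card)
    have "k \<in> ?B k" using k by (simp add: beats_def)
    then have "0 < card (?B k)" by (auto simp: card_gt_0_iff)
    moreover have "card (?B k) \<le> card {1..N}" by (intro card_mono) auto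
    ultimately show "r \<in> {1..N}" using k by simp
  qed
  ultimately have "bij_betw (rank_perm N \<eta>) {1..N} {1..N}"
    by (intro bij_betw_imageI endo_inj_surj) auto
  then show ?thesis
    by (rule bij_imp_permutes) (auto simp: rank_perm_def)
qed

text \<open>The hypothesis says that \<open>w\<close> lists the positions in the order given by
  \<open>beats\<close>, so those that beat \<open>w i\<close> are exactly
  \<open>w 1, ..., w i\<close>.\<close>

lemma rank_perm_comp_eq_id:
  assumes w: "w permutes {1..N}"
    and dec: "\<And>i j. i \<in> {1..N} \<Longrightarrow> j \<in> {1..N} \<Longrightarrow> i < j \<Longrightarrow>
      lookup \<eta> (w j) < lookup \<eta> (w i) \<or> (lookup \<eta> (w j) = lookup \<eta> (w i) \<and> w i < w j)"
  shows "rank_perm N \<eta> \<circ> w = id"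
proof
  fix i
  show "(rank_perm N \<eta> \<circ> w) i = id i"
  proof (cases "i \<in> {1..N}")
    case True
    have inN: "w j \<in> {1..N} \<longleftrightarrow> j \<in> {1..N}" for j
      by (rule permutes_in_image[OF w])
    have "{j \<in> {1..N}. beats \<eta> j (w i)} = w ` {1..i}"
    proof (rule set_eqI)
      fix j
      obtain l where l: "j = w l" using permutes_surj[OF w] by (metis surjD)
      have "beats \<eta> (w l) (w i) \<longleftrightarrow> l \<le> i" if "l \<in> {1..N}"
        using dec[of i l] dec[of l i] that True by (cases l i rule: linorder_cases) (auto simp: beats_def)
      moreover have "w l \<in> w ` {1..i} \<longleftrightarrow> l \<in> {1..i}"
        using permutes_inj[OF w] by (rule inj_image_mem_iff)
      ultimately show "j \<in> {j \<in> {1..N}. beats \<eta> j (w i)} \<longleftrightarrow> j \<in> w ` {1..i}"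
        using True inN[of l] unfolding l by auto
    qed
    then have "card {j \<in> {1..N}. beats \<eta> j (w i)} = i"
      using permutes_inj_on[OF w, of "{1..i}"] by (simp add: card_image)
    then show ?thesis
      using True inN[of i] by (simp add: rank_perm_def comp_rank_eq_card)
  next
    case False
    then show ?thesis
      using permutes_not_in[OF w False] by (auto simp: rank_perm_def)
  qed
qed

lemma lookup_inv_rank_perm:
  fixes \<eta> :: mono
  assumes "i \<in> {1..N}" "j \<in> {1..N}" "i < j"
  defines "w \<equiv> inv (rank_perm N \<eta>)"
  shows "lookup \<eta> (w j) < lookup \<eta> (w i) \<or> (lookup \<eta> (w j) = lookup \<eta> (w i) \<and> w i < w j)"
proof (rule ccontr)
  assume "\<not> ?thesis"
  then have b: "beats \<eta> (w j) (w i)"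
    by (auto simp: beats_def)
  have w: "w permutes {1..N}"
    unfolding w_def by (rule permutes_inv[OF rank_perm_permutes])
  then have wN: "w i \<in> {1..N}" "w j \<in> {1..N}"
    using assms permutes_in_image[OF w] by blast+
  have r: "rank_perm N \<eta> (w k) = k" for k
    unfolding w_def using permutes_inverses(1)[OF rank_perm_permutes] by metis
  have "{l \<in> {1..N}. beats \<eta> l (w j)} \<subseteq> {l \<in> {1..N}. beats \<eta> l (w i)}"
    using b by (auto simp: beats_def)
  then have "card {l \<in> {1..N}. beats \<eta> l (w j)} \<le> card {l \<in> {1..N}. beats \<eta> l (w i)}"
    by (intro card_mono) auto
  then have "rank_perm N \<eta> (w j) \<le> rank_perm N \<eta> (w i)"
    using wN by (simp add: rank_perm_def comp_rank_eq_card)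
  then show False using assms(3) by (simp add: r)
qed

lemma decreasing_nth_inv_rank_perm:
  assumes "i \<in> {1..N}"
  shows "lookup \<eta> (inv (rank_perm N \<eta>) i) = decreasing N \<eta> ! (i - 1)"
proof -
  let ?w = "inv (rank_perm N \<eta>)"
  have w: "?w permutes {1..N}" by (rule permutes_inv[OF rank_perm_permutes])
  define xs where "xs = map (\<lambda>i. lookup \<eta> (?w i)) [1..<Suc N]"
  have "sorted_wrt (\<ge>) xs"
    unfolding sorted_wrt_iff_nth_less
  proof (intro allI impI)
    fix i j assume "i < j" "j < length xs"
    then show "xs ! j \<le> xs ! i"
      using lookup_inv_rank_perm[of "Suc i" N "Suc j" \<eta>]
      by (auto simp: xs_def simp del: upt_Suc)
  qed
  then have "sorted (rev xs)"
    by (simp add: sorted_wrt_rev)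
  moreover have "mset (map (lookup \<eta>) [1..<Suc N]) = mset (rev xs)"
  proof -
    have "image_mset ?w (mset_set {1..N}) = mset_set {1..N}"
      using permutes_inj_on[OF w] permutes_image[OF w] by (simp add: image_mset_mset_set)
    then have "image_mset (lookup \<eta>) (mset_set {1..N}) = image_mset (lookup \<eta>) (image_mset ?w (mset_set {1..N}))"
      by simp
    then show ?thesis
      by (simp add: xs_def atLeastLessThanSuc_atLeastAtMost image_mset.compositionality comp_def del: upt_Suc)
  qed
  ultimately have "sort (map (lookup \<eta>) [1..<Suc N]) = rev xs"
    by (metis properties_for_sort)
  then have "decreasing N \<eta> = xs"
    by (simp add: decreasing_def)
  moreover obtain k where "i = Suc k" "k < N"
    using assms by (cases i) auto
  ultimately show ?thesis
    by (simp add: xs_def del: upt_Suc)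
qed

text \<open>A shortest sorting permutation keeps positions with equal entries in increasing order,
  since otherwise a transposition would shorten it. It is therefore determined, and the choice by
  \<open>ARG_MIN\<close> becomes an explicit formula in the same ranks that occur in the
  eigenvalues.\<close>

lemma min_perm_eq: "min_perm N \<eta> = inv (rank_perm N \<eta>)"
proof -
  let ?P = "\<lambda>w. w permutes {1..N} \<and> (\<forall>i\<in>{1..N}. lookup \<eta> (w i) = decreasing N \<eta> ! (i - 1))"
  define w where "w = min_perm N \<eta>"
  have ex: "?P (inv (rank_perm N \<eta>))"
    using permutes_inv[OF rank_perm_permutes] decreasing_nth_inv_rank_perm by blast
  have P: "?P w" and min: "\<And>v. ?P v \<Longrightarrow> perm_length w \<le> perm_length v"
    unfolding w_def min_perm_def using arg_min_nat_lemma[of ?P, OF ex, of perm_length] by blast+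
  have fp: "finperm w" using P finperm_permutes by blast
  have "rank_perm N \<eta> \<circ> w = id"
  proof (rule rank_perm_comp_eq_id)
    fix i j assume ij: "i \<in> {1..N}" "j \<in> {1..N}" "i < j"
    have le: "lookup \<eta> (w j) \<le> lookup \<eta> (w i)"
      using P ij sorted_decreasing[of N \<eta>] by (auto simp: sorted_wrt_iff_nth_less)
    have "w i < w j" if eq: "lookup \<eta> (w j) = lookup \<eta> (w i)"
    proof (rule ccontr)
      assume "\<not> w i < w j"
      then have gt: "w j < w i" using ij finperm_inj[OF fp, of i j] by linarith
      define v where "v = w \<circ> transpose i j"
      have "v permutes {1..N}"
        unfolding v_def using P ij by (intro permutes_compose permutes_swap_id) auto
      moreover have "lookup \<eta> (v k) = lookup \<eta> (w k)" for k
        using eq by (auto simp: v_def transpose_def)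
      ultimately have "?P v" using P by simp
      then have "perm_length w \<le> perm_length v" by (rule min)
      moreover have fv: "finperm v" unfolding v_def by (rule finperm_comp[OF fp finperm_transpose])
      moreover have "ninv v < ninv (v \<circ> transpose i j)"
        by (rule ninv_comp_transpose_less[OF fv ij(3)]) (use gt in \<open>simp add: v_def\<close>)
      moreover have "v \<circ> transpose i j = w"
        by (simp add: v_def comp_assoc)
      ultimately show False
        using fp by (simp add: perm_length_eq_ninv)
    qed
    then show "lookup \<eta> (w j) < lookup \<eta> (w i) \<or> (lookup \<eta> (w j) = lookup \<eta> (w i) \<and> w i < w j)"
      using le by linarith
  qed (use P in blast)
  then have "inv (rank_perm N \<eta>) = w"
    using permutes_bij[OF rank_perm_permutes] by (metis bij_is_inj comp_assoc inv_o_cancel comp_id id_comp)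
  then show ?thesis by (simp add: w_def)
qed

text \<open>If no entry strictly between equals one of the two exchanged ones, the order among equal
  entries is undisturbed. Then \<open>transpose a b \<circ> w\<close> is already the minimal
  permutation of the exchanged composition, and it lies one Bruhat step above
  \<open>w\<close>.\<close>

lemma swap_comp_less_aux:
  assumes ab: "a \<in> {1..N}" "b \<in> {1..N}" "a < b" "lookup \<eta> b < lookup \<eta> a"
    and between: "\<And>c. a < c \<Longrightarrow> c < b \<Longrightarrow> lookup \<eta> c \<noteq> lookup \<eta> a \<and> lookup \<eta> c \<noteq> lookup \<eta> b"
  shows "comp_less N (swap_mono a b \<eta>) \<eta>"
proof -
  let ?\<nu> = "swap_mono a b \<eta>"
  define w where "w = min_perm N \<eta>"
  define a' b' where "a' = rank_perm N \<eta> a" and "b' = rank_perm N \<eta> b"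
  have w: "w permutes {1..N}"
    unfolding w_def min_perm_eq by (rule permutes_inv[OF rank_perm_permutes])
  have wa: "w a' = a" "w b' = b"
    using permutes_inverses(2)[OF rank_perm_permutes] by (simp_all add: w_def min_perm_eq a'_def b'_def)
  have N': "a' \<in> {1..N}" "b' \<in> {1..N}"
    using ab permutes_in_image[OF w] wa by metis+
  have dec: "lookup \<eta> (w j) < lookup \<eta> (w i) \<or> (lookup \<eta> (w j) = lookup \<eta> (w i) \<and> w i < w j)"
    if "i \<in> {1..N}" "j \<in> {1..N}" "i < j" for i j
    unfolding w_def min_perm_eq using lookup_inv_rank_perm that by blast
  have "a' \<noteq> b'" using wa ab by auto
  have "a' < b'"
  proof (rule ccontr)
    assume "\<not> a' < b'"
    then have "b' < a'" using \<open>a' \<noteq> b'\<close> by simp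
    then show False using dec[OF N'(2,1)] ab wa by auto
  qed
  define v where "v = transpose a b \<circ> w"
  have v: "v permutes {1..N}"
    unfolding v_def using w ab by (intro permutes_compose permutes_swap_id) auto
  have "rank_perm N ?\<nu> \<circ> v = id"
  proof (rule rank_perm_comp_eq_id[OF v])
    fix i j assume ij: "i \<in> {1..N}" "j \<in> {1..N}" "i < j"
    have \<nu>: "lookup ?\<nu> (v k) = lookup \<eta> (w k)" for k
      by (simp add: v_def lookup_swap_mono)
    have "v i < v j" if eq: "lookup \<eta> (w j) = lookup \<eta> (w i)" and lt: "w i < w j"
      using between[of "w i"] between[of "w j"] eq lt ab(3,4)
      unfolding v_def comp_apply transpose_def by (auto split: if_splits) (metis linorder_neqE_nat order.strict_trans)+
    then show "lookup ?\<nu> (v j) < lookup ?\<nu> (v i) \<or> (lookup ?\<nu> (v j) = lookup ?\<nu> (v i) \<and> v i < v j)"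
      using dec[OF ij] unfolding \<nu> by blast
  qed
  then have vmin: "min_perm N ?\<nu> = v"
    unfolding min_perm_eq
    using permutes_bij[OF rank_perm_permutes] by (metis bij_is_inj comp_assoc inv_o_cancel comp_id id_comp)
  have fp: "finperm w" "finperm v"
    using w v finperm_permutes by blast+
  have v': "v = w \<circ> transpose a' b'"
    using finperm_comp_transpose[OF fp(1), of a' b'] by (simp add: v_def wa)
  have "ninv w < ninv v"
    unfolding v' using ab wa \<open>a' < b'\<close> by (intro ninv_comp_transpose_less fp) simp_all
  then have "bruhat_less N w v"
    unfolding bruhat_less_def using N' v' fp
    by (intro tranclp.r_into_trancl bexI[of _ a'] bexI[of _ b']) (simp_all add: perm_length_eq_ninv)
  moreover have "decreasing N ?\<nu> = decreasing N \<eta>"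
    using ab by (intro decreasing_permute_mono permutes_swap_id) auto
  ultimately show ?thesis
    by (simp add: comp_less_def vmin w_def)
qed

text \<open>An intermediate position \<open>c\<close> whose entry equals that at \<open>a\<close> or
  at \<open>b\<close> lets the exchange be replaced by two shorter ones through \<open>c\<close>
  with the same result.\<close>

lemma swap_comp_less:
  assumes "a \<in> {1..N}" "b \<in> {1..N}" "a < b" "lookup \<eta> b < lookup \<eta> a"
  shows "comp_less N (swap_mono a b \<eta>) \<eta>"
  using assms
proof (induction "b - a" arbitrary: a b \<eta> rule: less_induct)
  case less
  show ?case
  proof (cases "\<exists>c. a < c \<and> c < b \<and> (lookup \<eta> c = lookup \<eta> a \<or> lookup \<eta> c = lookup \<eta> b)")
    case False
    then show ?thesis
      using less.prems by (intro swap_comp_less_aux) auto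
  next
    case True
    then obtain c where c: "a < c" "c < b" "lookup \<eta> c = lookup \<eta> a \<or> lookup \<eta> c = lookup \<eta> b" by blast
    have cN: "c \<in> {1..N}" using c less.prems by simp
    show ?thesis
    proof (cases "lookup \<eta> c = lookup \<eta> a")
      case True
      have 1: "comp_less N (swap_mono c b \<eta>) \<eta>"
        by (rule less.hyps) (use c cN less.prems True in auto)
      have l: "lookup (swap_mono c b \<eta>) c = lookup \<eta> b" "lookup (swap_mono c b \<eta>) a = lookup \<eta> a"
        using c less.prems by (auto simp: lookup_swap_mono transpose_def)
      have 2: "comp_less N (swap_mono a c (swap_mono c b \<eta>)) (swap_mono c b \<eta>)"
        by (rule less.hyps) (use c cN less.prems l in auto)
      have "swap_mono a c (swap_mono c b \<eta>) = swap_mono a b \<eta>"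
        using c True by (intro poly_mapping_eqI) (auto simp: lookup_swap_mono transpose_def)
      then show ?thesis using comp_less_trans[OF 2 1] by simp
    next
      case False
      then have eq: "lookup \<eta> c = lookup \<eta> b" using c by blast
      have 1: "comp_less N (swap_mono a c \<eta>) \<eta>"
        by (rule less.hyps) (use c cN less.prems eq in auto)
      have l: "lookup (swap_mono a c \<eta>) c = lookup \<eta> a" "lookup (swap_mono a c \<eta>) b = lookup \<eta> b"
        using c less.prems by (auto simp: lookup_swap_mono transpose_def)
      have 2: "comp_less N (swap_mono c b (swap_mono a c \<eta>)) (swap_mono a c \<eta>)"
        by (rule less.hyps) (use c cN less.prems l in auto)
      have "swap_mono c b (swap_mono a c \<eta>) = swap_mono a b \<eta>"
        using c eq by (intro poly_mapping_eqI) (auto simp: lookup_swap_mono transpose_def)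
      then show ?thesis using comp_less_trans[OF 2 1] by simp
    qed
  qed
qed

section \<open>Cherednik operators\<close>

abbreviation Tm :: "nat \<Rightarrow> mpol \<Rightarrow> mpol" where "Tm i \<equiv> TT i (Suc i)"
abbreviation Ti :: "nat \<Rightarrow> mpol \<Rightarrow> mpol" where "Ti i \<equiv> TI i (Suc i)"

definition linop :: "(mpol \<Rightarrow> mpol) \<Rightarrow> bool" where
  "linop F \<longleftrightarrow> (\<forall>p r. F (p + r) = F p + F r) \<and> (\<forall>c p. F (cc c * p) = cc c * F p)"

lemma linopI:
  "(\<And>p r. F (p + r) = F p + F r) \<Longrightarrow> (\<And>c p. F (cc c * p) = cc c * F p) \<Longrightarrow> linop F"
  by (simp add: linop_def)

lemma linop_add: "linop F \<Longrightarrow> F (p + r) = F p + F r"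
  and linop_cc: "linop F \<Longrightarrow> F (cc c * p) = cc c * F p"
  by (simp_all add: linop_def)

lemma linop_0: "linop F \<Longrightarrow> F 0 = 0"
  using linop_cc[of F 0 0] by (simp add: cc_simps)

lemma linop_diff: "linop F \<Longrightarrow> F (p - r) = F p - F r"
  using linop_add[of F "p - r" r] by simp

lemma linop_sum: "linop F \<Longrightarrow> F (sum f A) = (\<Sum>x\<in>A. F (f x))"
  by (induction A rule: infinite_finite_induct) (simp_all add: linop_0 linop_add)

lemma linop_id: "linop id"
  by (rule linopI) simp_all

lemma linop_comp: "linop F \<Longrightarrow> linop G \<Longrightarrow> linop (F \<circ> G)"
  by (simp add: linop_def)

lemma linop_TT: "a \<noteq> b \<Longrightarrow> linop (TT a b)"
  and linop_TI: "a \<noteq> b \<Longrightarrow> linop (TI a b)"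
  by (auto intro!: linopI simp: TT_add TT_cc TI_add TI_cc)

lemma linop_subst: "bij \<sigma> \<Longrightarrow> linop (subst \<sigma> e)"
  by (auto intro!: linopI simp: subst_add subst_mult)

lemma linop_KK: "linop (KK a b)"
  by (auto intro!: linopI simp: KK_add KK_mult)

lemma linop_word_act: "(\<And>i. i \<in> set ws \<Longrightarrow> linop (F i)) \<Longrightarrow> linop (word_act F ws)"
  by (induction ws) (auto intro: linop_comp simp: linop_id)

lemma linop_cc_mult: "linop (\<lambda>p. cc c * p)"
  by (rule linopI) (simp_all add: algebra_simps)

definition cyc :: "nat \<Rightarrow> nat \<Rightarrow> nat" where
  "cyc N = word_perm (rev [1..<N])"

lemma word_perm_rev_upt:
  assumes "a \<le> b"
  shows "word_perm (rev [a..<b]) = (\<lambda>x. if x = a then b else if x \<in> {a<..b} then x - 1 else x)"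
proof -
  have "inv (word_perm [a..<b]) = (\<lambda>x. if x = a then b else if x \<in> {a<..b} then x - 1 else x)"
    by (rule inv_unique_comp) (use assms in \<open>auto simp: word_perm_upt fun_eq_iff\<close>)
  then show ?thesis by (simp add: word_perm_rev)
qed

lemma cyc_apply: "1 \<le> N \<Longrightarrow> cyc N x = (if x = 1 then N else if x \<in> {1<..N} then x - 1 else x)"
  unfolding cyc_def by (subst word_perm_rev_upt) auto

lemma bij_word_perm [simp]: "bij (word_perm ws)"
  by (rule finperm_bij[OF finperm_word_perm])

lemma bij_cyc [simp]: "bij (cyc N)"
  by (simp add: cyc_def)

text \<open>All of \<open>omega\<close> as one substitution: \<open>x_1\<close> goes to
  \<open>q x_N\<close> and \<open>x_j\<close> to \<open>x_(j-1)\<close>, the factor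
  \<open>tau_1\<close> being the weight at \<open>1\<close>.\<close>

definition om :: "nat \<Rightarrow> mpol \<Rightarrow> mpol" where
  "om N = subst (cyc N) (\<lambda>j. of_bool (j = 1))"

lemma linop_om: "linop (om N)"
  by (simp add: om_def linop_subst)

lemma om_mult: "om N (p * r) = om N p * om N r"
  by (simp add: om_def subst_mult)

lemma om_cc [simp]: "om N (cc c) = cc c"
  by (simp add: om_def)

lemma om_xx: "j \<in> {1<..N} \<Longrightarrow> om N (xx j) = xx (j - 1)"
  and om_xx_1: "1 \<le> N \<Longrightarrow> om N (xx 1) = cc qq * xx N"
  by (simp_all add: om_def subst_xx cyc_apply cc_simps)

lemma om_Tm: "i \<in> {1..<N} \<Longrightarrow> Suc i < N \<Longrightarrow> om N (Tm (Suc i) p) = Tm i (om N p)"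
  unfolding om_def by (subst TT_subst) (simp_all add: cyc_apply)

lemma om_Ti: "i \<in> {1..<N} \<Longrightarrow> Suc i < N \<Longrightarrow> om N (Ti (Suc i) p) = Ti i (om N p)"
  unfolding om_def by (subst TI_subst) (simp_all add: cyc_apply)

text \<open>A single \<open>omega\<close> separates \<open>x_1\<close> from \<open>x_2\<close> and
  gives only one of them a factor \<open>q\<close>. After the second both have moved to the end, are
  neighbours again and carry the same factor.\<close>

lemma om_om_Ti_1:
  assumes "2 \<le> N"
  shows "om N (om N (Ti 1 p)) = Ti (N - 1) (om N (om N p))"
proof -
  let ?\<sigma> = "cyc N \<circ> cyc N" and ?e = "\<lambda>j. of_bool (j = 1) + of_bool (cyc N j = 1) :: int"
  have om2: "om N (om N r) = subst ?\<sigma> ?e r" for r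
    by (simp add: om_def subst_subst)
  have "?\<sigma> 1 = N - 1" "?\<sigma> (Suc 1) = N" "?e 1 = ?e (Suc 1)" "bij ?\<sigma>"
    using assms by (simp_all add: cyc_apply bij_comp)
  then show ?thesis
    unfolding om2 using assms TI_subst[of ?\<sigma> ?e 1 "Suc 1" p] by simp
qed

definition YY :: "nat \<Rightarrow> nat \<Rightarrow> mpol \<Rightarrow> mpol" where
  "YY N i p = cc (tt powi (int i - int N)) * word_act Tm [i..<N] (om N (word_act Ti [1..<i] p))"

lemma linop_YY: "linop (YY N i)"
proof -
  have "YY N i = (\<lambda>p. cc (tt powi (int i - int N)) * p) \<circ> (word_act Tm [i..<N] \<circ> (om N \<circ> word_act Ti [1..<i]))"
    by (simp add: fun_eq_iff YY_def)
  then show ?thesis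
    by (simp only:) (intro linop_comp linop_cc_mult linop_word_act linop_om; simp add: linop_TT linop_TI)
qed

interpretation Tm: braid_action Tm
proof
  fix i j p
  assume "1 < \<bar>int i - int j\<bar>"
  then show "Tm i (Tm j p) = Tm j (Tm i p)"
    by (intro TT_commute) auto
next
  fix i p
  show "Tm i (Tm (Suc i) (Tm i p)) = Tm (Suc i) (Tm i (Tm (Suc i) p))"
    by (rule TT_braid) auto
qed

section \<open>Relations between \<open>T_j\<close> and the Cherednik operators\<close>

lemma Tm_Ti_far: "\<bar>int i - int j\<bar> > 1 \<Longrightarrow> Tm i (Ti j p) = Ti j (Tm i p)"
  by (intro TT_TI_commute) auto

lemma word_act_fixed: "(\<And>i p. i \<in> set ws \<Longrightarrow> F i (f p) = f (F i p)) \<Longrightarrow> word_act F ws (f p) = f (word_act F ws p)"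
  by (rule word_act_commute)

lemma word_act_linop_cc:
  "(\<And>i. i \<in> set ws \<Longrightarrow> linop (F i)) \<Longrightarrow> word_act F ws (cc c * p) = cc c * word_act F ws p"
  using linop_word_act linop_cc by blast

text \<open>Apart from the letters \<open>j - 1\<close> and \<open>j\<close> the word commutes with
  what passes; at these two a single braid relation lowers the index by one.\<close>

lemma Tm_word_shift:
  assumes "i < j" "j < N"
  shows "Tm j (word_act Tm [i..<N] p) = word_act Tm [i..<N] (Tm (j - 1) p)"
proof -
  obtain k where k: "j = Suc k" using assms by (cases j) auto
  have split: "[i..<N] = [i..<k] @ [k, Suc k] @ [Suc (Suc k)..<N]"
  proof -
    have "[i..<N] = [i..<k] @ [k..<N]" "[k..<N] = k # Suc k # [Suc (Suc k)..<N]"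
      using assms k upt_add_eq_append[of i k "N - k"] by (simp_all add: upt_conv_Cons)
    then show ?thesis by simp
  qed
  have 1: "word_act Tm [i..<k] (Tm (Suc k) r) = Tm (Suc k) (word_act Tm [i..<k] r)" for r
    by (rule word_act_fixed) (auto intro!: Tm.far)
  have 2: "word_act Tm [Suc (Suc k)..<N] (Tm k r) = Tm k (word_act Tm [Suc (Suc k)..<N] r)" for r
    by (rule word_act_fixed) (auto intro!: Tm.far)
  show ?thesis
    unfolding split k by (simp add: 2 Tm.braid flip: 1 del: upt_Suc)
qed

lemma Ti_word_shift:
  assumes "1 \<le> j" "Suc j < i"
  shows "Tm (Suc j) (word_act Ti [1..<i] p) = word_act Ti [1..<i] (Tm j p)"
proof -
  have split: "[1..<i] = [1..<j] @ [j, Suc j] @ [Suc (Suc j)..<i]"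
  proof -
    have "[1..<i] = [1..<j] @ [j..<i]" "[j..<i] = j # Suc j # [Suc (Suc j)..<i]"
      using assms upt_add_eq_append[of 1 j "i - j"] by (simp_all add: upt_conv_Cons)
    then show ?thesis by simp
  qed
  have 1: "word_act Ti [1..<j] (Tm (Suc j) r) = Tm (Suc j) (word_act Ti [1..<j] r)" for r
    by (rule word_act_fixed) (auto intro!: Tm_Ti_far[symmetric])
  have 2: "word_act Ti [Suc (Suc j)..<i] (Tm j r) = Tm j (word_act Ti [Suc (Suc j)..<i] r)" for r
    by (rule word_act_fixed) (auto intro!: Tm_Ti_far[symmetric])
  have 3: "Tm (Suc j) (Ti j (Ti (Suc j) r)) = Ti j (Ti (Suc j) (Tm j r))" for r
  proof -
    \<comment> \<open>Expressing \<open>r\<close> through \<open>s\<close> reduces the mixed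
      relation to the braid relation for the \<open>T\<close> alone.\<close>
    define s where "s = Ti j (Ti (Suc j) r)"
    have "r = Tm (Suc j) (Tm j s)" by (simp add: s_def)
    then have "Ti j (Ti (Suc j) (Tm j r)) = Ti j (Ti (Suc j) (Tm (Suc j) (Tm j (Tm (Suc j) s))))"
      by (simp add: Tm.braid)
    then show ?thesis by (simp add: s_def)
  qed
  show ?thesis
    unfolding split word_act_simps comp_apply id_apply 1 2 3[symmetric] ..
qed

text \<open>The words of \<open>Y_i\<close> and \<open>Y_(i+1)\<close> differ by one letter on each
  side of \<open>omega\<close>, and the scalars differ by a factor \<open>t\<close>.\<close>

lemma Tm_YY_Tm:
  assumes "1 \<le> i" "i < N"
  shows "Tm i (YY N (Suc i) (Tm i p)) = cc tt * YY N i p"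
proof -
  have e: "tt powi (int (Suc i) - int N) = tt * tt powi (int i - int N)"
    using power_int_add[of tt 1 "int i - int N"] by (simp add: algebra_simps)
  have "[1..<Suc i] = [1..<i] @ [i]" "[i..<N] = i # [Suc i..<N]"
    using assms by (simp_all add: upt_conv_Cons)
  then show ?thesis
    unfolding YY_def e
    by (simp add: TT_cc cc_simps mult.assoc del: upt_Suc)
qed

text \<open>On its way through, \<open>T_j\<close> changes its index by one at \<open>omega\<close>
  and back again at one of the two words; the other word has only distant letters.\<close>

lemma Tm_YY_commute:
  assumes "1 \<le> j" "j < N" "1 \<le> i" "i \<le> N" "j \<noteq> i" "Suc j \<noteq> i"
  shows "Tm j (YY N i p) = YY N i (Tm j p)"
proof (cases "i < j")
  case True
  then obtain k where k: "j = Suc k" by (cases j) auto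
  have "word_act Ti [1..<i] (Tm j p) = Tm j (word_act Ti [1..<i] p)"
    using True by (intro word_act_fixed) (auto intro!: Tm_Ti_far[symmetric])
  moreover have "om N (Tm j r) = Tm k (om N r)" for r
    unfolding k by (rule om_Tm) (use True k assms in auto)
  ultimately show ?thesis
    using Tm_word_shift[OF True assms(2)] by (simp add: YY_def TT_cc k)
next
  case False
  then have j: "Suc j < i" using assms by linarith
  have 1: "word_act Tm [i..<N] (Tm j r) = Tm j (word_act Tm [i..<N] r)" for r
    using j by (intro word_act_fixed) (auto intro!: Tm.far)
  have 2: "om N (Tm (Suc j) r) = Tm j (om N r)" for r
    by (rule om_Tm) (use j assms in auto)
  show ?thesis
    unfolding YY_def by (simp only: TT_cc[OF n_not_Suc_n] 1[symmetric] 2[symmetric] Ti_word_shift[OF assms(1) j])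
qed

section \<open>The raising operator\<close>

definition Phi :: "nat \<Rightarrow> mpol \<Rightarrow> mpol" where
  "Phi N p = xx N * om N p"

lemma word_act_xx_commute:
  assumes "\<And>i. i \<in> set ws \<Longrightarrow> i \<noteq> k \<and> Suc i \<noteq> k"
  shows "word_act Tm ws (xx k * p) = xx k * word_act Tm ws p"
    and "word_act Ti ws (xx k * p) = xx k * word_act Ti ws p"
proof -
  have K: "KK i (Suc i) (xx k) = xx k" if "i \<in> set ws" for i
    using assms[OF that] by (simp add: KK_xx transpose_def)
  show "word_act Tm ws (xx k * p) = xx k * word_act Tm ws p"
    by (rule word_act_fixed) (simp add: TT_mult_sym K)
  show "word_act Ti ws (xx k * p) = xx k * word_act Ti ws p"
    by (rule word_act_fixed) (simp add: TI_mult_sym K)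
qed

text \<open>Each letter moves the variable one place down and itself turns from \<open>T^-1\<close>
  into \<open>t^-1 T\<close>.\<close>

lemma word_act_Ti_xx:
  assumes "1 \<le> k"
  shows "word_act Ti [1..<k] (xx k * p) = cc (tt powi (1 - int k)) * (xx 1 * word_act Tm [1..<k] p)"
  using assms
proof (induction k arbitrary: p rule: dec_induct)
  case (step k)
  have e: "tt powi (1 - int (Suc k)) = inverse tt * tt powi (1 - int k)"
    using power_int_add[of tt "-1" "1 - int k"] by (simp add: algebra_simps)
  have k: "[1..<Suc k] = [1..<k] @ [k]" using step(1) by simp
  have "word_act Ti [1..<Suc k] (xx (Suc k) * p) = word_act Ti [1..<k] (cc (inverse tt) * (xx k * Tm k p))"
    unfolding k word_act_simps comp_apply id_apply by (simp only: TI_mult_xx[OF n_not_Suc_n])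
  also have "\<dots> = cc (inverse tt) * word_act Ti [1..<k] (xx k * Tm k p)"
    by (rule word_act_linop_cc) (simp add: linop_TI)
  also have "\<dots> = cc (tt powi (1 - int (Suc k))) * (xx 1 * word_act Tm [1..<Suc k] p)"
    unfolding step.IH k word_act_simps comp_apply id_apply e cc_simps by (simp only: mult.assoc)
  finally show ?case .
qed (simp add: cc_simps)

lemma om_word_act_shift:
  assumes "1 \<le> i" "k \<le> N"
  shows "word_act Ti [i..<k - 1] (om N p) = om N (word_act Ti [Suc i..<k] p)"
    and "word_act Tm [i..<k - 1] (om N p) = om N (word_act Tm [Suc i..<k] p)"
proof -
  have map: "[Suc i..<k] = map Suc [i..<k - 1]"
    by (cases k) (simp_all add: map_Suc_upt)
  have shift: "word_act F [i..<k - 1] (om N p) = om N (word_act F [Suc i..<k] p)"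
    if "\<And>j r. j \<in> {i..<k - 1} \<Longrightarrow> om N (F (Suc j) r) = F j (om N r)" for F
  proof -
    have "word_act F [i..<k - 1] (om N p) = om N (word_act (\<lambda>j. F (Suc j)) [i..<k - 1] p)"
      by (rule word_act_commute) (simp add: that)
    then show ?thesis
      unfolding map by (simp add: word_act_def comp_def)
  qed
  show "word_act Ti [i..<k - 1] (om N p) = om N (word_act Ti [Suc i..<k] p)"
    by (rule shift, rule om_Ti) (use assms in auto)
  show "word_act Tm [i..<k - 1] (om N p) = om N (word_act Tm [Suc i..<k] p)"
    by (rule shift, rule om_Tm) (use assms in auto)
qed

text \<open>The inner \<open>omega\<close> of \<open>Y_i\<close> lowers \<open>x_N\<close> to
  \<open>x_(N-1)\<close>, and the last letter \<open>T_(N-1)\<close> must raise it again. For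
  \<open>T x T = t x\<close> a second \<open>T_(N-1)\<close> is required; it comes from inserting
  \<open>T_1^-1\<close>, which the square of \<open>omega\<close> carries to the position
  \<open>N - 1\<close>.\<close>

lemma YY_Phi:
  assumes "1 \<le> i" "i < N"
  shows "YY N i (Phi N p) = Phi N (YY N (Suc i) p)"
proof -
  define r where "r = word_act Ti [2..<Suc i] p"
  have N2: "2 \<le> N" using assms by simp
  have "word_act Ti [1..<i] (Phi N p) = xx N * om N r"
    unfolding Phi_def r_def using assms om_word_act_shift(1)[of 1 "Suc i" N p]
    by (subst word_act_xx_commute) (auto simp: numeral_2_eq_2 simp del: upt_Suc)
  then have 1: "om N (word_act Ti [1..<i] (Phi N p)) = xx (N - 1) * om N (om N r)"
    using om_xx[of N N] N2 by (simp add: om_mult)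
  have "om N (om N r) = Tm (N - 1) (om N (om N (Ti 1 r)))"
    using om_om_Ti_1[OF N2, of r] N2 by simp
  also have "Ti 1 r = word_act Ti [1..<Suc i] p"
    using assms by (simp add: r_def upt_conv_Cons numeral_2_eq_2 del: upt_Suc)
  finally have 2: "om N (om N r) = Tm (N - 1) (om N (om N (word_act Ti [1..<Suc i] p)))" .
  have "[i..<N] = [i..<N - 1] @ [N - 1]"
    using assms by (cases N) simp_all
  then have "word_act Tm [i..<N] (xx (N - 1) * om N (om N r)) =
      word_act Tm [i..<N - 1] (cc tt * (xx N * om N (om N (word_act Ti [1..<Suc i] p))))"
    unfolding 2 using TT_xx_TT[of "N - 1" N] N2 by (simp add: mult.assoc del: upt_Suc)
  also have "\<dots> = cc tt * (xx N * word_act Tm [i..<N - 1] (om N (om N (word_act Ti [1..<Suc i] p))))"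
    by (subst word_act_linop_cc, simp add: linop_TT, subst word_act_xx_commute) auto
  also have "\<dots> = cc tt * (xx N * om N (word_act Tm [Suc i..<N] (om N (word_act Ti [1..<Suc i] p))))"
    using om_word_act_shift(2)[of i N N] assms by (simp del: upt_Suc)
  finally have "YY N i (Phi N p) = cc (tt powi (int i - int N)) * (cc tt *
      (xx N * om N (word_act Tm [Suc i..<N] (om N (word_act Ti [1..<Suc i] p)))))"
    unfolding YY_def 1 by (simp del: upt_Suc)
  moreover have "tt powi (int (Suc i) - int N) = tt powi (int i - int N) * tt"
    using power_int_add[of tt "int i - int N" 1] by (simp add: algebra_simps)
  ultimately show ?thesis
    unfolding YY_def Phi_def by (simp add: om_mult cc_simps mult_ac del: upt_Suc)
qed

lemma YY_Phi_last:
  assumes "1 \<le> N"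
  shows "YY N N (Phi N p) = cc qq * Phi N (YY N 1 p)"
proof -
  have "YY N N (Phi N p) = om N (word_act Ti [1..<N] (xx N * om N p))"
    by (simp add: YY_def Phi_def cc_simps)
  also have "\<dots> = cc (tt powi (1 - int N)) * (cc qq * xx N * om N (word_act Tm [1..<N] (om N p)))"
    unfolding word_act_Ti_xx[OF assms] by (simp only: om_mult om_xx_1[OF assms] om_cc)
  finally show ?thesis
    by (simp add: YY_def Phi_def om_mult mult_ac)
qed

section \<open>Triangularity\<close>

lemma mpol_as_sum: "p = (\<Sum>\<nu>\<in>keys p. cc (lookup p \<nu>) * single \<nu> 1)" for p :: mpol
proof (intro poly_mapping_eqI)
  fix \<mu>
  have "lookup (\<Sum>\<nu>\<in>keys p. cc (lookup p \<nu>) * single \<nu> 1) \<mu> = (\<Sum>\<nu>\<in>keys p. if \<nu> = \<mu> then lookup p \<mu> else 0)"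
    unfolding lookup_sum by (intro sum.cong) (auto simp: lookup_single when_def)
  then show "lookup p \<mu> = lookup (\<Sum>\<nu>\<in>keys p. cc (lookup p \<nu>) * single \<nu> 1) \<mu>"
    by (simp add: in_keys_iff)
qed

definition triangular :: "nat \<Rightarrow> (mpol \<Rightarrow> mpol) \<Rightarrow> (mono \<Rightarrow> coef) \<Rightarrow> bool" where
  "triangular N F d \<longleftrightarrow> linop F \<and> (\<forall>\<nu>\<in>compositions N.
     keys (F (single \<nu> 1) - cc (d \<nu>) * single \<nu> 1) \<subseteq> {\<kappa> \<in> compositions N. comp_less N \<kappa> \<nu>})"

lemma triD:
  assumes "triangular N F d" "\<nu> \<in> compositions N"
  obtains r where "F (single \<nu> 1) = cc (d \<nu>) * single \<nu> 1 + r"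
    "keys r \<subseteq> {\<kappa> \<in> compositions N. comp_less N \<kappa> \<nu>}"
  using assms that[of "F (single \<nu> 1) - cc (d \<nu>) * single \<nu> 1"] by (simp add: triangular_def)

lemma triangular_keys:
  assumes "triangular N F d" "keys p \<subseteq> compositions N"
  shows "keys (F p) \<subseteq> {\<kappa> \<in> compositions N. \<exists>\<nu>\<in>keys p. \<kappa> = \<nu> \<or> comp_less N \<kappa> \<nu>}"
proof -
  have lin: "linop F" using assms by (simp add: triangular_def)
  have eq: "F p = (\<Sum>\<nu>\<in>keys p. cc (lookup p \<nu>) * F (single \<nu> 1))"
    by (subst mpol_as_sum) (simp add: linop_sum[OF lin] linop_cc[OF lin])
  have sub: "keys (cc (lookup p \<nu>) * F (single \<nu> 1)) \<subseteq>
      {\<kappa> \<in> compositions N. \<exists>\<nu>\<in>keys p. \<kappa> = \<nu> \<or> comp_less N \<kappa> \<nu>}" if \<nu>: "\<nu> \<in> keys p" for \<nu>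
  proof -
    obtain r where r: "F (single \<nu> 1) = cc (d \<nu>) * single \<nu> 1 + r"
      "keys r \<subseteq> {\<kappa> \<in> compositions N. comp_less N \<kappa> \<nu>}"
      using triD[OF assms(1)] assms(2) \<nu> by blast
    have "keys (F (single \<nu> 1)) \<subseteq> {\<nu>} \<union> keys r"
      unfolding r(1) using keys_add[of "cc (d \<nu>) * single \<nu> 1" r] keys_cc_mult[of "d \<nu>" "single \<nu> 1"] by auto
    then show ?thesis
      using keys_cc_mult[of "lookup p \<nu>" "F (single \<nu> 1)"] r(2) \<nu> assms(2) by blast
  qed
  show ?thesis
    unfolding eq by (rule keys_sum_subset) (rule sub)
qed

lemma triangular_comp:
  assumes F: "triangular N F d" and G: "triangular N G e"
  shows "triangular N (F \<circ> G) (\<lambda>\<nu>. d \<nu> * e \<nu>)"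
  unfolding triangular_def
proof (intro conjI ballI)
  have lin: "linop F" "linop G" using assms by (simp_all add: triangular_def)
  then show "linop (F \<circ> G)" by (rule linop_comp)
  fix \<nu> assume \<nu>: "\<nu> \<in> compositions N"
  obtain r where r: "G (single \<nu> 1) = cc (e \<nu>) * single \<nu> 1 + r"
    "keys r \<subseteq> {\<kappa> \<in> compositions N. comp_less N \<kappa> \<nu>}"
    using triD[OF G \<nu>] .
  obtain s where s: "F (single \<nu> 1) = cc (d \<nu>) * single \<nu> 1 + s"
    "keys s \<subseteq> {\<kappa> \<in> compositions N. comp_less N \<kappa> \<nu>}"
    using triD[OF F \<nu>] .
  have "(F \<circ> G) (single \<nu> 1) - cc (d \<nu> * e \<nu>) * single \<nu> 1 = cc (e \<nu>) * s + F r"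
  proof -
    have "(F \<circ> G) (single \<nu> 1) = cc (e \<nu>) * (cc (d \<nu>) * single \<nu> 1 + s) + F r"
      by (simp only: comp_apply r(1) linop_add[OF lin(1)] linop_cc[OF lin(1)] s(1))
    then show ?thesis by (simp add: cc_simps algebra_simps)
  qed
  moreover have "keys (F r) \<subseteq> {\<kappa> \<in> compositions N. comp_less N \<kappa> \<nu>}"
    using triangular_keys[OF F, of r] r(2) comp_less_trans by blast
  ultimately show "keys ((F \<circ> G) (single \<nu> 1) - cc (d \<nu> * e \<nu>) * single \<nu> 1)
      \<subseteq> {\<kappa> \<in> compositions N. comp_less N \<kappa> \<nu>}"
    using keys_add[of "cc (e \<nu>) * s" "F r"] keys_cc_mult[of "e \<nu>" s] s(2) by (simp only:) blast
qed

lemma triangular_id: "triangular N id (\<lambda>_. 1)"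
  by (simp add: triangular_def linop_id cc_simps)

lemma triangular_cc_mult: "triangular N (\<lambda>p. cc c * p) (\<lambda>_. c)"
  by (simp add: triangular_def linop_cc_mult)

lemma triangular_word_act:
  "(\<And>j. j \<in> set js \<Longrightarrow> triangular N (F j) (d j)) \<Longrightarrow> triangular N (word_act F js) (\<lambda>\<nu>. \<Prod>j\<leftarrow>js. d j \<nu>)"
  by (induction js) (auto simp: triangular_id intro: triangular_comp)

lemma inner_comp_less:
  assumes "\<nu> \<in> compositions N" "a \<noteq> b" "a \<in> {1..N}" "b \<in> {1..N}" "\<kappa> \<in> inner a b \<nu>"
  shows "\<kappa> \<in> compositions N \<and> comp_less N \<kappa> \<nu>"
  using assms inner_compositions inner_dominance_less by (auto simp: comp_less_def)

lemma lower_subset: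
  assumes "\<nu> \<in> compositions N" "a < b" "a \<in> {1..N}" "b \<in> {1..N}"
  shows "inner a b \<nu> \<union> (if lookup \<nu> b < lookup \<nu> a then {swap_mono a b \<nu>} else {})
    \<subseteq> {\<kappa> \<in> compositions N. comp_less N \<kappa> \<nu>}"
  using inner_comp_less[of \<nu> N a b] swap_comp_less[of a N b \<nu>] swap_mono_compositions[of \<nu> N a b] assms
  by auto

lemma triangular_KK_TI:
  assumes "a < b" "a \<in> {1..N}" "b \<in> {1..N}"
  shows "triangular N (\<lambda>p. KK a b (TI a b p)) (\<lambda>\<nu>. if lookup \<nu> b \<le> lookup \<nu> a then inverse tt else 1)"
  unfolding triangular_def
proof (intro conjI ballI)
  show "linop (\<lambda>p. KK a b (TI a b p))"
    using linop_comp[OF linop_KK linop_TI, of a b a b] assms by (simp add: comp_def)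
  fix \<nu> assume "\<nu> \<in> compositions N"
  then show "keys (KK a b (TI a b (single \<nu> 1)) - cc (if lookup \<nu> b \<le> lookup \<nu> a then inverse tt else 1) * single \<nu> 1)
    \<subseteq> {\<kappa> \<in> compositions N. comp_less N \<kappa> \<nu>}"
    using assms by (intro order.trans[OF keys_KK_TI_single lower_subset]) simp_all
qed

lemma triangular_TT_KK:
  assumes "a < b" "a \<in> {1..N}" "b \<in> {1..N}"
  shows "triangular N (\<lambda>p. TT a b (KK a b p)) (\<lambda>\<nu>. if lookup \<nu> b \<le> lookup \<nu> a then tt else 1)"
  unfolding triangular_def
proof (intro conjI ballI)
  show "linop (\<lambda>p. TT a b (KK a b p))"
    using linop_comp[OF linop_TT linop_KK, of a b a b] assms by (simp add: comp_def)
  fix \<nu> assume "\<nu> \<in> compositions N"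
  then show "keys (TT a b (KK a b (single \<nu> 1)) - cc (if lookup \<nu> b \<le> lookup \<nu> a then tt else 1) * single \<nu> 1)
    \<subseteq> {\<kappa> \<in> compositions N. comp_less N \<kappa> \<nu>}"
    using assms by (intro order.trans[OF keys_TT_KK_single lower_subset]) simp_all
qed

section \<open>Cherednik operators as products of triangular factors\<close>

abbreviation tau :: "nat \<Rightarrow> mpol \<Rightarrow> mpol" where
  "tau i \<equiv> subst id (\<lambda>j. of_bool (j = i))"

lemma wt_of_bool: "wt (\<lambda>j. of_bool (j = i)) \<mu> = int (lookup \<mu> i)"
  by (simp add: wt_eq_sum[of "insert i (keys \<mu>)"] of_bool_def if_distrib[of "\<lambda>x. x * _"]
      subset_insertI sum.delta cong: if_cong)

lemma triangular_tau: "triangular N (tau i) (\<lambda>\<nu>. qq ^ lookup \<nu> i)"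
  unfolding triangular_def
proof (intro conjI ballI)
  fix \<nu>
  have "tau i (single \<nu> 1) = cc (qq ^ lookup \<nu> i) * single \<nu> 1"
    by (simp add: subst_single wt_of_bool) (simp add: cc_def mult_single)
  then show "keys (tau i (single \<nu> 1) - cc (qq ^ lookup \<nu> i) * single \<nu> 1)
      \<subseteq> {\<kappa> \<in> compositions N. comp_less N \<kappa> \<nu>}" by simp
qed (simp add: linop_subst)

text \<open>Distributing the transpositions of the cycle among the letters turns \<open>T_k\<close>
  into \<open>T K\<close> for the pair \<open>(i, k+1)\<close>. All pairs now share the position
  \<open>i\<close>, and the factors are triangular although the \<open>T_k\<close> are not.\<close>

lemma word_act_Tm_rotation:
  assumes "i \<le> k"
  shows "word_act Tm [i..<k] (subst (word_perm (rev [i..<k])) (\<lambda>_. 0) p) =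
    word_act (\<lambda>j p. TT i j (KK i j p)) [Suc i..<Suc k] p"
  using assms
proof (induction k arbitrary: p rule: dec_induct)
  case base
  then show ?case by (simp add: id_def[symmetric])
next
  case (step k)
  let ?c = "word_perm (rev [i..<k])"
  have c: "?c i = k" "?c (Suc k) = Suc k"
    using step(1) by (simp_all add: word_perm_rev_upt)
  have k: "[i..<Suc k] = [i..<k] @ [k]" "[Suc i..<Suc (Suc k)] = [Suc i..<Suc k] @ [Suc k]"
    "rev [i..<Suc k] = k # rev [i..<k]"
    using step(1) by simp_all
  have "subst (word_perm (rev [i..<Suc k])) (\<lambda>_. 0) p = KK k (Suc k) (subst ?c (\<lambda>_. 0) p)"
    unfolding k(3) word_perm_simps KK_def by (simp add: subst_subst)
  also have "\<dots> = subst ?c (\<lambda>_. 0) (KK i (Suc k) p)"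
    using subst_KK[of ?c "\<lambda>_. 0" i "Suc k" p] c by simp
  finally have "Tm k (subst (word_perm (rev [i..<Suc k])) (\<lambda>_. 0) p) = subst ?c (\<lambda>_. 0) (TT i (Suc k) (KK i (Suc k) p))"
    using TT_subst[of ?c "\<lambda>_. 0" i "Suc k"] c step(1) by simp
  then have "word_act Tm [i..<Suc k] (subst (word_perm (rev [i..<Suc k])) (\<lambda>_. 0) p) =
      word_act Tm [i..<k] (subst ?c (\<lambda>_. 0) (TT i (Suc k) (KK i (Suc k) p)))"
    unfolding k(1) word_act_simps comp_apply id_apply by (rule arg_cong)
  also have "\<dots> = word_act (\<lambda>j p. TT i j (KK i j p)) [Suc i..<Suc (Suc k)] p"
    unfolding k(2) word_act_simps comp_apply id_apply by (rule step.IH)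
  finally show ?case .
qed

lemma rotation_word_act_Ti:
  assumes "k \<le> i"
  shows "subst (word_perm (rev [k..<i])) (\<lambda>_. 0) (word_act Ti [k..<i] p) =
    word_act (\<lambda>j p. KK j i (TI j i p)) [k..<i] p"
  using assms
proof (induction k rule: inc_induct)
  case base
  then show ?case by (simp add: id_def[symmetric])
next
  case (step k)
  let ?c = "word_perm (rev [Suc k..<i])"
  have c: "?c k = k" "?c (Suc k) = i"
    using step(1,2) by (simp_all add: word_perm_rev_upt)
  have k: "[k..<i] = k # [Suc k..<i]" "rev [k..<i] = rev [Suc k..<i] @ [k]"
    using step(2) by (simp_all add: upt_conv_Cons)
  have "subst (word_perm (rev [k..<i])) (\<lambda>_. 0) r = subst ?c (\<lambda>_. 0) (KK k (Suc k) r)" for r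
    unfolding k(2) word_perm_snoc KK_def by (simp add: subst_subst)
  then have "subst (word_perm (rev [k..<i])) (\<lambda>_. 0) (Ti k r) = KK k i (TI k i (subst ?c (\<lambda>_. 0) r))" for r
    using subst_KK[of ?c "\<lambda>_. 0" k "Suc k"] TI_subst[of ?c "\<lambda>_. 0" k "Suc k"] by (simp only: c) simp
  then show ?case
    unfolding k(1) word_act_simps comp_apply step.IH[symmetric] by (simp only: k(1))
qed

text \<open>The cycle is cut at \<open>i\<close>. Its first piece brings position \<open>1\<close>
  to \<open>i\<close>, so between the pieces the shift of \<open>x_1\<close> appears as a shift of
  \<open>x_i\<close>.\<close>

lemma om_rotation:
  assumes "1 \<le> i" "i \<le> N"
  shows "om N p = subst (word_perm (rev [i..<N])) (\<lambda>_. 0) (tau i (subst (word_perm (rev [1..<i])) (\<lambda>_. 0) p))"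
proof -
  let ?c = "word_perm (rev [i..<N])" and ?d = "word_perm (rev [1..<i])"
  have "rev [1..<N] = rev [i..<N] @ rev [1..<i]"
    using assms upt_add_eq_append[of 1 i "N - i"] by simp
  then have cyc: "cyc N = ?c \<circ> ?d"
    by (simp add: cyc_def)
  have d: "?d j = i \<longleftrightarrow> j = 1" for j
    using assms by (auto simp: word_perm_rev_upt)
  show ?thesis
    by (simp add: om_def cyc subst_subst bij_comp d[unfolded One_nat_def])
qed

lemma YY_eq_triangular:
  assumes "1 \<le> i" "i \<le> N"
  shows "YY N i = (\<lambda>p. cc (tt powi (int i - int N)) * p) \<circ>
    (word_act (\<lambda>j p. TT i j (KK i j p)) [Suc i..<Suc N] \<circ> (tau i \<circ> word_act (\<lambda>j p. KK j i (TI j i p)) [1..<i]))"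
  using assms
  by (simp add: fun_eq_iff YY_def om_rotation[OF assms] word_act_Tm_rotation rotation_word_act_Ti del: upt_Suc)

definition eig :: "nat \<Rightarrow> mono \<Rightarrow> nat \<Rightarrow> coef" where
  "eig N \<eta> i = qq ^ lookup \<eta> i * tt powi (1 - int (comp_rank N \<eta> i))"

lemma prod_list_if: "(\<Prod>j\<leftarrow>js. if P j then c else 1) = c ^ length (filter P js)" for c :: coef
  by (induction js) simp_all

lemma comp_rank_split:
  assumes "i \<in> {1..N}"
  shows "comp_rank N \<eta> i = Suc (card {j \<in> {1..<i}. lookup \<eta> i \<le> lookup \<eta> j} + card {j \<in> {i<..N}. lookup \<eta> i < lookup \<eta> j})"
proof -
  have "{j \<in> {1..N}. beats \<eta> j i} = insert i
      ({j \<in> {1..<i}. lookup \<eta> i \<le> lookup \<eta> j} \<union> {j \<in> {i<..N}. lookup \<eta> i < lookup \<eta> j})"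
    using assms by (auto simp: beats_def)
  moreover have "card ({j \<in> {1..<i}. lookup \<eta> i \<le> lookup \<eta> j} \<union> {j \<in> {i<..N}. lookup \<eta> i < lookup \<eta> j})
      = card {j \<in> {1..<i}. lookup \<eta> i \<le> lookup \<eta> j} + card {j \<in> {i<..N}. lookup \<eta> i < lookup \<eta> j}"
    by (intro card_Un_disjoint) auto
  ultimately show ?thesis
    using assms by (simp add: comp_rank_eq_card)
qed

lemma triangular_YY:
  assumes "i \<in> {1..N}"
  shows "triangular N (YY N i) (\<lambda>\<nu>. eig N \<nu> i)"
proof -
  let ?d = "\<lambda>\<nu>. tt powi (int i - int N) *
    ((\<Prod>j\<leftarrow>[Suc i..<Suc N]. if lookup \<nu> j \<le> lookup \<nu> i then tt else 1) *
     (qq ^ lookup \<nu> i * (\<Prod>j\<leftarrow>[1..<i]. if lookup \<nu> i \<le> lookup \<nu> j then inverse tt else 1)))"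
  have i: "1 \<le> i" "i \<le> N" using assms by auto
  have "triangular N (YY N i) ?d"
    unfolding YY_eq_triangular[OF i]
    by (intro triangular_comp triangular_cc_mult triangular_word_act triangular_tau triangular_TT_KK triangular_KK_TI) (use i in auto)
  moreover have "?d \<nu> = eig N \<nu> i" for \<nu>
  proof -
    \<comment> \<open>The factors contribute \<open>t^A\<close> and \<open>t^(-B)\<close>. As
      \<open>A + C = N - i\<close>, the prefactor \<open>t^(i-N)\<close> reduces the exponent to
      \<open>-C - B\<close>, and \<open>B + C + 1\<close> is the rank.\<close>
    define A B C where "A = card {j \<in> {i<..N}. lookup \<nu> j \<le> lookup \<nu> i}"
      and "B = card {j \<in> {1..<i}. lookup \<nu> i \<le> lookup \<nu> j}"
      and "C = card {j \<in> {i<..N}. lookup \<nu> i < lookup \<nu> j}"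
    have "card {i<..N} = card ({j \<in> {i<..N}. lookup \<nu> j \<le> lookup \<nu> i} \<union> {j \<in> {i<..N}. lookup \<nu> i < lookup \<nu> j})"
      by (rule arg_cong[where f = card]) auto
    also have "\<dots> = A + C"
      unfolding A_def C_def by (rule card_Un_disjoint) auto
    finally have "card {i<..N} = A + C" .
    then have AC: "int A = int N - int i - int C"
      using i by simp
    have "length (filter (\<lambda>j. lookup \<nu> j \<le> lookup \<nu> i) [Suc i..<Suc N]) = A"
      unfolding A_def by (subst distinct_card[symmetric]) (auto simp: atLeastLessThanSuc_atLeastAtMost simp del: upt_Suc intro!: arg_cong[where f = card])
    moreover have "length (filter (\<lambda>j. lookup \<nu> i \<le> lookup \<nu> j) [1..<i]) = B"
      unfolding B_def by (subst distinct_card[symmetric]) (auto intro!: arg_cong[where f = card])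
    ultimately have "?d \<nu> = qq ^ lookup \<nu> i * (tt powi (int i - int N) * tt powi (int A) * tt powi (- int B))"
      by (simp add: prod_list_if power_int_minus power_inverse del: upt_Suc)
    also have "\<dots> = qq ^ lookup \<nu> i * tt powi (- int C - int B)"
      by (simp add: AC flip: power_int_add)
    finally show ?thesis
      using comp_rank_split[OF assms, of \<nu>] by (simp add: eig_def B_def C_def algebra_simps)
  qed
  then have "?d = (\<lambda>\<nu>. eig N \<nu> i)" by (rule ext)
  ultimately show ?thesis by (rule subst[where P = "triangular N (YY N i)", rotated])
qed

text \<open>The exponents of \<open>q\<close> alone recover the entries of the composition.\<close>

lemma eig_inject:
  assumes "\<nu> \<in> compositions N" "\<eta> \<in> compositions N" "\<And>i. i \<in> {1..N} \<Longrightarrow> eig N \<nu> i = eig N \<eta> i"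
  shows "\<nu> = \<eta>"
proof (rule poly_mapping_eqI)
  fix i
  show "lookup \<nu> i = lookup \<eta> i"
    using assms(1,2) qq_tt_powi_eqD[OF assms(3)[of i, unfolded eig_def]]
    by (cases "i \<in> {1..N}") (auto simp: in_compositions_iff)
qed

section \<open>Joint eigenvectors\<close>

definition joint_eigen :: "nat \<Rightarrow> mono \<Rightarrow> mpol \<Rightarrow> bool" where
  "joint_eigen N \<eta> p \<longleftrightarrow> keys p \<subseteq> compositions N \<and> (\<forall>i\<in>{1..N}. YY N i p = cc (eig N \<eta> i) * p)"

lemma joint_eigen_cc: "joint_eigen N \<eta> p \<Longrightarrow> joint_eigen N \<eta> (cc c * p)"
  using keys_cc_mult[of c p] by (auto simp: joint_eigen_def linop_cc[OF linop_YY] mult.left_commute)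

lemma joint_eigen_diff: "joint_eigen N \<eta> p \<Longrightarrow> joint_eigen N \<eta> r \<Longrightarrow> joint_eigen N \<eta> (p - r)"
  using keys_diff_subset[of p r] by (auto simp: joint_eigen_def linop_diff[OF linop_YY] right_diff_distrib)

lemma exists_maximal:
  assumes "finite A" "\<nu> \<in> A"
  shows "\<exists>\<kappa>\<in>A. (\<nu> = \<kappa> \<or> comp_less N \<nu> \<kappa>) \<and> (\<forall>\<mu>\<in>A. \<not> comp_less N \<kappa> \<mu>)"
  using assms(2)
proof (induction "card {\<mu> \<in> A. comp_less N \<nu> \<mu>}" arbitrary: \<nu> rule: less_induct)
  case less
  show ?case
  proof (cases "\<exists>\<mu>\<in>A. comp_less N \<nu> \<mu>")
    case True
    then obtain \<mu> where \<mu>: "\<mu> \<in> A" "comp_less N \<nu> \<mu>" by blast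
    have "{\<kappa> \<in> A. comp_less N \<mu> \<kappa>} \<subset> {\<kappa> \<in> A. comp_less N \<nu> \<kappa>}"
      using \<mu> comp_less_trans[of N \<nu> \<mu>] comp_less_irrefl[of N \<mu>] by blast
    then have "card {\<kappa> \<in> A. comp_less N \<mu> \<kappa>} < card {\<kappa> \<in> A. comp_less N \<nu> \<kappa>}"
      using assms(1) by (intro psubset_card_mono) auto
    from less.hyps[OF this \<mu>(1)] show ?thesis
      using \<mu>(2) comp_less_trans by blast
  qed (use less.prems in blast)
qed

text \<open>At a maximal monomial of \<open>p\<close> only the diagonal term of \<open>Y_i\<close>
  contributes, so its own eigenvalue must be the one attached to \<open>\<eta>\<close>, for every
  \<open>i\<close>.\<close>

lemma joint_eigen_maximal:
  assumes "joint_eigen N \<eta> p" "\<eta> \<in> compositions N" "\<kappa> \<in> keys p" "\<forall>\<mu>\<in>keys p. \<not> comp_less N \<kappa> \<mu>"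
  shows "\<kappa> = \<eta>"
proof (rule eig_inject)
  have sub: "keys p \<subseteq> compositions N" using assms(1) by (simp add: joint_eigen_def)
  then show "\<kappa> \<in> compositions N" using assms(3) by blast
  fix i assume i: "i \<in> {1..N}"
  have lin: "linop (YY N i)" by (rule linop_YY)
  have coef: "lookup (YY N i (single \<nu> 1)) \<kappa> = (if \<nu> = \<kappa> then eig N \<kappa> i else 0)" if \<nu>: "\<nu> \<in> keys p" for \<nu>
  proof -
    obtain r where r: "YY N i (single \<nu> 1) = cc (eig N \<nu> i) * single \<nu> 1 + r"
      "keys r \<subseteq> {\<kappa> \<in> compositions N. comp_less N \<kappa> \<nu>}"
      using triD[OF triangular_YY[OF i]] \<nu> sub by blast
    have "\<kappa> \<notin> keys r" using r(2) assms(4) \<nu> by blast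
    then show ?thesis
      by (simp add: r(1) lookup_add lookup_single when_def in_keys_iff)
  qed
  have "YY N i p = (\<Sum>\<nu>\<in>keys p. cc (lookup p \<nu>) * YY N i (single \<nu> 1))"
    by (subst mpol_as_sum) (simp add: linop_sum[OF lin] linop_cc[OF lin])
  then have "lookup (YY N i p) \<kappa> = (\<Sum>\<nu>\<in>keys p. if \<nu> = \<kappa> then lookup p \<kappa> * eig N \<kappa> i else 0)"
    by (simp add: lookup_sum coef if_distrib cong: sum.cong if_cong)
  also have "\<dots> = lookup p \<kappa> * eig N \<kappa> i"
    using assms(3) by simp
  finally show "eig N \<kappa> i = eig N \<eta> i"
    using assms(1,3) i by (simp add: joint_eigen_def in_keys_iff)
qed (use assms in simp)

text \<open>Every monomial lies at or below a maximal one, and the only possible maximal one is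
  \<open>\<eta>\<close>.\<close>

lemma joint_eigen_support:
  assumes "joint_eigen N \<eta> p" "\<eta> \<in> compositions N" "\<nu> \<in> keys p"
  shows "\<nu> = \<eta> \<or> comp_less N \<nu> \<eta>"
  using exists_maximal[OF finite_keys assms(3), of N] joint_eigen_maximal[OF assms(1,2)] by blast

lemma joint_eigen_lookup_nonzero:
  assumes "joint_eigen N \<eta> p" "\<eta> \<in> compositions N" "p \<noteq> 0"
  shows "lookup p \<eta> \<noteq> 0"
proof -
  obtain \<nu> where "\<nu> \<in> keys p" using assms(3) by (metis all_not_in_conv keys_eq_empty)
  then show ?thesis
    using exists_maximal[OF finite_keys, of \<nu> p N] joint_eigen_maximal[OF assms(1,2)] by (auto simp: in_keys_iff)
qed

text \<open>The difference of the two sides is a joint eigenvector whose coefficient at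
  \<open>\<eta>\<close> vanishes, hence zero.\<close>

lemma joint_eigen_multiple:
  assumes "joint_eigen N \<eta> p" "joint_eigen N \<eta> r" "\<eta> \<in> compositions N" "lookup r \<eta> = 1"
  shows "p = cc (lookup p \<eta>) * r"
proof (rule ccontr)
  assume "p \<noteq> cc (lookup p \<eta>) * r"
  then have "lookup (p - cc (lookup p \<eta>) * r) \<eta> \<noteq> 0"
    using assms by (intro joint_eigen_lookup_nonzero joint_eigen_diff joint_eigen_cc) auto
  then show False
    using assms(4) by (simp add: lookup_minus)
qed

section \<open>The inverse of the longest element\<close>

lemma word_act_Ti_rev [simp]:
  "word_act Ti (rev ws) (word_act Tm ws p) = p" "word_act Tm ws (word_act Ti (rev ws) p) = p"
  by (induction ws arbitrary: p) simp_all

lemma word_act_Tm_rev [simp]: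
  "word_act Ti ws (word_act Tm (rev ws) p) = p" "word_act Tm (rev ws) (word_act Ti ws p) = p"
  using word_act_Ti_rev[of "rev ws" p] by simp_all

definition TI_revp :: "nat \<Rightarrow> nat \<Rightarrow> mpol \<Rightarrow> mpol" where
  "TI_revp a b = word_act Ti (rev (some_reduced_word (revp a b)))"

abbreviation TT_revp :: "nat \<Rightarrow> nat \<Rightarrow> mpol \<Rightarrow> mpol" where
  "TT_revp a b \<equiv> Tm.perm_act (revp a b)"

lemma TI_revp_TT_revp [simp]: "TI_revp a b (TT_revp a b p) = p" "TT_revp a b (TI_revp a b p) = p"
  by (simp_all add: TI_revp_def Tm.perm_act_def)

lemma TI_revp_eqI: "TT_revp a b r = p \<Longrightarrow> TI_revp a b p = r"
  using TI_revp_TT_revp(1) by metis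

lemma linop_TI_revp: "linop (TI_revp a b)"
  unfolding TI_revp_def by (rule linop_word_act) (simp add: linop_TI)

lemma TI_revp_trivial:
  assumes "b \<le> a"
  shows "TI_revp a b p = p"
proof (rule TI_revp_eqI)
  have "revp a b = id" using assms by (auto simp: revp_def fun_eq_iff)
  then show "TT_revp a b p = p" by simp
qed

lemma TI_revp_last:
  assumes "a \<le> Suc b"
  shows "TI_revp a (Suc b) p = TI_revp a b (word_act Ti (rev [a..<Suc b]) p)"
  by (rule TI_revp_eqI) (simp only: Tm.perm_act_revp_last[OF assms] comp_apply TI_revp_TT_revp word_act_Ti_rev)

lemma TI_revp_first:
  assumes "a \<le> Suc b"
  shows "TI_revp a (Suc b) (word_act Tm (rev [a..<Suc b]) p) = TI_revp (Suc a) (Suc b) p"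
  by (rule TI_revp_eqI) (simp only: Tm.perm_act_revp_first[OF assms] comp_apply TI_revp_TT_revp)

lemma Ti_TI_revp:
  assumes "i \<in> {a..<b}"
  shows "Ti i (TI_revp a b p) = TI_revp a b (Ti (a + b - Suc i) p)"
proof (rule TI_revp_eqI[symmetric])
  define k where "k = a + b - Suc i"
  have k: "k \<in> {a..<b}" "a + b - Suc k = i"
    using assms by (auto simp: k_def)
  have "TT_revp a b (Ti i (TI_revp a b p)) = Ti k (Tm k (TT_revp a b (Ti i (TI_revp a b p))))"
    by simp
  also have "Tm k (TT_revp a b (Ti i (TI_revp a b p))) = TT_revp a b (Tm i (Ti i (TI_revp a b p)))"
    using Tm.T_perm_act_revp[OF k(1)] unfolding k(2) .
  finally show "TT_revp a b (Ti i (TI_revp a b p)) = Ti (a + b - Suc i) p"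
    by (simp add: k_def)
qed

lemma TI_revp_commute:
  assumes "a \<le> Suc b" "\<And>i r. i \<in> {a..<b} \<Longrightarrow> Ti i (f r) = f (Ti i r)"
  shows "TI_revp a b (f p) = f (TI_revp a b p)"
  using assms
proof (induction b arbitrary: p)
  case 0
  then show ?case by (simp add: TI_revp_trivial)
next
  case (Suc b)
  show ?case
  proof (cases "a \<le> Suc b")
    case True
    have "word_act Ti (rev [a..<Suc b]) (f p) = f (word_act Ti (rev [a..<Suc b]) p)"
      by (rule word_act_fixed) (use Suc.prems in auto)
    then show ?thesis
      unfolding TI_revp_last[OF True] using True Suc by simp
  next
    case False
    then show ?thesis by (simp add: TI_revp_trivial)
  qed
qed

text \<open>Crossing \<open>omega\<close> raises every letter by one, as long as the interval stays
  below \<open>N\<close>.\<close>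

lemma TI_revp_om:
  assumes "1 \<le> a" "a \<le> Suc b" "b < N"
  shows "TI_revp a b (om N p) = om N (TI_revp (Suc a) (Suc b) p)"
  using assms
proof (induction b arbitrary: p)
  case 0
  then show ?case by (simp add: TI_revp_trivial)
next
  case (Suc b)
  show ?case
  proof (cases "a \<le> Suc b")
    case True
    have map: "rev [Suc a..<Suc (Suc b)] = map Suc (rev [a..<Suc b])"
      by (simp add: rev_map[symmetric] map_Suc_upt del: upt_Suc)
    have "word_act Ti (rev [a..<Suc b]) (om N p) = om N (word_act (\<lambda>i. Ti (Suc i)) (rev [a..<Suc b]) p)"
    proof (rule word_act_commute)
      fix i r assume "i \<in> set (rev [a..<Suc b])"
      then show "Ti i (om N r) = om N (Ti (Suc i) r)"
        using Suc.prems by (intro om_Ti[symmetric]) auto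
    qed
    also have "word_act (\<lambda>i. Ti (Suc i)) (rev [a..<Suc b]) p = word_act Ti (rev [Suc a..<Suc (Suc b)]) p"
      unfolding map by (simp add: word_act_def comp_def del: upt_Suc)
    finally have *: "word_act Ti (rev [a..<Suc b]) (om N p) = om N (word_act Ti (rev [Suc a..<Suc (Suc b)]) p)" .
    have "TI_revp a (Suc b) (om N p) = TI_revp a b (om N (word_act Ti (rev [Suc a..<Suc (Suc b)]) p))"
      unfolding TI_revp_last[OF True] * ..
    also have "\<dots> = om N (TI_revp (Suc a) (Suc b) (word_act Ti (rev [Suc a..<Suc (Suc b)]) p))"
      by (rule Suc.IH) (use Suc.prems True in auto)
    also have "\<dots> = om N (TI_revp (Suc a) (Suc (Suc b)) p)"
      using TI_revp_last[of "Suc a" "Suc b" p] True by (simp del: upt_Suc)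
    finally show ?thesis .
  next
    case False
    then show ?thesis by (simp add: TI_revp_trivial)
  qed
qed

lemma word_act_Tm_fixed:
  assumes "\<And>i. i \<in> set ws \<Longrightarrow> Tm i p = cc tt * p"
  shows "word_act Tm ws p = cc (tt ^ length ws) * p"
  using assms
proof (induction ws)
  case (Cons i ws)
  then have "word_act Tm (i # ws) p = Tm i (cc (tt ^ length ws) * p)" by simp
  also have "\<dots> = cc (tt ^ length ws) * (cc tt * p)"
    using Cons.prems[of i] TT_cc[OF n_not_Suc_n, of i "tt ^ length ws" p] by (simp only: list.set_intros)
  finally show ?case by (simp add: cc_simps mult_ac)
qed (simp add: cc_simps)

lemma TI_revp_fixed:
  assumes "\<And>i. i \<in> {a..<b} \<Longrightarrow> Tm i p = cc tt * p"
  shows "TI_revp a b p = cc (tt powi - int ((Suc b - a) choose 2)) * p"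
proof (rule TI_revp_eqI)
  obtain ws where ws: "set ws \<subseteq> {a..<b}" "TT_revp a b = word_act Tm ws" "length ws = ninv (revp a b)"
    using Tm.perm_act_in_range[OF revp_permutes] .
  have "word_act Tm ws p = cc (tt ^ ((Suc b - a) choose 2)) * p"
  proof -
    have "word_act Tm ws p = cc (tt ^ length ws) * p"
      by (rule word_act_Tm_fixed) (use assms ws(1) in blast)
    then show ?thesis by (simp add: ws(3) ninv_revp)
  qed
  then have "TT_revp a b (cc c * p) = cc (c * tt ^ ((Suc b - a) choose 2)) * p" for c
    unfolding ws(2) by (subst word_act_linop_cc) (simp_all add: linop_TT cc_simps)
  then show "TT_revp a b (cc (tt powi - int ((Suc b - a) choose 2)) * p) = p"
    by (simp add: power_int_minus cc_simps(2))
qed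

section \<open>The bar involution on non-symmetric Macdonald polynomials\<close>

text \<open>Up to a scalar, this linear operator has the same effect on the non-symmetric Macdonald
  polynomials as the semilinear bar involution.\<close>

definition Bop :: "nat \<Rightarrow> mpol \<Rightarrow> mpol" where
  "Bop N p = subst (revp 1 N) (\<lambda>_. 0) (TI_revp 1 N p)"

lemma bij_revp [simp]: "bij (revp a b)"
  by (rule finperm_bij) simp

lemma linop_Bop: "linop (Bop N)"
proof -
  have "Bop N = subst (revp 1 N) (\<lambda>_. 0) \<circ> TI_revp 1 N"
    by (simp add: fun_eq_iff Bop_def)
  then show ?thesis
    by (simp only:) (intro linop_comp linop_subst linop_TI_revp bij_revp)
qed

text \<open>Passing the generator \<open>i\<close> through the inverse of \<open>T_w\<close> yields
  the generator \<open>N - i\<close>, and the reversal of the variables reflects it back. The two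
  reflections cancel except that the reversal also interchanges the two neighbours, which is exactly
  the exchange of indices caused by barring \<open>T_i\<close>.\<close>

lemma TI_Bop:
  assumes "1 \<le> i" "i < N"
  shows "TI (Suc i) i (Bop N p) = Bop N (Ti i p)"
proof -
  have r: "revp 1 N (N - i) = Suc i" "revp 1 N (Suc (N - i)) = i"
    using assms by (auto simp: revp_def)
  have "TI (Suc i) i (Bop N p) = subst (revp 1 N) (\<lambda>_. 0) (Ti (N - i) (TI_revp 1 N p))"
    unfolding Bop_def using TI_subst[of "revp 1 N" "\<lambda>_. 0" "N - i" "Suc (N - i)"] unfolding r by simp
  also have "Ti (N - i) (TI_revp 1 N p) = TI_revp 1 N (Ti i p)"
    using Ti_TI_revp[of "N - i" 1 N p] assms by simp
  finally show ?thesis by (simp add: Bop_def)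
qed

text \<open>Stated for two polynomials, because applying \<open>T_i\<close> under the bar applies
  \<open>T_i^-1\<close> on the other side and the two arguments drift apart along a word.\<close>

lemma mbar_Tm:
  assumes "1 \<le> i" "i < N" "mbar r = cc c * Bop N p"
  shows "mbar (Tm i r) = cc c * Bop N (Ti i p)"
  using TI_Bop[OF assms(1,2), of p] by (simp add: mbar_TT assms(3) TI_cc)

section \<open>The statistic behind the power of \<open>t\<close>\<close>

definition ninc :: "nat \<Rightarrow> mono \<Rightarrow> nat" where
  "ninc N \<eta> = card {(i, j). i \<in> {1..N} \<and> j \<in> {1..N} \<and> i < j \<and> lookup \<eta> i < lookup \<eta> j}"

text \<open>Normalized at the zero composition: there is no ascending pair, and the inverse of
  \<open>T_w\<close> multiplies the constant \<open>1\<close> by \<open>t\<close> to the power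
  \<open>-(N choose 2)\<close>.\<close>

definition bar_const :: "nat \<Rightarrow> mono \<Rightarrow> coef" where
  "bar_const N \<eta> = tt powi (int (N choose 2) - int (ninc N \<eta>))"

text \<open>The triangular shape is recovered from \<open>joint_eigen_support\<close>. Carrying the
  bar formula inside the predicate lets one recursion yield existence and formula together.\<close>

definition is_nonsym_E :: "nat \<Rightarrow> mono \<Rightarrow> mpol \<Rightarrow> bool" where
  "is_nonsym_E N \<eta> p \<longleftrightarrow> joint_eigen N \<eta> p \<and> lookup p \<eta> = 1 \<and> mbar p = cc (bar_const N \<eta>) * Bop N p"

lemma finite_pairs: "finite {(i, j). i \<in> {1..N} \<and> j \<in> {1..N} \<and> P i j}" for N :: nat
  by (rule finite_subset[of _ "{1..N} \<times> {1..N}"]) auto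

lemma bar_eig [simp]: "bar_coef (eig N \<eta> i) = inverse (eig N \<eta> i)"
  by (simp add: eig_def power_int_inverse power_inverse)

lemma eig_nonzero [simp]: "eig N \<eta> i \<noteq> 0"
  by (simp add: eig_def)

lemma comp_rank_reindex:
  assumes "\<sigma> permutes {1..N}" "k \<in> {1..N}"
    and "\<And>j. j \<in> {1..N} \<Longrightarrow> beats \<nu> (\<sigma> j) (\<sigma> k) \<longleftrightarrow> beats \<eta> j k"
  shows "comp_rank N \<nu> (\<sigma> k) = comp_rank N \<eta> k"
proof -
  have "{j \<in> {1..N}. beats \<nu> j (\<sigma> k)} = \<sigma> ` {j \<in> {1..N}. beats \<eta> j k}"
  proof (rule set_eqI)
    fix j
    obtain l where l: "j = \<sigma> l" using permutes_surj[OF assms(1)] by (metis surjD)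
    have "\<sigma> l \<in> {1..N} \<longleftrightarrow> l \<in> {1..N}" by (rule permutes_in_image[OF assms(1)])
    moreover have "\<sigma> l \<in> \<sigma> ` S \<longleftrightarrow> l \<in> S" for S
      using permutes_inj[OF assms(1)] by (rule inj_image_mem_iff)
    ultimately show "j \<in> {j \<in> {1..N}. beats \<nu> j (\<sigma> k)} \<longleftrightarrow> j \<in> \<sigma> ` {j \<in> {1..N}. beats \<eta> j k}"
      using assms(3)[of l] unfolding l by auto
  qed
  moreover have "\<sigma> k \<in> {1..N}" using assms(2) permutes_in_image[OF assms(1)] by blast
  ultimately show ?thesis
    using assms(2) permutes_inj_on[OF assms(1)] by (simp add: comp_rank_eq_card card_image)
qed

text \<open>Write \<open>T p\<close> as \<open>(T K) (K p)\<close> and use that \<open>T K\<close>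
  is triangular.\<close>

lemma keys_TT_compositions:
  assumes "keys p \<subseteq> compositions N" "a < b" "a \<in> {1..N}" "b \<in> {1..N}"
  shows "keys (TT a b p) \<subseteq> compositions N"
proof -
  have "keys (KK a b p) \<subseteq> compositions N"
    unfolding keys_KK using assms swap_mono_compositions by blast
  from triangular_keys[OF triangular_TT_KK[OF assms(2-4)] this] show ?thesis by auto
qed

section \<open>The intertwiner at an ascent\<close>

context
  fixes N i :: nat and \<eta> :: mono
  assumes i: "1 \<le> i" "i < N" and \<eta>: "\<eta> \<in> compositions N" and asc: "lookup \<eta> i < lookup \<eta> (Suc i)"
begin

lemma eig_swap:
  assumes "k \<in> {1..N}"
  shows "eig N (swap_mono i (Suc i) \<eta>) (adj i k) = eig N \<eta> k"
proof -
  have "comp_rank N (swap_mono i (Suc i) \<eta>) (adj i k) = comp_rank N \<eta> k"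
  proof (rule comp_rank_reindex)
    show "adj i permutes {1..N}" using i by (intro permutes_swap_id) auto
    show "beats (swap_mono i (Suc i) \<eta>) (adj i j) (adj i k) \<longleftrightarrow> beats \<eta> j k" for j
    proof (cases "{j, k} = {i, Suc i}")
      case True
      then show ?thesis using asc by (auto simp: beats_def lookup_swap_mono doubleton_eq_iff)
    next
      case False
      then have "adj i j \<le> adj i k \<longleftrightarrow> j \<le> k"
        by (auto simp: transpose_def)
      then show ?thesis by (simp add: beats_def lookup_swap_mono)
    qed
  qed (rule assms)
  then show ?thesis by (simp add: eig_def lookup_swap_mono)
qed

lemma ninc_swap: "ninc N \<eta> = Suc (ninc N (swap_mono i (Suc i) \<eta>))"
proof -
  let ?s = "adj i" and ?S = "\<lambda>\<eta>. {(i, j). i \<in> {1..N} \<and> j \<in> {1..N} \<and> i < j \<and> lookup \<eta> i < lookup \<eta> j}"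
  let ?\<nu> = "swap_mono i (Suc i) \<eta>"
  have mono: "?s k < ?s l" if "k < l" "(k, l) \<noteq> (i, Suc i)" for k l
    using that by (auto simp: transpose_def)
  have inN: "?s k \<in> {1..N} \<longleftrightarrow> k \<in> {1..N}" for k
    using i by (intro permutes_in_image permutes_swap_id) auto
  have "bij_betw (map_prod ?s ?s) (?S \<eta> - {(i, Suc i)}) (?S ?\<nu>)"
  proof (rule bij_betw_byWitness[where f' = "map_prod ?s ?s"])
    show "map_prod ?s ?s ` (?S \<eta> - {(i, Suc i)}) \<subseteq> ?S ?\<nu>"
    proof
      fix z assume "z \<in> map_prod ?s ?s ` (?S \<eta> - {(i, Suc i)})"
      then obtain k l where z: "z = (?s k, ?s l)" and kl: "k \<in> {1..N}" "l \<in> {1..N}" "k < l"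
        "lookup \<eta> k < lookup \<eta> l" "(k, l) \<noteq> (i, Suc i)" by auto
      then show "z \<in> ?S ?\<nu>"
        using mono[OF kl(3,5)] inN[of k] inN[of l] by (simp add: lookup_swap_mono)
    qed
    show "map_prod ?s ?s ` ?S ?\<nu> \<subseteq> ?S \<eta> - {(i, Suc i)}"
    proof
      fix z assume "z \<in> map_prod ?s ?s ` ?S ?\<nu>"
      then obtain k l where z: "z = (?s k, ?s l)" and kl: "k \<in> {1..N}" "l \<in> {1..N}" "k < l"
        "lookup \<eta> (?s k) < lookup \<eta> (?s l)" by (auto simp: lookup_swap_mono)
      have "(k, l) \<noteq> (i, Suc i)" using kl asc by auto
      then have "?s k < ?s l" by (rule mono[OF kl(3)])
      moreover have "(?s k, ?s l) \<noteq> (i, Suc i)"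
      proof
        assume "(?s k, ?s l) = (i, Suc i)"
        then have "?s (?s k) = ?s i" "?s (?s l) = ?s (Suc i)" by simp_all
        then show False using kl by simp
      qed
      ultimately show "z \<in> ?S \<eta> - {(i, Suc i)}"
        using kl inN[of k] inN[of l] by (simp add: z)
    qed
  qed auto
  then have "card (?S \<eta> - {(i, Suc i)}) = ninc N ?\<nu>"
    unfolding ninc_def by (rule bij_betw_same_card)
  moreover have "Suc (card (?S \<eta> - {(i, Suc i)})) = card (?S \<eta>)"
    by (rule card_Suc_Diff1) (use i asc finite_pairs in simp_all)
  ultimately show ?thesis
    by (simp add: ninc_def)
qed

lemma is_nonsym_E_swap:
  assumes "is_nonsym_E N \<eta> p"
  shows "\<exists>p'. is_nonsym_E N (swap_mono i (Suc i) \<eta>) p'"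
proof -
  let ?\<nu> = "swap_mono i (Suc i) \<eta>"
  define a b where "a = eig N \<eta> i" and "b = eig N \<eta> (Suc i)"
  \<comment> \<open>From \<open>Y_i T_i p = (t - 1) a p + b T_i p\<close>, this is the value for
    which \<open>T_i p + z p\<close> becomes an eigenvector of \<open>Y_i\<close> with eigenvalue
    \<open>b\<close>.\<close>
  define z where "z = (tt - 1) * a / (b - a)"
  have p: "joint_eigen N \<eta> p" "lookup p \<eta> = 1" "mbar p = cc (bar_const N \<eta>) * Bop N p"
    using assms by (simp_all add: is_nonsym_E_def)
  have ab: "a \<noteq> b"
  proof
    assume "a = b"
    then show False
      using asc by (auto simp: a_def b_def eig_def dest: qq_tt_powi_eqD)
  qed
  have nz: "a \<noteq> 0" "b \<noteq> 0" by (simp_all add: a_def b_def)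
  have z: "(tt - 1) * a + z * a = b * z"
    using ab by (simp add: z_def field_simps)
  \<comment> \<open>Equivalently \<open>t (T_i^-1 + bar z) = T_i + z\<close>: up to the factor
    \<open>t\<close> the intertwiner is compatible with the bar involution.\<close>
  have zbar: "tt * bar_coef z + (1 - tt) = z"
  proof -
    have ba: "b - a \<noteq> 0" "inverse b - inverse a \<noteq> 0" using ab by auto
    have "bar_coef z = (inverse tt - 1) * inverse a / (inverse b - inverse a)"
      by (simp add: z_def a_def b_def)
    also have "\<dots> = (inverse tt - 1) * b / (a - b)"
      using ba ab nz by (simp add: divide_simps)
    finally have "tt * bar_coef z = (1 - tt) * b / (a - b)"
      by (simp add: algebra_simps)
    moreover have "(1 - tt) * b / (a - b) + (1 - tt) = z"
      using ab by (simp add: z_def divide_simps) (simp add: algebra_simps)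
    ultimately show ?thesis by simp
  qed
  have Y: "YY N k p = cc (eig N \<eta> k) * p" if "k \<in> {1..N}" for k
    using p(1) that by (simp add: joint_eigen_def)
  note lin = linop_add[OF linop_YY] linop_cc[OF linop_YY]
  have Yi: "YY N i (Tm i p) = cc ((tt - 1) * a) * p + cc b * Tm i p"
  proof -
    have TTp: "Tm i (Tm i p) = cc (tt - 1) * Tm i p + cc tt * p"
      by (simp add: TT_quadratic cc_simps)
    have "cc tt * YY N i (Tm i p) = Tm i (YY N (Suc i) (Tm i (Tm i p)))"
      by (rule Tm_YY_Tm[OF i, symmetric])
    also have "\<dots> = cc (tt - 1) * Tm i (YY N (Suc i) (Tm i p)) + cc tt * (cc b * Tm i p)"
      using i by (simp only: TTp lin TT_add[OF n_not_Suc_n] TT_cc[OF n_not_Suc_n]) (simp add: Y TT_cc b_def)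
    also have "\<dots> = cc tt * (cc ((tt - 1) * a) * p + cc b * Tm i p)"
      unfolding Tm_YY_Tm[OF i] using i by (simp add: Y a_def cc_simps algebra_simps)
    finally show ?thesis by simp
  qed
  have Yi1: "YY N (Suc i) (Tm i p) = cc a * Tm i p + cc (a * (1 - tt)) * p"
  proof -
    have "YY N (Suc i) (Tm i p) = Ti i (Tm i (YY N (Suc i) (Tm i p)))"
      by simp
    also have "\<dots> = cc tt * (cc a * Ti i p)"
      unfolding Tm_YY_Tm[OF i] using i by (simp add: Y a_def TI_cc)
    also have "\<dots> = cc a * (cc tt * Ti i p)"
      by (simp only: mult_ac)
    also have "cc tt * Ti i p = Tm i p + cc (1 - tt) * p"
      by (simp add: TI_def)
    finally show ?thesis by (simp add: cc_simps algebra_simps)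
  qed
  define r where "r = Tm i p + cc z * p"
  have keys_p: "keys p \<subseteq> compositions N" using p(1) by (simp add: joint_eigen_def)
  have keys_r: "keys r \<subseteq> compositions N"
    using keys_TT_compositions[OF keys_p, of i "Suc i"] i keys_cc_mult[of z p] keys_p
      keys_add[of "Tm i p" "cc z * p"] by (auto simp: r_def)
  have eig\<nu>: "eig N ?\<nu> i = b" "eig N ?\<nu> (Suc i) = a"
    using eig_swap[of "Suc i"] eig_swap[of i] i by (simp_all add: a_def b_def)
  have jr: "joint_eigen N ?\<nu> r"
    unfolding joint_eigen_def
  proof (intro conjI ballI keys_r)
    fix k assume k: "k \<in> {1..N}"
    consider "k = i" | "k = Suc i" | "k \<noteq> i" "k \<noteq> Suc i" by blast
    then show "YY N k r = cc (eig N ?\<nu> k) * r"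
    proof cases
      case 1
      have "YY N i r = cc ((tt - 1) * a + z * a) * p + cc b * Tm i p"
        unfolding r_def lin Yi using i by (simp add: Y a_def cc_simps algebra_simps)
      also have "\<dots> = cc b * r"
        unfolding z r_def by (simp add: cc_simps algebra_simps)
      finally show ?thesis using 1 eig\<nu> by simp
    next
      case 2
      have "YY N (Suc i) r = cc a * Tm i p + cc (b * z - (tt - 1) * a) * p"
        unfolding r_def lin Yi1 using i by (simp add: Y b_def cc_simps algebra_simps)
      also have "\<dots> = cc a * r"
        unfolding z[symmetric] r_def by (simp add: cc_simps algebra_simps)
      finally show ?thesis using 2 eig\<nu> by simp
    next
      case 3
      have "YY N k (Tm i p) = Tm i (YY N k p)"
        by (rule Tm_YY_commute[symmetric]) (use i k 3 in auto)
      then have "YY N k (Tm i p) = cc (eig N \<eta> k) * Tm i p"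
        by (simp only: Y[OF k] TT_cc[OF n_not_Suc_n])
      then have "YY N k r = cc (eig N \<eta> k) * r"
        unfolding r_def lin Y[OF k] by (simp add: algebra_simps)
      moreover have "eig N ?\<nu> k = eig N \<eta> k"
        using eig_swap[OF k] 3 by (simp add: transpose_apply_other)
      ultimately show ?thesis by simp
    qed
  qed
  have \<eta>\<nu>: "comp_less N \<eta> ?\<nu>"
    using swap_comp_less[of i N "Suc i" ?\<nu>] i asc by (simp add: lookup_swap_mono)
  \<comment> \<open>\<open>?\<nu>\<close> lies above all monomials of \<open>p\<close>. Only the
    exchange term of \<open>\<eta>\<close> reaches it, with coefficient \<open>t\<close> because the
    exponent at \<open>i\<close> is the smaller one; hence the normalization by
    \<open>t^-1\<close>.\<close>
  have "lookup (Tm i p) ?\<nu> = tt"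
  proof -
    have coef: "lookup (Tm i (single \<mu> 1)) ?\<nu> = (if \<mu> = \<eta> then tt else 0)" if \<mu>: "\<mu> \<in> keys p" for \<mu>
    proof -
      define s where "s = Tm i (single \<mu> 1) - TT_lead i (Suc i) \<mu>"
      have s: "keys s \<subseteq> inner i (Suc i) \<mu>"
        unfolding s_def by (rule keys_TT_single) simp
      have \<mu>\<eta>: "\<mu> = \<eta> \<or> comp_less N \<mu> \<eta>" by (rule joint_eigen_support[OF p(1) \<eta> \<mu>])
      have "?\<nu> \<notin> inner i (Suc i) \<mu>"
      proof
        assume "?\<nu> \<in> inner i (Suc i) \<mu>"
        then have "comp_less N ?\<nu> \<mu>"
          using inner_comp_less[of \<mu> N i "Suc i"] i \<mu> keys_p by auto
        then show False
          using \<mu>\<eta> \<eta>\<nu> comp_less_trans comp_less_irrefl by blast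
      qed
      then have "lookup s ?\<nu> = 0"
        using s by (auto simp: in_keys_iff)
      then have "lookup (Tm i (single \<mu> 1)) ?\<nu> = lookup (TT_lead i (Suc i) \<mu>) ?\<nu>"
        by (simp add: s_def lookup_minus)
      also have "\<dots> = (if \<mu> = \<eta> then tt else 0)"
      proof (cases "\<mu> = \<eta>")
        case True
        have "\<eta> \<noteq> ?\<nu>" using \<eta>\<nu> comp_less_irrefl by metis
        then show ?thesis
          using True asc by (simp add: TT_lead_def lookup_add lookup_single when_def)
      next
        case False
        then have "\<mu> \<noteq> ?\<nu>" using \<mu>\<eta> \<eta>\<nu> comp_less_trans comp_less_irrefl by blast
        moreover have "swap_mono i (Suc i) \<mu> \<noteq> ?\<nu>"
          using False by (metis swap_mono_swap_mono)
        ultimately show ?thesis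
          using False by (simp add: TT_lead_def lookup_add lookup_single when_def)
      qed
      finally show ?thesis .
    qed
    have lin: "linop (Tm i)" by (simp add: linop_TT)
    have "Tm i p = (\<Sum>\<mu>\<in>keys p. cc (lookup p \<mu>) * Tm i (single \<mu> 1))"
      by (subst mpol_as_sum) (simp add: linop_sum[OF lin] linop_cc[OF lin])
    then have "lookup (Tm i p) ?\<nu> = (\<Sum>\<mu>\<in>keys p. if \<mu> = \<eta> then lookup p \<eta> * tt else 0)"
      by (simp add: lookup_sum coef if_distrib cong: sum.cong if_cong)
    then show ?thesis
      using p(2) by (simp add: in_keys_iff)
  qed
  moreover have "lookup p ?\<nu> = 0"
    using joint_eigen_support[OF p(1) \<eta>, of ?\<nu>] \<eta>\<nu> comp_less_trans comp_less_irrefl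
    by (metis in_keys_iff)
  ultimately have lr: "lookup r ?\<nu> = tt"
    by (simp add: r_def lookup_add)
  define p' where "p' = cc (inverse tt) * r"
  have "joint_eigen N ?\<nu> p'" "lookup p' ?\<nu> = 1"
    unfolding p'_def using joint_eigen_cc[OF jr] lr by simp_all
  moreover have "mbar p' = cc (bar_const N ?\<nu>) * Bop N p'"
  proof -
    let ?c = "bar_const N \<eta>"
    have c: "bar_const N ?\<nu> = ?c * tt"
      unfolding bar_const_def ninc_swap using power_int_add[of tt "int (N choose 2) - int (ninc N \<eta>)" 1]
      by (simp add: ninc_swap algebra_simps)
    note lB = linop_add[OF linop_Bop] linop_cc[OF linop_Bop]
    have "mbar p' = cc tt * (cc ?c * Bop N (Ti i p) + cc (bar_coef z) * (cc ?c * Bop N p))"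
      by (simp add: p'_def r_def mbar_mult mbar_add mbar_Tm[OF i p(3)] p(3))
    also have "\<dots> = cc ?c * (cc tt * (Bop N (Ti i p) + cc (bar_coef z) * Bop N p))"
      by (simp add: algebra_simps)
    also have "cc tt * (Bop N (Ti i p) + cc (bar_coef z) * Bop N p) = Bop N (cc tt * (Ti i p + cc (bar_coef z) * p))"
      by (simp add: lB)
    also have "cc tt * (Ti i p + cc (bar_coef z) * p) = (Tm i p + cc (1 - tt) * p) + cc (tt * bar_coef z) * p"
      by (simp add: TI_def distrib_left cc_simps(6) mult.assoc)
    also have "\<dots> = Tm i p + cc (tt * bar_coef z + (1 - tt)) * p"
      by (simp only: cc_simps(3) distrib_right add_ac)
    also have "\<dots> = cc tt * p'"
      unfolding zbar by (simp add: p'_def r_def)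
    finally show ?thesis
      unfolding c by (simp only: lB(2) cc_simps(6) mult.assoc)
  qed
  ultimately show ?thesis
    by (auto simp: is_nonsym_E_def)
qed

end

lemma word_act_Ti_rev_xx:
  assumes "1 \<le> k"
  shows "xx k * word_act Ti (rev [1..<k]) p = cc (tt powi (1 - int k)) * word_act Tm (rev [1..<k]) (xx 1 * p)"
  using assms
proof (induction k rule: dec_induct)
  case (step k)
  let ?u = "word_act Ti (rev [1..<k]) p"
  have e: "tt powi (1 - int (Suc k)) = inverse tt * tt powi (1 - int k)"
    using power_int_add[of tt "-1" "1 - int k"] by (simp add: algebra_simps)
  have k: "rev [1..<Suc k] = k # rev [1..<k]" using step(1) by simp
  have "cc tt * (xx (Suc k) * Ti k ?u) = Tm k (xx k * ?u)"
    using TT_xx_TT[of k "Suc k" "Ti k ?u"] by (simp add: mult.assoc)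
  then have "xx (Suc k) * Ti k ?u = cc (inverse tt) * Tm k (xx k * ?u)"
    by (metis cc_inverse_mult(1) tt_nonzero)
  also have "\<dots> = cc (inverse tt) * (cc (tt powi (1 - int k)) * Tm k (word_act Tm (rev [1..<k]) (xx 1 * p)))"
    unfolding step.IH by (simp only: TT_cc[OF n_not_Suc_n])
  finally show ?case
    unfolding k word_act_simps comp_apply e cc_simps by (simp only: mult.assoc)
qed (simp add: cc_simps)

text \<open>In entries: \<open>(\<eta>_2, ..., \<eta>_N, \<eta>_1 + 1)\<close>.\<close>

definition Phi_mono :: "nat \<Rightarrow> mono \<Rightarrow> mono" where
  "Phi_mono N \<eta> = single N 1 + permute_mono (inv (cyc N)) \<eta>"

lemma cyc_permutes: "cyc N permutes {1..N}"
proof -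
  have "word_perm ws permutes {1..N}" if "set ws \<subseteq> {1..<N}" for ws
    using that
  proof (induction ws)
    case (Cons i ws)
    then have "adj i permutes {1..N}" "word_perm ws permutes {1..N}"
      by (auto intro: permutes_swap_id)
    then show ?case
      unfolding word_perm_simps by (intro permutes_compose)
  qed (simp add: permutes_id[unfolded id_def] permutes_id)
  then show ?thesis by (simp add: cyc_def)
qed

section \<open>The raising step\<close>

context
  fixes N :: nat and \<eta> :: mono
  assumes N: "1 \<le> N" and \<eta>: "\<eta> \<in> compositions N"
begin

lemma lookup_Phi_mono_cyc: "lookup (Phi_mono N \<eta>) (cyc N j) = lookup \<eta> j + of_bool (j = 1)"
proof -
  have "inj (inv (cyc N))" "inv (cyc N) (cyc N j) = j"
    by (simp_all add: bij_imp_bij_inv bij_is_inj)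
  moreover have "cyc N j = N \<longleftrightarrow> j = 1"
    using N by (auto simp: cyc_apply)
  ultimately show ?thesis
    by (auto simp: Phi_mono_def lookup_add lookup_permute_mono lookup_single when_def)
qed

text \<open>The first entry used to win ties by its position. At the last place it would lose them,
  but being larger by one it wins the same comparisons.\<close>

lemma beats_Phi_mono:
  assumes "j \<in> {1..N}" "k \<in> {1..N}"
  shows "beats (Phi_mono N \<eta>) (cyc N j) (cyc N k) \<longleftrightarrow> beats \<eta> j k"
  using assms N unfolding beats_def lookup_Phi_mono_cyc
  by (cases "j = 1"; cases "k = 1") (auto simp: cyc_apply)

lemma comp_rank_Phi_mono:
  assumes "k \<in> {1..N}"
  shows "comp_rank N (Phi_mono N \<eta>) (cyc N k) = comp_rank N \<eta> k"
  by (rule comp_rank_reindex[OF cyc_permutes assms]) (rule beats_Phi_mono[OF _ assms])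

lemma eig_Phi_mono:
  assumes "k \<in> {1..N}"
  shows "eig N (Phi_mono N \<eta>) (cyc N k) = (if k = 1 then qq else 1) * eig N \<eta> k"
  using comp_rank_Phi_mono[OF assms] by (simp add: eig_def lookup_Phi_mono_cyc)

text \<open>Removing the first entry destroys the \<open>G\<close> ascending pairs it starts;
  appending it, increased by one, creates the \<open>L\<close> pairs that end at it. The rank of
  position \<open>1\<close> is \<open>G + 1\<close>, and \<open>G + L = N - 1\<close>.\<close>

lemma ninc_Phi_mono: "int (ninc N (Phi_mono N \<eta>)) = int (ninc N \<eta>) + int N + 1 - 2 * int (comp_rank N \<eta> 1)"
proof -
  define G L M where "G = {j \<in> {2..N}. lookup \<eta> 1 < lookup \<eta> j}"
    and "L = {j \<in> {2..N}. lookup \<eta> j \<le> lookup \<eta> 1}"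
    and "M = {(i, j). i \<in> {2..N} \<and> j \<in> {2..N} \<and> i < j \<and> lookup \<eta> i < lookup \<eta> j}"
  have fin: "finite G" "finite L" "finite M"
    unfolding G_def L_def M_def by (auto intro: finite_subset[OF _ finite_pairs[of N]])
  have "card {2..N} = card (G \<union> L)"
    by (rule arg_cong[where f = card]) (auto simp: G_def L_def)
  also have "\<dots> = card G + card L"
    using fin by (intro card_Un_disjoint) (auto simp: G_def L_def)
  finally have GL: "card G + card L = N - 1" by simp
  have "comp_rank N \<eta> 1 = Suc (card G)"
    using comp_rank_split[of 1 N \<eta>] N by (simp add: G_def greaterThanAtMost_def atLeast_Suc_greaterThan[symmetric] numeral_2_eq_2 atLeastAtMost_def[symmetric])
  moreover have "ninc N \<eta> = card G + card M"
  proof -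
    have "{(i, j). i \<in> {1..N} \<and> j \<in> {1..N} \<and> i < j \<and> lookup \<eta> i < lookup \<eta> j} = Pair 1 ` G \<union> M"
    proof (rule set_eqI)
      fix z :: "nat \<times> nat"
      obtain i j where "z = (i, j)" by fastforce
      then show "z \<in> {(i, j). i \<in> {1..N} \<and> j \<in> {1..N} \<and> i < j \<and> lookup \<eta> i < lookup \<eta> j} \<longleftrightarrow>
          z \<in> Pair 1 ` G \<union> M"
        using N by (cases "i = 1") (auto simp: G_def M_def)
    qed
    then have "ninc N \<eta> = card (Pair 1 ` G \<union> M)" by (simp add: ninc_def)
    also have "\<dots> = card (Pair (1::nat) ` G) + card M"
      using fin by (intro card_Un_disjoint) (auto simp: M_def)
    finally show ?thesis by (simp add: card_image inj_on_def)
  qed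
  moreover have "ninc N (Phi_mono N \<eta>) = card L + card M"
  proof -
    let ?f = "\<lambda>j::nat. j - 1"
    have nu: "lookup (Phi_mono N \<eta>) (j - 1) = lookup \<eta> j" if "j \<in> {2..N}" for j
      using lookup_Phi_mono_cyc[of j] that by (simp add: cyc_apply split: if_splits)
    have nuN: "lookup (Phi_mono N \<eta>) N = Suc (lookup \<eta> 1)"
      using lookup_Phi_mono_cyc[of 1] N by (simp add: cyc_apply)
    have "{(i, j). i \<in> {1..N} \<and> j \<in> {1..N} \<and> i < j \<and> lookup (Phi_mono N \<eta>) i < lookup (Phi_mono N \<eta>) j}
        = (\<lambda>j. (j - 1, N)) ` L \<union> map_prod ?f ?f ` M"
    proof (rule set_eqI)
      fix z :: "nat \<times> nat"
      obtain i j where z: "z = (i, j)" by fastforce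
      show "z \<in> {(i, j). i \<in> {1..N} \<and> j \<in> {1..N} \<and> i < j \<and> lookup (Phi_mono N \<eta>) i < lookup (Phi_mono N \<eta>) j} \<longleftrightarrow>
          z \<in> (\<lambda>j. (j - 1, N)) ` L \<union> map_prod ?f ?f ` M"
      proof (cases "1 \<le> i \<and> i < j \<and> j \<le> N")
        case False
        then show ?thesis by (auto simp: z L_def M_def)
      next
        case True
        then have si: "lookup (Phi_mono N \<eta>) i = lookup \<eta> (Suc i)" using nu[of "Suc i"] by simp
        have L: "(i, j) \<in> (\<lambda>j. (j - 1, N)) ` L \<longleftrightarrow> j = N \<and> Suc i \<in> L"
        proof
          assume "j = N \<and> Suc i \<in> L"
          then show "(i, j) \<in> (\<lambda>j. (j - 1, N)) ` L"
            by (intro image_eqI[of _ _ "Suc i"]) simp_all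
        qed (auto simp: L_def)
        have M: "(i, j) \<in> map_prod ?f ?f ` M \<longleftrightarrow> (Suc i, Suc j) \<in> M"
        proof
          assume "(i, j) \<in> map_prod ?f ?f ` M"
          then obtain k l where "(k, l) \<in> M" "i = k - 1" "j = l - 1" by auto
          then show "(Suc i, Suc j) \<in> M" by (simp add: M_def)
        next
          assume "(Suc i, Suc j) \<in> M"
          then have "map_prod ?f ?f (Suc i, Suc j) \<in> map_prod ?f ?f ` M" by (rule imageI)
          then show "(i, j) \<in> map_prod ?f ?f ` M" by simp
        qed
        show ?thesis
        proof (cases "j = N")
          case True
          then show ?thesis
            using L M \<open>1 \<le> i \<and> i < j \<and> j \<le> N\<close> by (auto simp: z si nuN L_def M_def)
        next
          case False
          then have sj: "lookup (Phi_mono N \<eta>) j = lookup \<eta> (Suc j)" using nu[of "Suc j"] True by simp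
          show ?thesis
            using L M True False by (auto simp: z si sj L_def M_def)
        qed
      qed
    qed
    then have "ninc N (Phi_mono N \<eta>) = card ((\<lambda>j. (j - 1, N)) ` L \<union> map_prod ?f ?f ` M)"
      by (simp add: ninc_def)
    also have "\<dots> = card ((\<lambda>j. (j - 1, N)) ` L) + card (map_prod ?f ?f ` M)"
      using fin by (intro card_Un_disjoint) (auto simp: M_def)
    also have "card ((\<lambda>j. (j - 1, N)) ` L) = card L"
      by (rule card_image) (auto simp: inj_on_def L_def)
    also have "card (map_prod ?f ?f ` M) = card M"
      by (rule card_image) (auto simp: inj_on_def M_def)
    finally show ?thesis .
  qed
  ultimately show ?thesis
    using GL N by simp
qed

text \<open>Both sides reduce to \<open>x_N K_w u\<close>, with \<open>w\<close> the reversal. The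
  eigenvalue equation of \<open>Y_1\<close> is used on either side, once inverted and once directly,
  so the ratio contains the inverse of the first eigenvalue twice.\<close>

lemma is_nonsym_E_Phi:
  assumes "is_nonsym_E N \<eta> p"
  shows "\<exists>p'. is_nonsym_E N (Phi_mono N \<eta>) p'"
proof -
  have p: "joint_eigen N \<eta> p" "lookup p \<eta> = 1" "mbar p = cc (bar_const N \<eta>) * Bop N p"
    using assms by (simp_all add: is_nonsym_E_def)
  define y where "y = eig N \<eta> 1"
  define c where "c = bar_const N \<eta>"
  have y: "y \<noteq> 0" by (simp add: y_def)
  have Y: "YY N k p = cc (eig N \<eta> k) * p" if "k \<in> {1..N}" for k
    using p(1) that by (simp add: joint_eigen_def)
  obtain M where M: "N = Suc M" using N by (cases N) auto
  let ?K = "subst (revp 1 N) (\<lambda>_. 0)"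
  \<comment> \<open>The part of the inverse of \<open>T_w\<close> on \<open>p\<close> that involves
    only the last \<open>N - 1\<close> positions; it occurs on both sides.\<close>
  define u where "u = TI_revp 2 N p"

  \<comment> \<open>The eigenvalue equation of \<open>Y_1\<close> solved for \<open>omega p\<close>.
    The word obtained is the one that splits off the inverse of \<open>T_w\<close> at the last
    position.\<close>
  have om_p: "om N p = cc (tt powi (int N - 1) * y) * word_act Ti (rev [1..<N]) p"
  proof -
    have "cc (tt powi (1 - int N)) * word_act Tm [1..<N] (om N p) = cc y * p"
      using Y[of 1] N by (simp add: YY_def y_def)
    then have "cc (tt powi (int N - 1)) * (cc (tt powi (1 - int N)) * word_act Tm [1..<N] (om N p))
        = cc (tt powi (int N - 1)) * (cc y * p)"
      by (rule arg_cong)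
    moreover have "cc (tt powi (int N - 1)) * (cc (tt powi (1 - int N)) * r) = r" for r
      by (simp add: cc_simps(2) flip: mult.assoc cc_simps(6) power_int_add)
    ultimately have "word_act Tm [1..<N] (om N p) = cc (tt powi (int N - 1) * y) * p"
      by (simp add: cc_simps mult.assoc)
    then have "word_act Ti (rev [1..<N]) (word_act Tm [1..<N] (om N p)) =
        word_act Ti (rev [1..<N]) (cc (tt powi (int N - 1) * y) * p)"
      by (rule arg_cong)
    then show ?thesis
      by (simp only: word_act_Ti_rev) (rule word_act_linop_cc, simp add: linop_TI)
  qed
  have t_inv: "cc (tt powi (1 - int N) * inverse y) * (cc (tt powi (int N - 1) * y) * r) = r" for r
  proof -
    have "tt powi (1 - int N) * inverse y * (tt powi (int N - 1) * y) = 1"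
      using y by (simp add: mult_ac flip: power_int_add)
    then show ?thesis by (simp add: cc_simps(2) flip: mult.assoc cc_simps(6))
  qed
  have TI_revp_p: "TI_revp 1 N p = cc (tt powi (1 - int N) * inverse y) * om N u"
  proof -
    have "word_act Ti (rev [1..<N]) p = cc (tt powi (1 - int N) * inverse y) * om N p"
      unfolding om_p t_inv ..
    then have "TI_revp 1 N p = TI_revp 1 M (cc (tt powi (1 - int N) * inverse y) * om N p)"
      using TI_revp_last[of 1 M p] M by simp
    also have "\<dots> = cc (tt powi (1 - int N) * inverse y) * TI_revp 1 M (om N p)"
      by (rule linop_cc[OF linop_TI_revp])
    also have "TI_revp 1 M (om N p) = om N u"
      using TI_revp_om[of 1 M N p] M by (simp add: u_def numeral_2_eq_2)
    finally show ?thesis .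
  qed
  have mbar_Phi: "mbar (Phi N p) = cc (c * (tt powi (1 - int N) * inverse y)) * (xx N * ?K u)"
  proof -
    let ?e = "\<lambda>j. - of_bool (j = 1) :: int"
    \<comment> \<open>The reversal conjugates the cycle into its inverse, and the weights
      \<open>1\<close> and \<open>-1\<close> meet at the same variable, since barring inverts the
      \<open>q\<close> in \<open>omega\<close>.\<close>
    have "subst (cyc N) ?e (?K (om N u)) = ?K u"
    proof -
      have comp: "cyc N \<circ> (revp 1 N \<circ> cyc N) = revp 1 N"
        using N by (auto simp: fun_eq_iff cyc_apply revp_def)
      have e: "revp 1 N (cyc N j) = 1 \<longleftrightarrow> j = 1" for j
        using N by (auto simp: cyc_apply revp_def)
      show ?thesis
        unfolding om_def by (simp add: subst_subst bij_comp comp e[unfolded One_nat_def] comp_assoc)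
          (simp add: comp[unfolded One_nat_def] e[unfolded One_nat_def])
    qed
    have "mbar (om N p) = subst (cyc N) ?e (mbar p)"
      by (simp add: om_def mbar_subst)
    also have "\<dots> = cc c * subst (cyc N) ?e (?K (TI_revp 1 N p))"
      unfolding p(3) Bop_def c_def by (simp add: subst_mult)
    also have "\<dots> = cc c * (cc (tt powi (1 - int N) * inverse y) * subst (cyc N) ?e (?K (om N u)))"
      unfolding TI_revp_p by (simp add: subst_mult)
    also have "subst (cyc N) ?e (?K (om N u)) = ?K u" by fact
    finally have "mbar (om N p) = cc (c * (tt powi (1 - int N) * inverse y)) * ?K u"
      by (simp add: cc_simps mult.assoc)
    then show ?thesis
      by (simp add: Phi_def mbar_mult mult_ac)
  qed
  \<comment> \<open>Here the first position is split off instead. The remaining letters do not touch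
    \<open>x_1\<close>, which the reversal turns into \<open>x_N\<close>.\<close>
  have Bop_Phi: "Bop N (Phi N p) = cc y * (xx N * ?K u)"
  proof -
    have "Phi N p = cc (tt powi (int N - 1) * y) * (xx N * word_act Ti (rev [1..<N]) p)"
      unfolding Phi_def om_p by (simp only: mult_ac)
    also have "\<dots> = cc (tt powi (int N - 1) * y) * (cc (tt powi (1 - int N)) * word_act Tm (rev [1..<N]) (xx 1 * p))"
      unfolding word_act_Ti_rev_xx[OF N] ..
    also have "\<dots> = cc y * word_act Tm (rev [1..<N]) (xx 1 * p)"
    proof -
      have "tt powi (int N - 1) * y * tt powi (1 - int N) = y"
        by (simp add: mult_ac flip: power_int_add)
      then have "cc (tt powi (int N - 1) * y) * cc (tt powi (1 - int N)) = cc y"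
        by (simp only: cc_simps(6)[symmetric])
      then show ?thesis
        by (simp only: mult.assoc[symmetric])
    qed
    finally have "TI_revp 1 N (Phi N p) = cc y * TI_revp 1 N (word_act Tm (rev [1..<N]) (xx 1 * p))"
      by (simp only: linop_cc[OF linop_TI_revp])
    also have "TI_revp 1 N (word_act Tm (rev [1..<N]) (xx 1 * p)) = TI_revp 2 N (xx 1 * p)"
      using TI_revp_first[of 1 M "xx 1 * p"] unfolding M by (simp only: numeral_2_eq_2 One_nat_def le_add2 Suc_le_mono le0)
    also have "TI_revp 2 N (xx 1 * p) = xx 1 * u"
      unfolding u_def
      by (rule TI_revp_commute[where f = "\<lambda>r. xx 1 * r"]) (use N in \<open>auto intro!: TI_mult_sym simp: KK_xx transpose_apply_other\<close>)
    finally show ?thesis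
      using N by (simp add: Bop_def subst_mult subst_xx revp_def cc_simps)
  qed
  have ratio: "mbar (Phi N p) = cc (c * (tt powi (1 - int N) * inverse y * inverse y)) * Bop N (Phi N p)"
  proof -
    have "c * (tt powi (1 - int N) * inverse y * inverse y) * y = c * (tt powi (1 - int N) * inverse y)"
      using y by simp
    then show ?thesis
      unfolding mbar_Phi Bop_Phi by (simp only: mult.assoc[symmetric] cc_simps(6)[symmetric])
  qed

  define d where "d = qq ^ lookup \<eta> 1"
  have d: "d \<noteq> 0" by (simp add: d_def)
  define p' where "p' = cc (inverse d) * Phi N p"
  have keys_om: "keys (om N p) \<subseteq> compositions N"
  proof
    fix \<mu> assume "\<mu> \<in> keys (om N p)"
    then have "permute_mono (cyc N) \<mu> \<in> keys p"
      by (auto simp: om_def in_keys_iff lookup_subst)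
    then have "permute_mono (cyc N) \<mu> \<in> compositions N"
      using p(1) by (auto simp: joint_eigen_def)
    then have "permute_mono (inv (cyc N)) (permute_mono (cyc N) \<mu>) \<in> compositions N"
      by (rule permute_mono_compositions) (rule permutes_inv[OF cyc_permutes])
    then show "\<mu> \<in> compositions N" by simp
  qed
  have "keys (Phi N p) \<subseteq> compositions N"
  proof
    fix \<mu> assume "\<mu> \<in> keys (Phi N p)"
    then have *: "mult_var N (lookup (om N p)) \<mu> \<noteq> 0"
      by (simp add: Phi_def in_keys_iff lookup_xx_mult)
    then have "\<mu> - single N 1 \<in> keys (om N p)"
      by (auto simp: mult_var_def in_keys_iff split: if_splits)
    then have "\<mu> - single N 1 \<in> compositions N" using keys_om by blast
    then have "lookup (\<mu> - single N 1) j = 0" if "j \<notin> {1..N}" for j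
      using that unfolding in_compositions_iff by blast
    then show "\<mu> \<in> compositions N"
      using N unfolding in_compositions_iff lookup_minus lookup_single when_def
      by (metis atLeastAtMost_iff diff_zero order_refl)
  qed
  then have keys: "keys p' \<subseteq> compositions N"
    using keys_cc_mult unfolding p'_def by blast
  have "lookup p' (Phi_mono N \<eta>) = 1"
  proof -
    have "lookup (Phi N p) (Phi_mono N \<eta>) = lookup (om N p) (permute_mono (inv (cyc N)) \<eta>)"
      unfolding Phi_def Phi_mono_def xx_def using lookup_single_mult[of "single N 1" 1] by simp
    also have "\<dots> = d"
      by (simp add: om_def lookup_subst p(2) wt_of_bool[unfolded One_nat_def] d_def)
    finally show ?thesis using d by (simp add: p'_def)
  qed
  moreover have "joint_eigen N (Phi_mono N \<eta>) p'"
    unfolding joint_eigen_def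
  proof (intro conjI ballI keys)
    fix i assume i: "i \<in> {1..N}"
    have "YY N i (Phi N p) = cc (eig N (Phi_mono N \<eta>) i) * Phi N p"
    proof (cases "i = N")
      case True
      have "eig N (Phi_mono N \<eta>) N = qq * y"
        using eig_Phi_mono[of 1] N by (simp add: cyc_apply y_def)
      moreover have "Phi N (YY N 1 p) = cc y * Phi N p"
        using Y[of 1] N by (simp add: Phi_def om_mult y_def mult.left_commute)
      ultimately show ?thesis
        using YY_Phi_last[OF N, of p] True by (simp add: cc_simps mult.assoc)
    next
      case False
      then have i': "1 \<le> i" "i < N" "Suc i \<in> {1..N}" using i by auto
      have "eig N (Phi_mono N \<eta>) i = eig N \<eta> (Suc i)"
        using eig_Phi_mono[OF i'(3)] i' by (simp add: cyc_apply)
      moreover have "Phi N (YY N (Suc i) p) = cc (eig N \<eta> (Suc i)) * Phi N p"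
        by (simp add: Y[OF i'(3)] Phi_def om_mult mult.left_commute)
      ultimately show ?thesis
        using YY_Phi[OF i'(1,2), of p] by simp
    qed
    then show "YY N i p' = cc (eig N (Phi_mono N \<eta>) i) * p'"
      unfolding p'_def linop_cc[OF linop_YY] by (simp only: mult_ac)
  qed
  moreover have "mbar p' = cc (bar_const N (Phi_mono N \<eta>)) * Bop N p'"
  proof -
    have "mbar p' = cc (d * (c * (tt powi (1 - int N) * inverse y * inverse y))) * Bop N (Phi N p)"
      by (simp add: p'_def mbar_mult ratio d_def power_inverse[symmetric] cc_simps mult.assoc)
    \<comment> \<open>The two inverse eigenvalues contribute \<open>t^(2 (r-1))\<close>, with
      \<open>r\<close> the rank of the first position. Together with \<open>t^(1-N)\<close> the
      exponent is minus the change of \<open>ninc\<close>.\<close>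
    also have "d * (c * (tt powi (1 - int N) * inverse y * inverse y)) = bar_const N (Phi_mono N \<eta>) * inverse d"
    proof -
      let ?r = "int (comp_rank N \<eta> 1)"
      have iy: "inverse y = inverse d * tt powi (?r - 1)"
        by (simp add: y_def eig_def d_def power_int_minus[symmetric] flip: One_nat_def)
      have "d * (c * (tt powi (1 - int N) * inverse y * inverse y))
          = inverse d * (c * tt powi (1 - int N) * tt powi (?r - 1) * tt powi (?r - 1))"
        unfolding iy using d by (simp add: field_simps)
      also have "c * tt powi (1 - int N) * tt powi (?r - 1) * tt powi (?r - 1) = bar_const N (Phi_mono N \<eta>)"
        unfolding c_def bar_const_def by (simp add: ninc_Phi_mono flip: power_int_add) (simp add: algebra_simps)
      finally show ?thesis by (simp only: mult.commute)
    qed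
    finally show ?thesis
      by (simp add: p'_def linop_cc[OF linop_Bop] cc_simps mult.assoc)
  qed
  ultimately show ?thesis
    by (auto simp: is_nonsym_E_def)
qed

end

section \<open>The recursion starting from the constant polynomial\<close>

lemma is_nonsym_E_0: "is_nonsym_E N 0 1"
proof -
  have KK1: "KK a b 1 = 1" for a b by (simp add: KK_def)
  have T1: "Tm i 1 = cc tt * 1" for i
    by (rule TT_fixed) (simp_all add: KK1)
  have I1: "Ti i 1 = cc (inverse tt) * 1" for i
    by (rule TI_fixed) (simp_all add: T1)
  have W: "word_act Tm ws 1 = cc (tt ^ length ws) * 1" for ws
    by (rule word_act_Tm_fixed) (rule T1)
  have V: "word_act Ti ws 1 = cc (inverse tt ^ length ws) * 1" for ws
    by (induction ws) (simp_all add: cc_simps I1[simplified] TI_cc[of _ _ _ 1, simplified])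
  have "joint_eigen N 0 1"
    unfolding joint_eigen_def
  proof (intro conjI ballI)
    show "keys (1 :: mpol) \<subseteq> compositions N"
      by (auto simp: in_compositions_iff simp flip: single_one)
    fix i assume i: "i \<in> {1..N}"
    have "om N 1 = 1" by (simp add: om_def)
    then have "YY N i 1 = cc (tt powi (int i - int N) * inverse tt ^ (i - 1) * tt ^ (N - i))"
      unfolding YY_def V linop_cc[OF linop_om] word_act_linop_cc[OF linop_TT[OF n_not_Suc_n]] by (simp add: W[simplified] cc_simps)
    also have "tt powi (int i - int N) * inverse tt ^ (i - 1) * tt ^ (N - i)
        = tt powi (int i - int N) * tt powi (- int (i - 1)) * tt powi (int (N - i))"
      by (simp add: power_int_minus power_inverse)
    also have "\<dots> = tt powi (1 - int i)"
      using i by (simp add: of_nat_diff flip: power_int_add)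
    also have "comp_rank N 0 i = i"
    proof -
      have "{j \<in> {1..N}. beats 0 j i} = {1..i}" using i by (auto simp: beats_def)
      then show ?thesis using i by (simp add: comp_rank_eq_card)
    qed
    then have "tt powi (1 - int i) = eig N 0 i"
      by (simp add: eig_def)
    finally show "YY N i 1 = cc (eig N 0 i) * 1" by simp
  qed
  moreover have "Bop N 1 = cc (tt powi - int (N choose 2))"
    unfolding Bop_def using TI_revp_fixed[of 1 N 1] T1 by simp
  then have "mbar 1 = cc (bar_const N 0) * Bop N 1"
    by (simp add: bar_const_def ninc_def power_int_minus cc_simps(2) flip: cc_simps(6))
  moreover have "lookup (1 :: mpol) 0 = 1"
    by (simp flip: single_one)
  ultimately show ?thesis by (simp add: is_nonsym_E_def)
qed

text \<open>A positive last entry is undone by the raising step, which lowers the degree. Otherwise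
  the last nonzero entry is moved one place to the right, producing an ascent from which the
  intertwiner leads back; this lowers the second measure, where an entry weighs its distance from
  position \<open>N\<close>.\<close>

lemma exists_is_nonsym_E:
  assumes "\<eta> \<in> compositions N"
  shows "\<exists>p. is_nonsym_E N \<eta> p"
  using assms
proof (induction \<eta> rule: wf_induct_rule[OF wf_measures,
    of "[\<lambda>\<eta>. \<Sum>j\<in>{1..N}. lookup \<eta> j, \<lambda>\<eta>. \<Sum>j\<in>{1..N}. (N - j) * lookup \<eta> j]"])
  case (1 \<eta>)
  show ?case
  proof (cases "\<eta> = 0")
    case True
    then show ?thesis using is_nonsym_E_0 by blast
  next
    case False
    then have "keys \<eta> \<noteq> {}" by simp
    have sub: "keys \<eta> \<subseteq> {1..N}" using 1(2) by (simp add: compositions_def)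
    define k where "k = Max (keys \<eta>)"
    have "k \<in> keys \<eta>" unfolding k_def using \<open>keys \<eta> \<noteq> {}\<close> by (intro Max_in) simp_all
    then have "k \<in> {1..N}" and "lookup \<eta> k > 0"
      using sub by (blast, simp add: in_keys_iff)
    then have k: "1 \<le> k" "k \<le> N" "lookup \<eta> k > 0"
      by auto
    have kmax: "lookup \<eta> j = 0" if "k < j" for j
      using that Max_ge[of "keys \<eta>" j] unfolding k_def by (metis finite_keys in_keys_iff leD)
    show ?thesis
    proof (cases "k = N")
      case True
      have N: "1 \<le> N" using k by simp
      define \<mu> where "\<mu> = \<eta> - single N 1"
      define \<kappa> where "\<kappa> = permute_mono (cyc N) \<mu>"
      have \<mu>: "\<mu> \<in> compositions N"
        using 1(2) by (auto simp: \<mu>_def in_compositions_iff lookup_minus)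
      then have \<kappa>: "\<kappa> \<in> compositions N"
        unfolding \<kappa>_def by (rule permute_mono_compositions) (rule cyc_permutes)
      have \<eta>: "\<eta> = single N 1 + \<mu>"
        using k True by (intro poly_mapping_eqI) (auto simp: \<mu>_def lookup_add lookup_minus lookup_single when_def)
      then have "Phi_mono N \<kappa> = \<eta>"
        by (simp add: Phi_mono_def \<kappa>_def)
      moreover have "(\<Sum>j\<in>{1..N}. lookup \<kappa> j) = (\<Sum>j\<in>{1..N}. lookup \<mu> j)"
        unfolding \<kappa>_def by (simp only: lookup_permute_mono bij_is_inj bij_cyc)
          (rule sum.permute[OF cyc_permutes, symmetric, unfolded comp_def])
      moreover have "(\<Sum>j\<in>{1..N}. lookup \<eta> j) = Suc (\<Sum>j\<in>{1..N}. lookup \<mu> j)"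
        unfolding \<eta> using N by (simp add: lookup_add sum.distrib lookup_single when_def)
      ultimately show ?thesis
        using 1(1)[of \<kappa>] \<kappa> is_nonsym_E_Phi[OF N \<kappa>] by (simp add: in_measures) blast
    next
      case False
      define \<kappa> where "\<kappa> = swap_mono k (Suc k) \<eta>"
      have kN: "k < N" "k \<in> {1..N}" "Suc k \<in> {1..N}" using False k by auto
      have \<kappa>: "\<kappa> \<in> compositions N"
        unfolding \<kappa>_def using 1(2) kN by (intro swap_mono_compositions) auto
      have lk: "lookup \<kappa> k = 0" "lookup \<kappa> (Suc k) = lookup \<eta> k" "lookup \<eta> (Suc k) = 0"
        using kmax[of "Suc k"] by (simp_all add: \<kappa>_def lookup_swap_mono)
      have rest: "(\<Sum>j\<in>{1..N} - {k, Suc k}. f j * lookup \<kappa> j) = (\<Sum>j\<in>{1..N} - {k, Suc k}. f j * lookup \<eta> j)" for f :: "nat \<Rightarrow> nat"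
        by (intro sum.cong) (auto simp: \<kappa>_def lookup_swap_mono transpose_apply_other)
      note split = sum_remove2[OF n_not_Suc_n kN(2,3)]
      have s1: "(\<Sum>j\<in>{1..N}. lookup \<kappa> j) = (\<Sum>j\<in>{1..N}. lookup \<eta> j)"
        using split[of "lookup \<kappa>"] split[of "lookup \<eta>"] rest[of "\<lambda>_. 1"] lk by simp
      have "N - k = Suc (N - Suc k)" using kN by simp
      then have "(N - Suc k) * lookup \<eta> k < (N - k) * lookup \<eta> k"
        using k by simp
      then have s2: "(\<Sum>j\<in>{1..N}. (N - j) * lookup \<kappa> j) < (\<Sum>j\<in>{1..N}. (N - j) * lookup \<eta> j)"
        using split[of "\<lambda>j. (N - j) * lookup \<kappa> j"] split[of "\<lambda>j. (N - j) * lookup \<eta> j"]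
          rest[of "\<lambda>j. N - j"] lk by simp
      obtain p where "is_nonsym_E N \<kappa> p"
        using 1(1)[of \<kappa>] \<kappa> s1 s2 by (auto simp: in_measures)
      then have "\<exists>p'. is_nonsym_E N (swap_mono k (Suc k) \<kappa>) p'"
        by (intro is_nonsym_E_swap[OF k(1) kN(1) \<kappa>]) (use lk k in simp_all)
      then show ?thesis by (simp add: \<kappa>_def)
    qed
  qed
qed

section \<open>Partial symmetrization\<close>

definition Sym :: "nat \<Rightarrow> nat \<Rightarrow> mpol \<Rightarrow> mpol" where
  "Sym a b p = (\<Sum>\<sigma> | \<sigma> permutes {a..b}. Tm.perm_act \<sigma> p)"

lemma linop_perm_act: "linop (Tm.perm_act \<sigma>)"
  unfolding Tm.perm_act_def by (rule linop_word_act) (simp add: linop_TT)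

text \<open>Pairing \<open>\<sigma>\<close> with \<open>s_i \<sigma>\<close> extracts the left
  factor \<open>1 + T_i\<close>, and \<open>T_i (1 + T_i) = t (1 + T_i)\<close> by the quadratic
  relation.\<close>

lemma Tm_Sym:
  assumes "i \<in> {a..<b}"
  shows "Tm i (Sym a b p) = cc tt * Sym a b p"
proof -
  let ?S = "{\<sigma>. \<sigma> permutes {a..b}}"
  let ?P = "{\<sigma> \<in> ?S. inv \<sigma> i < inv \<sigma> (Suc i)}" and ?M = "{\<sigma> \<in> ?S. inv \<sigma> (Suc i) < inv \<sigma> i}"
  let ?f = "\<lambda>\<sigma>. adj i \<circ> \<sigma>"
  have fin: "finite ?S" by (rule finite_permutations) simp
  have s: "adj i permutes {a..b}" using assms by (intro permutes_swap_id) auto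
  have fp: "finperm \<sigma>" if "\<sigma> \<in> ?S" for \<sigma> using that finperm_permutes by blast
  have invf: "inv (?f \<sigma>) = inv \<sigma> \<circ> adj i" if "\<sigma> \<in> ?S" for \<sigma>
    using finperm_bij[OF fp[OF that]] by (simp add: o_inv_distrib)
  have ff: "?f (?f \<sigma>) = \<sigma>" for \<sigma> :: "nat \<Rightarrow> nat"
    by (simp add: comp_assoc[symmetric])
  have ne: "inv \<sigma> i \<noteq> inv \<sigma> (Suc i)" if "\<sigma> \<in> ?S" for \<sigma>
    using finperm_inj[OF finperm_inv[OF fp[OF that]], of i "Suc i"] by simp
  have SPM: "?S = ?P \<union> ?M" using ne by (auto simp: neq_iff)
  have split: "sum g ?S = sum g ?P + sum g ?M" for g :: "_ \<Rightarrow> mpol"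
  proof -
    have "sum g ?S = sum g (?P \<union> ?M)" by (rule arg_cong[OF SPM])
    also have "\<dots> = sum g ?P + sum g ?M"
      by (rule sum.union_disjoint) (auto intro: finite_subset[OF _ fin])
    finally show ?thesis .
  qed
  have "bij_betw ?f ?P ?M"
  proof (rule bij_betw_byWitness[where f' = ?f])
    have in_S: "?f \<sigma> \<in> ?S" if "\<sigma> \<in> ?S" for \<sigma>
      using that s permutes_compose by blast
    show "?f ` ?P \<subseteq> ?M" "?f ` ?M \<subseteq> ?P"
      using in_S invf by auto
  qed (use ff in auto)
  then have M: "sum g ?M = (\<Sum>\<sigma>\<in>?P. g (?f \<sigma>))" for g :: "_ \<Rightarrow> mpol"
    by (rule sum.reindex_bij_betw[symmetric])
  have "Sym a b p = (\<Sum>\<sigma>\<in>?P. Tm.perm_act \<sigma> p + Tm.perm_act (?f \<sigma>) p)"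
    unfolding Sym_def split M sum.distrib ..
  also have "\<dots> = (\<Sum>\<sigma>\<in>?P. Tm.perm_act \<sigma> p + Tm i (Tm.perm_act \<sigma> p))"
    using fp by (intro sum.cong) (simp_all add: Tm.perm_act_adj_comp)
  finally have eq: "Sym a b p = (\<Sum>\<sigma>\<in>?P. Tm.perm_act \<sigma> p + Tm i (Tm.perm_act \<sigma> p))" .
  have lin: "linop (Tm i)" by (simp add: linop_TT)
  have "Tm i (r + Tm i r) = cc tt * (r + Tm i r)" for r
    by (simp add: TT_add TT_quadratic cc_simps algebra_simps)
  then show ?thesis
    unfolding eq by (simp add: linop_sum[OF lin] sum_distrib_left)
qed

text \<open>The left-hand side is the inverse of \<open>T\<close> at \<open>\<sigma>\<^bsup>-1\<^esup>\<close>, so the sum over \<open>\<sigma>\<close> reproduces the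
  symmetrizer up to a power of \<open>t\<close>.\<close>

lemma word_act_Ti_eq_TI_revp:
  assumes "\<sigma> permutes {a..b}" "word_perm ws = \<sigma>" "length ws = ninv \<sigma>"
  shows "word_act Ti ws p = TI_revp a b (Tm.perm_act (revp a b \<circ> \<sigma>) p)"
proof (rule TI_revp_eqI[symmetric])
  have fp: "finperm \<sigma>" using assms(1) finperm_permutes by blast
  have "TT_revp a b = Tm.perm_act (revp a b \<circ> inv (inv \<sigma>)) \<circ> Tm.perm_act (inv \<sigma>)"
    by (rule Tm.perm_act_revp_factor_right) (rule permutes_inv[OF assms(1)])
  moreover have "Tm.perm_act (inv \<sigma>) = word_act Tm (rev ws)"
    using Tm.perm_act_word[of "rev ws"] assms(2,3) ninv_inv[OF fp] by (simp add: word_perm_rev)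
  ultimately show "TT_revp a b (word_act Ti ws p) = Tm.perm_act (revp a b \<circ> \<sigma>) p"
    using inv_inv_eq[OF finperm_bij[OF fp]] by simp
qed

lemma mbar_word_act:
  assumes "set ws \<subseteq> {1..<N}" "mbar p = cc c * Bop N p"
  shows "mbar (word_act Tm ws p) = cc c * Bop N (word_act Ti ws p)"
  using assms(1)
proof (induction ws)
  case (Cons i ws)
  then show ?case using mbar_Tm[of i N "word_act Tm ws p" c "word_act Ti ws p"] by simp
qed (simp add: assms(2))

lemma mbar_sum: "mbar (sum f A) = (\<Sum>x\<in>A. mbar (f x))"
  by (induction A rule: infinite_finite_induct) (simp_all add: mbar_add)

lemma mbar_Sym:
  assumes "m \<le> N" "mbar p = cc c * Bop N p"
  shows "mbar (Sym (Suc m) N p) = cc (c * tt powi - int ((N - m) choose 2)) * Bop N (Sym (Suc m) N p)"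
proof -
  let ?S = "{\<sigma>. \<sigma> permutes {Suc m..N}}"
  let ?G = "Sym (Suc m) N p"
  have "mbar (Tm.perm_act \<sigma> p) = cc c * Bop N (TI_revp (Suc m) N (Tm.perm_act (revp (Suc m) N \<circ> \<sigma>) p))"
    if \<sigma>: "\<sigma> permutes {Suc m..N}" for \<sigma>
  proof -
    obtain ws where ws: "set ws \<subseteq> {Suc m..<N}" "Tm.perm_act \<sigma> = word_act Tm ws"
      "length ws = ninv \<sigma>" "word_perm ws = \<sigma>"
      using Tm.perm_act_in_range[OF \<sigma>] .
    have "set ws \<subseteq> {1..<N}" using ws(1) by auto
    then show ?thesis
      using mbar_word_act[OF _ assms(2)] word_act_Ti_eq_TI_revp[OF \<sigma> ws(4,3)] ws(2) by simp
  qed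
  then have "mbar ?G = (\<Sum>\<sigma>\<in>?S. cc c * Bop N (TI_revp (Suc m) N (Tm.perm_act (revp (Suc m) N \<circ> \<sigma>) p)))"
    unfolding Sym_def mbar_sum by (intro sum.cong) auto
  also have "\<dots> = cc c * Bop N (TI_revp (Suc m) N (\<Sum>\<sigma>\<in>?S. Tm.perm_act (revp (Suc m) N \<circ> \<sigma>) p))"
    by (simp add: linop_sum[OF linop_Bop] linop_sum[OF linop_TI_revp] sum_distrib_left)
  \<comment> \<open>Left multiplication by the reversal only permutes the summands.\<close>
  also have "(\<Sum>\<sigma>\<in>?S. Tm.perm_act (revp (Suc m) N \<circ> \<sigma>) p) = ?G"
    unfolding Sym_def
  proof (rule sum.reindex_bij_betw, rule bij_betw_byWitness[where f' = "\<lambda>\<sigma>. revp (Suc m) N \<circ> \<sigma>"])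
    have "revp (Suc m) N \<circ> (revp (Suc m) N \<circ> \<sigma>) = \<sigma>" for \<sigma>
      by (simp add: comp_assoc[symmetric])
    then show "\<forall>\<sigma>\<in>?S. revp (Suc m) N \<circ> (revp (Suc m) N \<circ> \<sigma>) = \<sigma>"
      "\<forall>\<sigma>\<in>?S. revp (Suc m) N \<circ> (revp (Suc m) N \<circ> \<sigma>) = \<sigma>" by blast+
    show "(\<lambda>\<sigma>. revp (Suc m) N \<circ> \<sigma>) ` ?S \<subseteq> ?S" "(\<lambda>\<sigma>. revp (Suc m) N \<circ> \<sigma>) ` ?S \<subseteq> ?S"
      using permutes_compose[OF _ revp_permutes] by blast+
  qed
  also have "TI_revp (Suc m) N ?G = cc (tt powi - int ((N - m) choose 2)) * ?G"
    using TI_revp_fixed[of "Suc m" N ?G] Tm_Sym by simp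
  finally show ?thesis
    by (simp add: linop_cc[OF linop_Bop] cc_simps mult.assoc)
qed

section \<open>From the longest element of \<open>S\<^sub>N\<close> to that of \<open>S\<^sub>m\<close>\<close>

lemma word_act_Ti_om_funpow:
  assumes "1 \<le> i" "k + j \<le> N"
  shows "word_act Ti [i..<k] ((om N ^^ j) p) = (om N ^^ j) (word_act Ti [i + j..<k + j] p)"
  using assms
proof (induction j arbitrary: i k)
  case (Suc j)
  have "word_act Ti [i..<k] (om N ((om N ^^ j) p)) = om N (word_act Ti [Suc i..<Suc k] ((om N ^^ j) p))"
    using om_word_act_shift(1)[of i "Suc k" N "(om N ^^ j) p"] Suc.prems by simp
  also have "\<dots> = om N ((om N ^^ j) (word_act Ti [Suc i + j..<Suc k + j] p))"
    using Suc.IH[of "Suc i" "Suc k"] Suc.prems by (simp del: upt_Suc)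
  finally show ?case by simp
qed simp

text \<open>The \<open>j\<close>-th power of \<open>cyc N\<close>, for
  \<open>j \<le> N\<close>.\<close>

definition shift :: "nat \<Rightarrow> nat \<Rightarrow> nat \<Rightarrow> nat" where
  "shift N j i = (if i \<in> {1..j} then N - j + i else if i \<in> {j<..N} then i - j else i)"

lemma cyc_shift: "Suc j \<le> N \<Longrightarrow> cyc N (shift N j i) = shift N (Suc j) i"
  by (cases "i \<le> j"; cases "i = Suc j") (auto simp: shift_def cyc_apply)

lemma bij_shift: "j \<le> N \<Longrightarrow> bij (shift N j)"
proof (induction j)
  case 0
  have "shift N 0 = id" by (auto simp: shift_def fun_eq_iff)
  then show ?case by (simp only: bij_id)
next
  case (Suc j)
  then have "cyc N \<circ> shift N j = shift N (Suc j)"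
    by (simp add: fun_eq_iff cyc_shift)
  moreover have "bij (cyc N \<circ> shift N j)"
    using Suc by (intro bij_comp bij_cyc) simp
  ultimately show ?case by (simp only:)
qed

text \<open>Each of the first \<open>j\<close> variables passes the first place exactly once and so
  acquires a single factor \<open>q\<close>.\<close>

lemma om_funpow:
  assumes "j \<le> N"
  shows "(om N ^^ j) p = subst (shift N j) (\<lambda>i. of_bool (i \<in> {1..j})) p"
  using assms
proof (induction j)
  case 0
  have "shift N 0 = id" by (auto simp: shift_def fun_eq_iff)
  then show ?case by simp
next
  case (Suc j)
  have e: "of_bool (i \<in> {1..j}) + of_bool (shift N j i = 1) = (of_bool (i \<in> {1..Suc j}) :: int)" for i
    using Suc.prems by (auto simp: shift_def)
  have comp: "cyc N \<circ> shift N j = shift N (Suc j)"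
    using Suc.prems by (simp add: fun_eq_iff cyc_shift)
  have "(om N ^^ Suc j) p = om N (subst (shift N j) (\<lambda>i. of_bool (i \<in> {1..j})) p)"
    using Suc by simp
  also have "\<dots> = subst (cyc N \<circ> shift N j) (\<lambda>i. of_bool (i \<in> {1..j}) + of_bool (shift N j i = 1)) p"
    unfolding om_def by (rule subst_subst[OF bij_cyc bij_shift]) (use Suc.prems in simp)
  finally show ?case unfolding comp e .
qed

lemma subst_word_perm_fixed:
  assumes "\<And>i. i \<in> set ws \<Longrightarrow> KK i (Suc i) p = p"
  shows "subst (word_perm ws) (\<lambda>_. 0) p = p"
  using assms
proof (induction ws)
  case (Cons i ws)
  have "subst (word_perm (i # ws)) (\<lambda>_. 0) p = KK i (Suc i) (subst (word_perm ws) (\<lambda>_. 0) p)"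
    by (simp add: KK_def subst_subst)
  also have "subst (word_perm ws) (\<lambda>_. 0) p = p"
    by (rule Cons.IH) (use Cons.prems in simp)
  finally show ?case using Cons.prems[of i] by simp
qed simp

text \<open>The eigenvalue equation of \<open>Y_k\<close> is solved for the word that splits off the
  inverse longest element of \<open>{k..N}\<close> at its last position. What remains, that of
  \<open>{k..N-1}\<close>, crosses \<open>omega\<close> and becomes the one of
  \<open>{k+1..N}\<close>.\<close>

lemma TI_revp_chain_step:
  assumes k: "1 \<le> k" "k \<le> N" and Y: "YY N k p = cc y * p" "y \<noteq> 0"
  shows "TI_revp k N p = cc (tt powi (int k - int N) * inverse y) * om N (word_act Ti [1..<k] (TI_revp (Suc k) N p))"
proof -
  obtain M where M: "N = Suc M" using k by (cases N) auto
  define c where "c = tt powi (int k - int N)"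
  have c: "c \<noteq> 0" by (simp add: c_def)
  have "cc c * word_act Tm [k..<N] (om N (word_act Ti [1..<k] p)) = cc y * p"
    using Y(1) by (simp add: YY_def c_def)
  then have "word_act Ti (rev [k..<N]) (cc c * word_act Tm [k..<N] (om N (word_act Ti [1..<k] p))) =
      word_act Ti (rev [k..<N]) (cc y * p)"
    by (rule arg_cong)
  then have "cc c * om N (word_act Ti [1..<k] p) = cc y * word_act Ti (rev [k..<N]) p"
    by (simp only: word_act_linop_cc[OF linop_TI[OF n_not_Suc_n]] word_act_Ti_rev)
  then have "cc (inverse y) * (cc c * om N (word_act Ti [1..<k] p)) = cc (inverse y) * (cc y * word_act Ti (rev [k..<N]) p)"
    by (rule arg_cong)
  then have "word_act Ti (rev [k..<N]) p = cc (inverse y) * (cc c * om N (word_act Ti [1..<k] p))"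
    by (simp only: cc_inverse_mult[OF Y(2)])
  also have "\<dots> = cc (c * inverse y) * om N (word_act Ti [1..<k] p)"
    by (simp only: cc_simps(6) mult_ac)
  finally have "TI_revp k N p = cc (c * inverse y) * TI_revp k M (om N (word_act Ti [1..<k] p))"
    using TI_revp_last[of k M p] k unfolding M by (simp only: linop_cc[OF linop_TI_revp])
  also have "TI_revp k M (om N (word_act Ti [1..<k] p)) = om N (TI_revp (Suc k) N (word_act Ti [1..<k] p))"
    using TI_revp_om[of k M N] k M by simp
  also have "TI_revp (Suc k) N (word_act Ti [1..<k] p) = word_act Ti [1..<k] (TI_revp (Suc k) N p)"
  proof (rule TI_revp_commute)
    fix i r assume i: "i \<in> {Suc k..<N}"
    have "Ti j (Ti i s) = Ti i (Ti j s)" if "j < k" for j s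
    proof -
      have "Ti j (Ti i s) = Ti j (Ti i (Tm j (Ti j s)))" by simp
      also have "\<dots> = Ti j (Tm j (Ti i (Ti j s)))"
        using i that by (subst Tm_Ti_far) auto
      finally show ?thesis by simp
    qed
    then show "Ti i (word_act Ti [1..<k] r) = word_act Ti [1..<k] (Ti i r)"
      by (intro word_act_fixed[symmetric]) auto
  qed (use k in simp)
  finally show ?thesis by (simp add: c_def)
qed

text \<open>Each step leaves a word on \<open>{1..k}\<close>, which crosses the accumulated powers
  of \<open>omega\<close> and then acts on the top \<open>k\<close> of the first \<open>m\<close>
  positions. There it is precisely the next factor of the inverse longest element of
  \<open>{1..m}\<close>. The second equation says how much of that element is still missing; at
  \<open>j = m\<close> nothing is.\<close>

lemma TI_revp_chain:
  assumes m: "m \<le> N" and Y: "\<And>k. k \<in> {1..m} \<Longrightarrow> YY N k p = cc (y k) * p" "\<And>k. y k \<noteq> 0"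
    and top: "TI_revp (Suc m) N p = cc c * p" and j: "j \<le> m"
  shows "\<exists>h. TI_revp (Suc m - j) N p = cc (c * (\<Prod>k\<in>{Suc m - j..m}. tt powi (int k - int N) * inverse (y k))) * (om N ^^ j) h
    \<and> TI_revp 1 m p = TI_revp (Suc j) m h"
  using j
proof (induction j)
  case 0
  show ?case using top by (intro exI[of _ p]) simp
next
  case (Suc j)
  define k where "k = m - j"
  have k: "1 \<le> k" "k \<le> m" "Suc m - j = Suc k" "Suc m - Suc j = k" "k + j = m"
    using Suc.prems by (auto simp: k_def)
  obtain h where h: "TI_revp (Suc k) N p = cc (c * (\<Prod>k\<in>{Suc k..m}. tt powi (int k - int N) * inverse (y k))) * (om N ^^ j) h"
    "TI_revp 1 m p = TI_revp (Suc j) m h"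
    using Suc k by auto
  define C where "C = c * (\<Prod>k\<in>{Suc k..m}. tt powi (int k - int N) * inverse (y k))"
  define d where "d = tt powi (int k - int N) * inverse (y k)"
  let ?h = "word_act Ti [Suc j..<m] h"
  have "TI_revp k N p = cc d * om N (word_act Ti [1..<k] (TI_revp (Suc k) N p))"
    unfolding d_def by (rule TI_revp_chain_step) (use k m Y in auto)
  also have "\<dots> = cc d * (cc C * om N (word_act Ti [1..<k] ((om N ^^ j) h)))"
    unfolding h(1) C_def[symmetric]
    by (simp only: word_act_linop_cc[OF linop_TI[OF n_not_Suc_n]] linop_cc[OF linop_om])
  also have "word_act Ti [1..<k] ((om N ^^ j) h) = (om N ^^ j) ?h"
    using word_act_Ti_om_funpow[of 1 k j N h] k m by simp
  also have "cc d * (cc C * om N ((om N ^^ j) ?h)) = cc (C * d) * (om N ^^ Suc j) ?h"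
    by (simp add: cc_simps mult_ac)
  also have "C * d = c * (\<Prod>k\<in>{k..m}. tt powi (int k - int N) * inverse (y k))"
    using k by (simp add: C_def d_def prod.atLeast_Suc_atMost[of k m] mult_ac)
  finally have 1: "TI_revp k N p = cc (c * (\<Prod>k\<in>{k..m}. tt powi (int k - int N) * inverse (y k))) * (om N ^^ Suc j) ?h" .
  obtain M where M: "m = Suc M" using Suc.prems by (cases m) auto
  have "TI_revp (Suc j) m h = TI_revp (Suc j) (Suc M) (word_act Tm (rev [Suc j..<Suc M]) (word_act Ti [Suc j..<Suc M] h))"
    by (simp only: word_act_Tm_rev M)
  also have "\<dots> = TI_revp (Suc (Suc j)) m ?h"
    unfolding M by (rule TI_revp_first) (use Suc.prems M in simp)
  finally show ?case
    using 1 h(2) k(4) by (intro exI[of _ ?h]) simp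
qed

text \<open>After \<open>m\<close> steps the reversal of all variables times \<open>omega^m\<close>
  is the reversal of the first \<open>m\<close> with their factors \<open>q\<close>, times the
  reversal of the others. The latter acts trivially, since being a \<open>t\<close>-eigenvector of
  the remaining \<open>T_i\<close> means symmetry.\<close>

lemma Bop_reduce:
  assumes m: "m \<le> N" and Y: "\<And>k. k \<in> {1..m} \<Longrightarrow> YY N k p = cc (y k) * p" "\<And>k. y k \<noteq> 0"
    and T: "\<And>i. i \<in> {Suc m..<N} \<Longrightarrow> Tm i p = cc tt * p"
  shows "Bop N p = cc (tt powi - int ((N - m) choose 2) * (\<Prod>k\<in>{1..m}. tt powi (int k - int N) * inverse (y k))) *
    subst (revp 1 m) (\<lambda>i. of_bool (i \<in> {1..m})) (TI_revp 1 m p)"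
proof -
  define c where "c = tt powi - int ((N - m) choose 2)"
  define d where "d = c * (\<Prod>k\<in>{1..m}. tt powi (int k - int N) * inverse (y k))"
  define g where "g = TI_revp 1 m p"
  have "TI_revp (Suc m) N p = cc c * p"
    using TI_revp_fixed[OF T, of "Suc m" N] by (simp add: c_def)
  from TI_revp_chain[OF m Y this order_refl] obtain h where
    h: "TI_revp 1 N p = cc d * (om N ^^ m) h" "TI_revp 1 m p = TI_revp (Suc m) m h"
    by (auto simp: d_def)
  then have hg: "h = g" by (simp add: g_def TI_revp_trivial)
  have Tg: "Tm i g = cc tt * g" if i: "i \<in> {Suc m..<N}" for i
  proof -
    have "TI_revp 1 m (Tm i p) = Tm i (TI_revp 1 m p)"
      by (rule TI_revp_commute[where f = "Tm i"]) (use i in \<open>auto intro!: Tm_Ti_far[symmetric]\<close>)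
    then show ?thesis
      unfolding g_def T[OF i] linop_cc[OF linop_TI_revp] by simp
  qed
  have Kg: "KK i (Suc i) g = g" if "i \<in> {Suc m..<N}" for i
    by (rule TT_fixed_iff) (use Tg[OF that] in simp_all)
  obtain ws where ws: "set ws \<subseteq> {Suc m..<N}" "word_perm ws = revp (Suc m) N"
    using exists_word[OF revp_permutes] by metis
  have Rg: "subst (revp (Suc m) N) (\<lambda>_. 0) g = g"
    unfolding ws(2)[symmetric] by (rule subst_word_perm_fixed) (use Kg ws(1) in blast)
  let ?e = "\<lambda>i. of_bool (i \<in> {1..m}) :: int"
  have comp: "revp 1 N \<circ> shift N m = revp 1 m \<circ> revp (Suc m) N"
    using m by (auto simp: fun_eq_iff revp_def shift_def)
  have e: "0 + ?e (revp (Suc m) N i) = ?e i" for i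
    by (auto simp: revp_def)
  have "subst (revp 1 N) (\<lambda>_. 0) ((om N ^^ m) g) = subst (revp 1 N \<circ> shift N m) (\<lambda>i. ?e i + 0) g"
    unfolding om_funpow[OF m] by (rule subst_subst[OF bij_revp bij_shift[OF m]])
  also have "\<dots> = subst (revp 1 m \<circ> revp (Suc m) N) (\<lambda>i. 0 + ?e (revp (Suc m) N i)) g"
    unfolding comp e by simp
  also have "\<dots> = subst (revp 1 m) ?e (subst (revp (Suc m) N) (\<lambda>_. 0) g)"
    by (rule subst_subst[OF bij_revp bij_revp, symmetric])
  also have "\<dots> = subst (revp 1 m) ?e g"
    unfolding Rg ..
  finally have "subst (revp 1 N) (\<lambda>_. 0) ((om N ^^ m) g) = subst (revp 1 m) ?e g" .
  then show ?thesis
    unfolding Bop_def h(1) hg d_def c_def g_def by (simp add: subst_mult)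
qed

section \<open>The normalization\<close>

lemma t_fact_tt_aux:
  fixes t s P Q :: "'a::idom"
  assumes "t * s = 1" "P * Q = 1"
  shows "(1 - t * P) * (1 - s) = P * (1 - s * Q) * (1 - t)"
  using assms by algebra

lemma t_fact_tt: "t_fact tt k = tt ^ (k choose 2) * t_fact (inverse tt) k"
proof (induction k)
  case (Suc k)
  have "(1 - tt ^ Suc k) / (1 - tt) = tt ^ k * ((1 - inverse tt ^ Suc k) / (1 - inverse tt))"
  proof -
    have "1 - inverse tt \<noteq> 0" "1 - tt \<noteq> 0"
      using tt_ne_1 by (auto simp: field_simps)
    moreover have "(1 - tt ^ Suc k) * (1 - inverse tt) = tt ^ k * (1 - inverse tt ^ Suc k) * (1 - tt)"
    proof -
      have "tt * inverse tt = 1" "tt ^ k * inverse tt ^ k = 1"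
        by (simp_all flip: power_mult_distrib)
      then show ?thesis
        unfolding power_Suc by (rule t_fact_tt_aux)
    qed
    ultimately show ?thesis
      by (simp add: frac_eq_eq del: power_Suc)
  qed
  moreover have "Suc k choose 2 = (k choose 2) + k"
    by (simp add: numeral_2_eq_2)
  ultimately show ?case
    using Suc by (simp add: t_fact_def power_add mult_ac del: power_Suc)
qed (simp add: t_fact_def numeral_2_eq_2)

lemma bar_t_fact: "bar_coef (t_fact (inverse tt) k) = tt ^ (k choose 2) * t_fact (inverse tt) k"
proof -
  have "bar_coef (t_fact (inverse tt) k) = t_fact tt k"
    by (simp add: t_fact_def)
  then show ?thesis by (simp add: t_fact_tt)
qed

lemma tt_powi_diff2: "tt powi (int a - 2 * int b) = tt ^ a * inverse tt ^ b * inverse tt ^ b"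
proof -
  have "int a - 2 * int b = int a - int (b + b)" by simp
  then have "tt powi (int a - 2 * int b) = tt ^ a / tt ^ (b + b)"
    by (simp only: power_int_diff power_int_of_nat tt_nonzero simp_thms)
  then show ?thesis
    by (simp add: power_add field_simps)
qed

text \<open>A factorial of \<open>n\<close> contributes \<open>t^(n choose 2)\<close>, and the
  explicit power of \<open>t\<close> is inverted, which costs twice its exponent.\<close>

lemma bar_u_norm:
  "bar_coef (u_norm N m lam) =
    tt powi (int (\<Sum>v\<in>set (padded (N - m) lam). count_list (padded (N - m) lam) v choose 2)
      - 2 * int ((N - m) choose 2)) * u_norm N m lam"
proof -
  let ?A = "set (padded (N - m) lam)" and ?n = "count_list (padded (N - m) lam)"
  let ?f = "\<Prod>v\<in>?A. t_fact (inverse tt) (?n v)"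
  let ?s = "\<Sum>v\<in>?A. ?n v choose 2" and ?K = "(N - m) choose 2"
  have "bar_coef (u_norm N m lam) = tt ^ ?s * ?f * inverse tt ^ ?K"
    by (simp add: u_norm_def bar_t_fact choose_two prod.distrib power_sum)
  also have "\<dots> = tt powi (int ?s - 2 * int ?K) * (?f * tt ^ ?K)"
  proof -
    have "tt ^ ?K * inverse tt ^ ?K = 1"
      by (simp flip: power_mult_distrib)
    then show ?thesis
      unfolding tt_powi_diff2 by (simp add: mult_ac)
  qed
  finally show ?thesis
    by (simp add: u_norm_def choose_two)
qed

section \<open>The bar identity in finitely many variables\<close>

lemma YY_Sym:
  assumes "k \<in> {1..m}" "m \<le> N" "YY N k p = cc y * p"
  shows "YY N k (Sym (Suc m) N p) = cc y * Sym (Suc m) N p"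
proof -
  have "YY N k (Tm.perm_act \<sigma> p) = cc y * Tm.perm_act \<sigma> p" if \<sigma>: "\<sigma> permutes {Suc m..N}" for \<sigma>
  proof -
    obtain ws where ws: "set ws \<subseteq> {Suc m..<N}" "Tm.perm_act \<sigma> = word_act Tm ws"
      using Tm.perm_act_in_range[OF \<sigma>] .
    have "word_act Tm ws (YY N k p) = YY N k (word_act Tm ws p)"
      by (rule word_act_fixed, rule Tm_YY_commute) (use ws(1) assms(1,2) in auto)
    then show ?thesis
      unfolding ws(2) assms(3) by (simp add: word_act_linop_cc linop_TT)
  qed
  then show ?thesis
    by (simp add: Sym_def linop_sum[OF linop_YY] sum_distrib_left)
qed

lemma int_choose_2: "2 * int (n choose 2) = int n * int n - int n"
proof (induction n)
  case (Suc n)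
  have "Suc n choose 2 = n + (n choose 2)" by (simp add: numeral_2_eq_2)
  then show ?case using Suc by (simp add: algebra_simps)
qed (simp add: numeral_2_eq_2)

lemma sum_diff_interval: "2 * (\<Sum>k\<in>{1..m}. int k - c) = int m * int m + int m - 2 * int m * c"
proof (induction m)
  case (Suc m)
  then show ?case by (simp add: algebra_simps)
qed simp

section \<open>Ascending and equal pairs of entries\<close>

definition asc_pairs :: "mono \<Rightarrow> nat \<Rightarrow> nat \<Rightarrow> nat \<Rightarrow> nat \<Rightarrow> (nat \<times> nat) set" where
  "asc_pairs \<eta> a b c d = {(i, j). i \<in> {a..b} \<and> j \<in> {c..d} \<and> i < j \<and> lookup \<eta> i < lookup \<eta> j}"

lemma finite_asc_pairs: "finite (asc_pairs \<eta> a b c d)"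
  by (rule finite_subset[of _ "{a..b} \<times> {c..d}"]) (auto simp: asc_pairs_def)

text \<open>A rank counts earlier weakly larger and later strictly larger entries. Inside
  \<open>{1..m}\<close> the former are the pairs that are not ascending and the latter the ascending
  ones, so together they exhaust all pairs; only the ascending pairs leading into the tail are left
  over.\<close>

lemma sum_comp_rank:
  assumes "m \<le> N"
  shows "(\<Sum>k\<in>{1..m}. int (comp_rank N \<eta> k) - 1) = int (m choose 2) + int (card (asc_pairs \<eta> 1 m (Suc m) N))"
proof -
  define A where "A = (SIGMA k:{1..m}. {j \<in> {1..<k}. lookup \<eta> k \<le> lookup \<eta> j})"
  define B where "B = (SIGMA k:{1..m}. {j \<in> {k<..N}. lookup \<eta> k < lookup \<eta> j})"
  define P where "P = {(i, j). i < j \<and> i \<in> {1..m} \<and> j \<in> {1..m}}"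
  let ?I = "asc_pairs \<eta> 1 m 1 m" and ?X = "asc_pairs \<eta> 1 m (Suc m) N"
  have "int (comp_rank N \<eta> k) - 1 = int (card {j \<in> {1..<k}. lookup \<eta> k \<le> lookup \<eta> j}) + int (card {j \<in> {k<..N}. lookup \<eta> k < lookup \<eta> j})"
    if "k \<in> {1..m}" for k
    using comp_rank_split[of k N \<eta>] that assms by simp
  then have "(\<Sum>k\<in>{1..m}. int (comp_rank N \<eta> k) - 1) = (\<Sum>k\<in>{1..m}.
      int (card {j \<in> {1..<k}. lookup \<eta> k \<le> lookup \<eta> j}) + int (card {j \<in> {k<..N}. lookup \<eta> k < lookup \<eta> j}))"
    by (rule sum.cong[OF refl])
  also have "\<dots> = int (card A) + int (card B)"
    by (simp add: A_def B_def card_SigmaI sum.distrib)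
  also have "card A + card ?I = card P"
  proof -
    have "card (prod.swap ` A) = card A"
      by (rule card_image) simp
    moreover have "finite (prod.swap ` A)" by (simp add: A_def)
    moreover have "prod.swap ` A \<inter> ?I = {}" by (auto simp: A_def asc_pairs_def)
    ultimately have "card (prod.swap ` A \<union> ?I) = card A + card ?I"
      using finite_asc_pairs by (simp add: card_Un_disjoint)
    moreover have "prod.swap ` A \<union> ?I = P"
    proof (rule set_eqI)
      fix z :: "nat \<times> nat"
      obtain i j where z: "z = (i, j)" by fastforce
      have "z \<in> prod.swap ` A \<longleftrightarrow> (j, i) \<in> A"
        unfolding z by (metis (no_types, lifting) image_iff swap_simp swap_swap)
      then show "z \<in> prod.swap ` A \<union> ?I \<longleftrightarrow> z \<in> P"
        by (auto simp: z A_def P_def asc_pairs_def)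
    qed
    ultimately show ?thesis by simp
  qed
  then have "int (card A) = int (card P) - int (card ?I)" by simp
  also have "card P = m choose 2"
    using card_pairs[of "{1..m}"] by (simp add: P_def)
  also have "card B = card ?I + card ?X"
  proof -
    have "B = ?I \<union> ?X"
      using assms by (auto simp: B_def asc_pairs_def)
    moreover have "?I \<inter> ?X = {}" by (auto simp: asc_pairs_def)
    ultimately show ?thesis
      using finite_asc_pairs by (simp add: card_Un_disjoint)
  qed
  finally show ?thesis by simp
qed

lemma ninc_split:
  assumes "m \<le> N"
  shows "ninc N \<eta> = card (asc_pairs \<eta> 1 m 1 m) + card (asc_pairs \<eta> 1 m (Suc m) N) + card (asc_pairs \<eta> (Suc m) N (Suc m) N)"
proof -
  let ?I = "asc_pairs \<eta> 1 m 1 m" and ?X = "asc_pairs \<eta> 1 m (Suc m) N" and ?L = "asc_pairs \<eta> (Suc m) N (Suc m) N"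
  have "ninc N \<eta> = card (?I \<union> ?X \<union> ?L)"
    unfolding ninc_def by (rule arg_cong[where f = card]) (use assms in \<open>auto simp: asc_pairs_def\<close>)
  also have "\<dots> = card (?I \<union> ?X) + card ?L"
    by (intro card_Un_disjoint) (auto simp: finite_asc_pairs, auto simp: asc_pairs_def)
  also have "card (?I \<union> ?X) = card ?I + card ?X"
    by (intro card_Un_disjoint) (auto simp: finite_asc_pairs, auto simp: asc_pairs_def)
  finally show ?thesis .
qed

text \<open>In a weakly increasing tail these are the pairs that are not ascending. Barring the
  factorials in the normalization produces the same number.\<close>

definition ties :: "mono \<Rightarrow> nat \<Rightarrow> nat \<Rightarrow> nat" where
  "ties \<eta> a b = card {(i, j). i < j \<and> i \<in> {a..b} \<and> j \<in> {a..b} \<and> lookup \<eta> i = lookup \<eta> j}"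

lemma asc_pairs_ties:
  assumes "\<And>i j. i \<in> {a..b} \<Longrightarrow> j \<in> {a..b} \<Longrightarrow> i < j \<Longrightarrow> lookup \<eta> i \<le> lookup \<eta> j"
  shows "card (asc_pairs \<eta> a b a b) + ties \<eta> a b = (Suc b - a) choose 2"
proof -
  let ?E = "{(i, j). i < j \<and> i \<in> {a..b} \<and> j \<in> {a..b} \<and> lookup \<eta> i = lookup \<eta> j}"
  have "finite ?E" by (rule finite_subset[of _ "{a..b} \<times> {a..b}"]) auto
  moreover have "asc_pairs \<eta> a b a b \<inter> ?E = {}" by (auto simp: asc_pairs_def)
  ultimately have "card (asc_pairs \<eta> a b a b) + card ?E = card (asc_pairs \<eta> a b a b \<union> ?E)"
    using finite_asc_pairs by (simp add: card_Un_disjoint)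
  also have "asc_pairs \<eta> a b a b \<union> ?E = {(i, j). i < j \<and> i \<in> {a..b} \<and> j \<in> {a..b}}"
  proof (rule set_eqI)
    fix z :: "nat \<times> nat"
    obtain i j where z: "z = (i, j)" by fastforce
    show "z \<in> asc_pairs \<eta> a b a b \<union> ?E \<longleftrightarrow> z \<in> {(i, j). i < j \<and> i \<in> {a..b} \<and> j \<in> {a..b}}"
      using assms[of i j] unfolding z asc_pairs_def by (auto simp: le_less)
  qed
  also have "card \<dots> = (Suc b - a) choose 2"
    using card_pairs[of "{a..b}"] by simp
  finally show ?thesis by (simp add: ties_def)
qed

lemma mbar_Sym_E:
  assumes m: "m \<le> N" and \<eta>: "\<eta> \<in> compositions N" and E: "is_nonsym_E N \<eta> p"
    and tail: "\<And>i j. i \<in> {Suc m..N} \<Longrightarrow> j \<in> {Suc m..N} \<Longrightarrow> i < j \<Longrightarrow> lookup \<eta> i \<le> lookup \<eta> j"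
  defines "G \<equiv> Sym (Suc m) N p"
  shows "mbar G = cc (inverse (qq ^ (\<Sum>k\<in>{1..m}. lookup \<eta> k)) *
      tt powi (int (m choose 2) - int (card (asc_pairs \<eta> 1 m 1 m)) + int (ties \<eta> (Suc m) N) - 2 * int ((N - m) choose 2))) *
    subst (revp 1 m) (\<lambda>i. of_bool (i \<in> {1..m})) (TI_revp 1 m G)"
proof -
  let ?K = "(N - m) choose 2" and ?R = "subst (revp 1 m) (\<lambda>i. of_bool (i \<in> {1..m})) (TI_revp 1 m G)"
  have p: "joint_eigen N \<eta> p" "mbar p = cc (bar_const N \<eta>) * Bop N p"
    using E by (simp_all add: is_nonsym_E_def)
  have Y: "YY N k G = cc (eig N \<eta> k) * G" if "k \<in> {1..m}" for k
    unfolding G_def by (rule YY_Sym[OF that m]) (use p(1) that m in \<open>auto simp: joint_eigen_def\<close>)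
  have T: "Tm i G = cc tt * G" if "i \<in> {Suc m..<N}" for i
    unfolding G_def by (rule Tm_Sym[OF that])
  have "mbar G = cc (bar_const N \<eta> * tt powi - int ?K) * Bop N G"
    unfolding G_def by (rule mbar_Sym[OF m p(2)])
  also have "Bop N G = cc (tt powi - int ?K * (\<Prod>k\<in>{1..m}. tt powi (int k - int N) * inverse (eig N \<eta> k))) * ?R"
    by (rule Bop_reduce[OF m Y eig_nonzero T])
  finally have "mbar G = cc (bar_const N \<eta> * tt powi - int ?K * (tt powi - int ?K * (\<Prod>k\<in>{1..m}. tt powi (int k - int N) * inverse (eig N \<eta> k)))) * ?R"
    by (simp add: cc_simps mult.assoc)
  moreover have "(\<Prod>k\<in>{1..m}. tt powi (int k - int N) * inverse (eig N \<eta> k)) =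
      inverse (qq ^ (\<Sum>k\<in>{1..m}. lookup \<eta> k)) * tt powi (\<Sum>k\<in>{1..m}. (int k - int N) + (int (comp_rank N \<eta> k) - 1))"
  proof -
    have "tt powi (int k - int N) * inverse (eig N \<eta> k) = inverse (qq ^ lookup \<eta> k) *
        tt powi ((int k - int N) + (int (comp_rank N \<eta> k) - 1))" for k
      unfolding eig_def power_int_add[OF disjI1[OF tt_nonzero]] by (simp flip: power_int_minus)
    moreover have "tt powi (sum f A) = (\<Prod>k\<in>A. tt powi (f k))" for f :: "nat \<Rightarrow> int" and A
      by (induction A rule: infinite_finite_induct) (simp_all add: power_int_add)
    ultimately show ?thesis
      by (simp add: prod.distrib power_sum prod_inversef[symmetric] comp_def)
  qed
  moreover have "bar_const N \<eta> * tt powi - int ?K * (tt powi - int ?K * (inverse (qq ^ (\<Sum>k\<in>{1..m}. lookup \<eta> k)) *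
      tt powi (\<Sum>k\<in>{1..m}. (int k - int N) + (int (comp_rank N \<eta> k) - 1)))) =
    inverse (qq ^ (\<Sum>k\<in>{1..m}. lookup \<eta> k)) * tt powi (int (m choose 2) - int (card (asc_pairs \<eta> 1 m 1 m)) + int (ties \<eta> (Suc m) N) - 2 * int ?K)"
  proof -
    let ?s = "\<Sum>k\<in>{1..m}. (int k - int N) + (int (comp_rank N \<eta> k) - 1)"
    have 1: "?s = (\<Sum>k\<in>{1..m}. int k - int N) + int (m choose 2) + int (card (asc_pairs \<eta> 1 m (Suc m) N))"
      unfolding sum.distrib sum_comp_rank[OF m] by simp
    have 2: "int (card (asc_pairs \<eta> (Suc m) N (Suc m) N)) + int (ties \<eta> (Suc m) N) = int ?K"
      using asc_pairs_ties[of "Suc m" N \<eta>] tail by (simp flip: of_nat_add)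
    have 3: "2 * int (N choose 2) + 2 * (\<Sum>k\<in>{1..m}. int k - int N) = 2 * int ?K"
      unfolding sum_diff_interval int_choose_2 using m by (simp add: of_nat_diff algebra_simps)
    \<comment> \<open>The pairs between head and tail cancel between \<open>ninc\<close> and the
      ranks, and \<open>N choose 2\<close> together with the sum of \<open>k - N\<close> leaves
      \<open>(N - m) choose 2\<close>.\<close>
    have "int (N choose 2) - int (ninc N \<eta>) - int ?K - int ?K + ?s =
        int (m choose 2) - int (card (asc_pairs \<eta> 1 m 1 m)) + int (ties \<eta> (Suc m) N) - 2 * int ?K"
      using 1 2 3 ninc_split[OF m, of \<eta>] by linarith
    moreover have "bar_const N \<eta> * tt powi - int ?K * (tt powi - int ?K * (c * tt powi s)) =
        c * tt powi (int (N choose 2) - int (ninc N \<eta>) - int ?K - int ?K + s)" for c s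
    proof -
      have "tt powi (int (N choose 2) - int (ninc N \<eta>) - int ?K - int ?K + s) =
          tt powi (int (N choose 2) - int (ninc N \<eta>)) * tt powi - int ?K * tt powi - int ?K * tt powi s"
        by (simp flip: power_int_add)
      then show ?thesis by (simp add: bar_const_def mult_ac)
    qed
    ultimately show ?thesis by (simp only:)
  qed
  ultimately show ?thesis by (simp only:)
qed

section \<open>The compositions of m-partitions\<close>

context
  fixes N m :: nat and a lam :: "nat list"
  assumes len: "length a = m" and part: "is_partition lam" and N: "m + length lam \<le> N"
begin

lemma m_le_N: "m \<le> N" using N by simp

lemma length_padded: "length (padded (N - m) lam) = N - m"
  using N by (simp add: padded_def)

lemma lookup_eta_head: "k < m \<Longrightarrow> lookup (eta_comp N a lam) (Suc k) = a ! k"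
  using len by (simp add: eta_comp_def nth_default_def nth_append)

lemma lookup_eta_tail: "k < N - m \<Longrightarrow> lookup (eta_comp N a lam) (Suc (m + k)) = rev (padded (N - m) lam) ! k"
  using len by (simp add: eta_comp_def nth_default_def nth_append length_padded)

lemma eta_compositions: "eta_comp N a lam \<in> compositions N"
proof -
  have "lookup (eta_comp N a lam) j = 0" if "j \<notin> {1..N}" for j
    using that len m_le_N length_padded by (cases j) (auto simp: eta_comp_def nth_default_def)
  then show ?thesis by (simp add: in_compositions_iff)
qed

lemma sorted_rev_padded: "sorted (rev (padded (N - m) lam))"
  using part by (simp add: padded_def is_partition_def sorted_wrt_append sorted_wrt_rev sorted_replicate)

lemma eta_tail_mono:
  assumes "i \<in> {Suc m..N}" "j \<in> {Suc m..N}" "i < j"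
  shows "lookup (eta_comp N a lam) i \<le> lookup (eta_comp N a lam) j"
proof -
  obtain k where k: "i = Suc (m + k)" using assms(1) less_imp_Suc_add[of m i] by auto
  obtain l where l: "j = Suc (m + l)" using assms(2) less_imp_Suc_add[of m j] by auto
  show ?thesis
    using assms sorted_nth_mono[OF sorted_rev_padded, of k l] length_padded
    by (simp add: k l lookup_eta_tail)
qed

lemma sum_eta_head: "(\<Sum>k\<in>{1..m}. lookup (eta_comp N a lam) k) = sum_list a"
proof -
  have "(\<Sum>k\<in>{1..m}. lookup (eta_comp N a lam) k) = (\<Sum>k\<in>{0..<m}. lookup (eta_comp N a lam) (Suc k))"
    by (rule sum.reindex_bij_witness[of _ Suc "\<lambda>k. k - 1"]) auto
  also have "\<dots> = (\<Sum>k\<in>{0..<m}. a ! k)"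
    by (intro sum.cong) (simp_all add: lookup_eta_head)
  finally show ?thesis
    using len by (simp add: sum_list_sum_nth)
qed

lemma card_asc_pairs_head: "card (asc_pairs (eta_comp N a lam) 1 m 1 m) = inversions a"
proof -
  let ?S = "{(i, j). i < j \<and> j < length a \<and> a ! i < a ! j}"
  have "asc_pairs (eta_comp N a lam) 1 m 1 m = map_prod Suc Suc ` ?S"
  proof (rule set_eqI)
    fix z :: "nat \<times> nat"
    obtain i j where z: "z = (i, j)" by fastforce
    show "z \<in> asc_pairs (eta_comp N a lam) 1 m 1 m \<longleftrightarrow> z \<in> map_prod Suc Suc ` ?S"
    proof (cases "i = 0 \<or> j = 0")
      case True
      then show ?thesis by (auto simp: z asc_pairs_def)
    next
      case False
      then obtain k l where kl: "i = Suc k" "j = Suc l" by (cases i; cases j) auto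
      have "(Suc k, Suc l) \<in> map_prod Suc Suc ` ?S \<longleftrightarrow> (k, l) \<in> ?S" by auto
      then show ?thesis
        using lookup_eta_head len unfolding z kl asc_pairs_def by auto
    qed
  qed
  moreover have "inj (map_prod Suc Suc)" by (simp add: prod.inj_map)
  ultimately show ?thesis
    unfolding inversions_def by (simp add: card_image inj_on_subset)
qed

lemma ties_eta_tail:
  "ties (eta_comp N a lam) (Suc m) N = (\<Sum>v\<in>set (padded (N - m) lam). count_list (padded (N - m) lam) v choose 2)"
proof -
  let ?xs = "padded (N - m) lam" and ?\<eta> = "eta_comp N a lam"
  define A where "A = (\<lambda>v. {i \<in> {Suc m..N}. lookup ?\<eta> i = v})"
  have val: "lookup ?\<eta> i \<in> set ?xs" if i: "i \<in> {Suc m..N}" for i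
  proof -
    obtain k where k: "i = Suc (m + k)" using i less_imp_Suc_add[of m i] by auto
    then have "k < N - m" using i by simp
    then show ?thesis
      using k length_padded nth_mem[of k "rev ?xs"] by (simp add: lookup_eta_tail)
  qed
  have cardA: "card (A v) = count_list ?xs v" for v
  proof -
    have "A v = (\<lambda>k. Suc (m + k)) ` {k. k < length (rev ?xs) \<and> rev ?xs ! k = v}"
    proof (rule set_eqI)
      fix i
      show "i \<in> A v \<longleftrightarrow> i \<in> (\<lambda>k. Suc (m + k)) ` {k. k < length (rev ?xs) \<and> rev ?xs ! k = v}"
      proof (cases "m < i")
        case True
        then obtain k where k: "i = Suc (m + k)" using less_imp_Suc_add[OF True] by auto
        then show ?thesis
          using lookup_eta_tail[of k] m_le_N by (auto simp: A_def length_padded)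
      qed (auto simp: A_def)
    qed
    then have "card (A v) = card {k. k < length (rev ?xs) \<and> rev ?xs ! k = v}"
      by (simp add: card_image inj_on_def)
    also have "\<dots> = length (filter (\<lambda>x. x = v) (rev ?xs))"
      by (rule length_filter_conv_card[symmetric])
    also have "\<dots> = count_list ?xs v"
    proof -
      have "(\<lambda>x. x = v) = (=) v" by auto
      then show ?thesis by (simp add: count_list_eq_length_filter flip: rev_filter)
    qed
    finally show ?thesis .
  qed
  have "{(i, j). i < j \<and> i \<in> {Suc m..N} \<and> j \<in> {Suc m..N} \<and> lookup ?\<eta> i = lookup ?\<eta> j} =
      (\<Union>v\<in>set ?xs. {(i, j). i < j \<and> i \<in> A v \<and> j \<in> A v})"
    using val by (auto simp: A_def)
  then have "ties ?\<eta> (Suc m) N = card (\<Union>v\<in>set ?xs. {(i, j). i < j \<and> i \<in> A v \<and> j \<in> A v})"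
    by (simp add: ties_def)
  also have "\<dots> = (\<Sum>v\<in>set ?xs. card {(i, j). i < j \<and> i \<in> A v \<and> j \<in> A v})"
  proof (rule card_UN_disjoint)
    show "\<forall>v\<in>set ?xs. finite {(i, j). i < j \<and> i \<in> A v \<and> j \<in> A v}"
    proof
      fix v
      have "finite (A v \<times> A v)" by (simp add: A_def)
      then show "finite {(i, j). i < j \<and> i \<in> A v \<and> j \<in> A v}"
        by (rule rev_finite_subset) auto
    qed
  qed (auto simp: A_def)
  also have "\<dots> = (\<Sum>v\<in>set ?xs. count_list ?xs v choose 2)"
  proof (rule sum.cong[OF refl])
    fix v
    have "finite (A v)" by (simp add: A_def)
    then show "card {(i, j). i < j \<and> i \<in> A v \<and> j \<in> A v} = count_list ?xs v choose 2"
      by (simp only: card_pairs cardA)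
  qed
  finally show ?thesis .
qed

text \<open>The exponent \<open>e\<close> caused by the tail is exactly the one by which barring
  changes the normalization. It cancels, and \<open>N\<close> disappears from the constant.\<close>

lemma mbar_m_macdonald:
  assumes "is_nonsym_E N (eta_comp N a lam) p"
  defines "P \<equiv> cc (inverse (u_norm N m lam)) * Sym (Suc m) N p"
  shows "mbar P = cc (inverse (qq ^ sum_list a) * tt powi (int (m choose 2) - int (inversions a))) *
    subst (revp 1 m) (\<lambda>i. of_bool (i \<in> {1..m})) (TI_revp 1 m P)"
proof -
  let ?G = "Sym (Suc m) N p" and ?u = "u_norm N m lam" and ?\<eta> = "eta_comp N a lam"
  let ?R = "\<lambda>p. subst (revp 1 m) (\<lambda>i. of_bool (i \<in> {1..m})) (TI_revp 1 m p)"
  define e where "e = int (ties ?\<eta> (Suc m) N) - 2 * int ((N - m) choose 2)"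
  define f where "f = int (m choose 2) - int (inversions a)"
  have bu: "inverse (bar_coef ?u) = tt powi - e * inverse ?u"
    unfolding bar_u_norm e_def ties_eta_tail inverse_mult_distrib power_int_minus ..
  have ef: "int (m choose 2) - int (inversions a) + int (ties ?\<eta> (Suc m) N) - 2 * int ((N - m) choose 2) = f + e"
    by (simp add: e_def f_def)
  have "mbar ?G = cc (inverse (qq ^ sum_list a) * tt powi (f + e)) * ?R ?G"
    using mbar_Sym_E[OF m_le_N eta_compositions assms(1) eta_tail_mono]
    unfolding sum_eta_head card_asc_pairs_head ef .
  then have "mbar P = cc (tt powi - e * inverse ?u * (inverse (qq ^ sum_list a) * tt powi (f + e))) * ?R ?G"
    by (simp add: P_def mbar_mult bu cc_simps mult.assoc)
  also have "tt powi - e * inverse ?u * (inverse (qq ^ sum_list a) * tt powi (f + e)) =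
      inverse (qq ^ sum_list a) * tt powi f * inverse ?u"
  proof -
    have "tt powi - e * tt powi (f + e) = tt powi f" by (simp flip: power_int_add)
    then show ?thesis by (simp add: mult_ac)
  qed
  also have "cc (inverse (qq ^ sum_list a) * tt powi f * inverse ?u) * ?R ?G =
      cc (inverse (qq ^ sum_list a) * tt powi f) * ?R P"
    by (simp add: P_def linop_cc[OF linop_TI_revp] subst_mult cc_simps mult.assoc)
  finally show ?thesis by (simp add: f_def)
qed

end

section \<open>Operators on series\<close>

text \<open>
  The operators act on the coefficients of finite sets of monomials separately, which reduces
  statements on series to statements on polynomials.
\<close>

definition strip :: "nat \<Rightarrow> mono \<Rightarrow> mono set" where
  "strip i \<mu> = {\<nu>. (\<forall>j. j \<noteq> i \<and> j \<noteq> Suc i \<longrightarrow> lookup \<nu> j = lookup \<mu> j) \<and>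
     lookup \<nu> i + lookup \<nu> (Suc i) = lookup \<mu> i + lookup \<mu> (Suc i)}"

definition poly_on :: "mono set \<Rightarrow> series \<Rightarrow> mpol" where
  "poly_on S f = Abs_poly_mapping (\<lambda>\<nu>. if \<nu> \<in> S then f \<nu> else 0)"

lemma lookup_poly_on: "finite S \<Longrightarrow> lookup (poly_on S f) \<nu> = (if \<nu> \<in> S then f \<nu> else 0)"
  unfolding poly_on_def by (subst lookup_Abs_poly_mapping) (auto intro: rev_finite_subset)

lemma finite_bounded_monos:
  assumes "finite A"
  shows "finite {\<nu>::mono. keys \<nu> \<subseteq> A \<and> (\<forall>j. lookup \<nu> j \<le> n)}"
proof -
  have "lookup ` {\<nu>::mono. keys \<nu> \<subseteq> A \<and> (\<forall>j. lookup \<nu> j \<le> n)} \<subseteq>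
      {f. \<forall>j. (j \<in> A \<longrightarrow> f j \<in> {..n}) \<and> (j \<notin> A \<longrightarrow> f j = 0)}"
    by (auto simp: in_keys_iff)
  moreover have "finite {f. \<forall>j. (j \<in> A \<longrightarrow> f j \<in> {..n}) \<and> (j \<notin> A \<longrightarrow> f j = (0::nat))}"
    using assms by (intro finite_set_of_finite_funs) simp_all
  ultimately have "finite (lookup ` {\<nu>::mono. keys \<nu> \<subseteq> A \<and> (\<forall>j. lookup \<nu> j \<le> n)})"
    by (rule finite_subset)
  then show ?thesis
    by (rule finite_imageD) (simp add: inj_on_def poly_mapping_eqI)
qed

text \<open>Finite, and containing with a monomial its strips at all \<open>i < M\<close>, so one
  truncation serves a whole word of operators.\<close>

definition window :: "nat \<Rightarrow> mono \<Rightarrow> mono set" where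
  "window M \<mu> = {\<nu>. (\<forall>j>M. lookup \<nu> j = lookup \<mu> j) \<and> (\<Sum>j\<le>M. lookup \<nu> j) = (\<Sum>j\<le>M. lookup \<mu> j)}"

lemma finite_window: "finite (window M \<mu>)"
proof (rule finite_subset[OF _ finite_bounded_monos])
  define n where "n = (\<Sum>j\<le>M. lookup \<mu> j) + (\<Sum>j\<in>keys \<mu>. lookup \<mu> j)"
  show "window M \<mu> \<subseteq> {\<nu>. keys \<nu> \<subseteq> {..M} \<union> keys \<mu> \<and> (\<forall>j. lookup \<nu> j \<le> n)}"
  proof
    fix \<nu> assume \<nu>: "\<nu> \<in> window M \<mu>"
    have "lookup \<nu> j \<le> n" for j
    proof (cases "j \<le> M")
      case True
      then have "lookup \<nu> j \<le> (\<Sum>j\<le>M. lookup \<nu> j)" by (intro member_le_sum) auto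
      then show ?thesis using \<nu> by (simp add: window_def n_def)
    next
      case False
      have "lookup \<mu> j \<le> (\<Sum>j\<in>keys \<mu>. lookup \<mu> j)"
        by (cases "j \<in> keys \<mu>") (auto intro: member_le_sum simp: in_keys_iff)
      then show ?thesis using \<nu> False by (simp add: window_def n_def)
    qed
    moreover have "keys \<nu> \<subseteq> {..M} \<union> keys \<mu>"
    proof
      fix j assume "j \<in> keys \<nu>"
      then show "j \<in> {..M} \<union> keys \<mu>"
        using \<nu> by (cases "j \<le> M") (auto simp: window_def in_keys_iff)
    qed
    ultimately show "\<nu> \<in> {\<nu>. keys \<nu> \<subseteq> {..M} \<union> keys \<mu> \<and> (\<forall>j. lookup \<nu> j \<le> n)}" by simp
  qed
qed simp

lemma strip_refl [simp]: "\<mu> \<in> strip i \<mu>"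
  by (simp add: strip_def)

lemma strip_eq: "\<nu> \<in> strip i \<mu> \<Longrightarrow> strip i \<nu> = strip i \<mu>"
  by (auto simp: strip_def)

lemma sum_two_eq:
  fixes f g :: "nat \<Rightarrow> nat"
  assumes "Suc i \<le> M" "\<And>j. j \<noteq> i \<Longrightarrow> j \<noteq> Suc i \<Longrightarrow> f j = g j" "f i + f (Suc i) = g i + g (Suc i)"
  shows "(\<Sum>j\<le>M. f j) = (\<Sum>j\<le>M. g j)"
proof -
  have split: "(\<Sum>j\<le>M. h j) = (\<Sum>j\<in>{..M} - {i, Suc i}. h j) + (h i + h (Suc i))" for h :: "nat \<Rightarrow> nat"
    using sum.subset_diff[of "{i, Suc i}" "{..M}" h] assms(1) by simp
  have "(\<Sum>j\<in>{..M} - {i, Suc i}. f j) = (\<Sum>j\<in>{..M} - {i, Suc i}. g j)"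
    using assms(2) by (intro sum.cong) auto
  then show ?thesis unfolding split[of f] split[of g] using assms(3) by simp
qed

lemma strip_subset_window: "Suc i \<le> M \<Longrightarrow> strip i \<mu> \<subseteq> window M \<mu>"
proof
  fix \<nu> assume i: "Suc i \<le> M" and \<nu>: "\<nu> \<in> strip i \<mu>"
  have "(\<Sum>j\<le>M. lookup \<nu> j) = (\<Sum>j\<le>M. lookup \<mu> j)"
    by (rule sum_two_eq[OF i]) (use \<nu> in \<open>simp_all add: strip_def\<close>)
  then show "\<nu> \<in> window M \<mu>"
    using i \<nu> by (simp add: window_def strip_def)
qed

lemma window_eq: "\<nu> \<in> window M \<mu> \<Longrightarrow> window M \<nu> = window M \<mu>"
  by (auto simp: window_def)

lemma finite_strip: "finite (strip i \<mu>)"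
  using finite_subset[OF strip_subset_window[OF order_refl] finite_window] .

lemma swap_mono_strip: "swap_mono i (Suc i) \<mu> \<in> strip i \<mu>"
  by (simp add: strip_def lookup_swap_mono transpose_apply_other)

text \<open>\<open>div_diff\<close> is a definite description over all series. A quotient is glued
  from those of the truncations to strips, and the injectivity of multiplication by
  \<open>x_i - x_(i+1)\<close> identifies it.\<close>

lemma T_op_eq_strip: "T_op i f \<mu> = lookup (Tm i (poly_on (strip i \<mu>) f)) \<mu>"
proof -
  define p where "p = (\<lambda>\<mu>. poly_on (strip i \<mu>) f)"
  \<comment> \<open>The coefficient of the quotient at \<open>\<mu>\<close> enters its product with
    \<open>x_i\<close> at \<open>\<mu> + single i 1\<close>, so the strip of that monomial decides;
    the product with \<open>x_(i+1)\<close> leads to the same strip.\<close>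
  define g where "g = (\<lambda>\<mu>. lookup (dd i (Suc i) (p (\<mu> + single i 1))) \<mu>)"
  have lp: "lookup (p \<mu>) \<nu> = (if \<nu> \<in> strip i \<mu> then f \<nu> else 0)" for \<mu> \<nu>
    unfolding p_def by (rule lookup_poly_on[OF finite_strip])
  have 1: "mult_var i g \<mu> = mult_var i (lookup (dd i (Suc i) (p \<mu>))) \<mu>" for \<mu>
  proof (cases "lookup \<mu> i = 0")
    case False
    then have "\<mu> - single i 1 + single i 1 = \<mu>"
      by (intro poly_mapping_eqI) (auto simp: lookup_add lookup_minus lookup_single when_def)
    then show ?thesis by (simp add: mult_var_def g_def)
  qed (simp add: mult_var_def)
  have 2: "mult_var (Suc i) g \<mu> = mult_var (Suc i) (lookup (dd i (Suc i) (p \<mu>))) \<mu>" for \<mu>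
  proof (cases "lookup \<mu> (Suc i) = 0")
    case False
    have "\<mu> - single (Suc i) 1 + single i 1 \<in> strip i \<mu>"
      using False by (auto simp: strip_def lookup_add lookup_minus lookup_single when_def)
    then have "strip i (\<mu> - single (Suc i) 1 + single i 1) = strip i \<mu>" by (rule strip_eq)
    then show ?thesis by (simp add: mult_var_def g_def p_def)
  qed (simp add: mult_var_def)
  have dd: "div_diff i (\<lambda>\<mu>. K_op i (Suc i) f \<mu> - f \<mu>) = g"
  proof (rule div_diff_eqI)
    fix \<mu>
    have "lookup ((xx i - xx (Suc i)) * dd i (Suc i) (p \<mu>)) \<mu> = lookup (KK i (Suc i) (p \<mu>) - p \<mu>) \<mu>"
      by (simp add: dd_eq)
    then have "mult_var i g \<mu> - mult_var (Suc i) g \<mu> = lookup (p \<mu>) (swap_mono i (Suc i) \<mu>) - lookup (p \<mu>) \<mu>"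
      by (simp add: 1 2 left_diff_distrib lookup_minus lookup_xx_mult lookup_KK K_op_def)
    then show "mult_var i g \<mu> - mult_var (Suc i) g \<mu> = K_op i (Suc i) f \<mu> - f \<mu>"
      by (simp add: lp swap_mono_strip K_op_def)
  qed
  have "lookup (Tm i (p \<mu>)) \<mu> = tt * lookup (p \<mu>) \<mu> + (tt * mult_var i g \<mu> - mult_var (Suc i) g \<mu>)"
    by (simp add: TT_def lookup_add left_diff_distrib lookup_minus lookup_xx_mult mult.assoc 1 2)
  moreover have "lookup (p \<mu>) \<mu> = f \<mu>"
    by (simp add: lp)
  ultimately show ?thesis
    by (simp add: T_op_def dd Let_def p_def)
qed

section \<open>Sets of monomials on which the operators act\<close>

definition closed_at :: "nat \<Rightarrow> mono set \<Rightarrow> bool" where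
  "closed_at i S \<longleftrightarrow> (\<forall>\<mu>\<in>S. strip i \<mu> \<subseteq> S)"

definition agree :: "mono set \<Rightarrow> series \<Rightarrow> series \<Rightarrow> bool" where
  "agree S f g \<longleftrightarrow> (\<forall>\<mu>\<in>S. f \<mu> = g \<mu>)"

lemma agree_T_op:
  assumes "closed_at i S" "agree S f g"
  shows "agree S (T_op i f) (T_op i g)"
  unfolding agree_def
proof
  fix \<mu> assume "\<mu> \<in> S"
  then have "poly_on (strip i \<mu>) f = poly_on (strip i \<mu>) g"
    using assms by (intro poly_mapping_eqI) (auto simp: lookup_poly_on finite_strip closed_at_def agree_def)
  then show "T_op i f \<mu> = T_op i g \<mu>" by (simp add: T_op_eq_strip)
qed

lemma agree_T_op_poly:
  "closed_at i S \<Longrightarrow> agree S f (lookup p) \<Longrightarrow> agree S (T_op i f) (lookup (Tm i p))"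
  using agree_T_op[of i S f "lookup p"] by (simp add: T_op_lookup)

definition Tinv_op :: "nat \<Rightarrow> series \<Rightarrow> series" where
  "Tinv_op i f = (\<lambda>\<mu>. inverse tt * (T_op i f \<mu> + (1 - tt) * f \<mu>))"

lemma agree_Tinv_op_poly:
  "closed_at i S \<Longrightarrow> agree S f (lookup p) \<Longrightarrow> agree S (Tinv_op i f) (lookup (Ti i p))"
  using agree_T_op_poly[of i S f p] by (simp add: agree_def Tinv_op_def TI_def lookup_add)

lemma agree_poly_on: "finite S \<Longrightarrow> agree S f (lookup (poly_on S f))"
  by (simp add: agree_def lookup_poly_on)

lemma closed_at_window: "Suc i \<le> M \<Longrightarrow> closed_at i (window M \<mu>)"
  unfolding closed_at_def using strip_subset_window window_eq by blast

lemma mem_window [simp]: "\<mu> \<in> window M \<mu>"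
  by (simp add: window_def)

text \<open>Read off on a finite window from the polynomial case. Thus \<open>T_op i\<close> is
  bijective on all series, and the \<open>inv\<close> in the definitions is a genuine
  inverse.\<close>

lemma T_op_Tinv_op [simp]: "T_op i (Tinv_op i f) = f" "Tinv_op i (T_op i f) = f"
proof -
  have "T_op i (Tinv_op i f) \<mu> = f \<mu> \<and> Tinv_op i (T_op i f) \<mu> = f \<mu>" for \<mu>
  proof -
    let ?S = "window (Suc i) \<mu>"
    let ?p = "poly_on ?S f"
    have c: "closed_at i ?S" by (rule closed_at_window) simp
    have a: "agree ?S f (lookup ?p)" by (rule agree_poly_on[OF finite_window])
    have "agree ?S (T_op i (Tinv_op i f)) (lookup (Tm i (Ti i ?p)))"
      "agree ?S (Tinv_op i (T_op i f)) (lookup (Ti i (Tm i ?p)))"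
      by (intro agree_T_op_poly agree_Tinv_op_poly c a)+
    then show ?thesis using a by (simp add: agree_def)
  qed
  then show "T_op i (Tinv_op i f) = f" "Tinv_op i (T_op i f) = f" by auto
qed

lemma inv_T_op: "inv (T_op i) = Tinv_op i"
  by (rule inv_unique_comp) (simp_all add: fun_eq_iff)

lemma Tinv_op_lookup: "Tinv_op i (lookup p) = lookup (Ti i p)"
  by (simp add: fun_eq_iff Tinv_op_def T_op_lookup TI_def lookup_add)

interpretation Top: braid_action T_op
proof
  fix i j f
  assume ij: "1 < \<bar>int i - int j\<bar>"
  show "T_op i (T_op j f) = T_op j (T_op i f)"
  proof
    fix \<mu>
    let ?S = "window (Suc (max i j)) \<mu>"
    let ?p = "poly_on ?S f"
    have c: "closed_at i ?S" "closed_at j ?S" by (rule closed_at_window, simp)+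
    have a: "agree ?S f (lookup ?p)" by (rule agree_poly_on[OF finite_window])
    have "agree ?S (T_op i (T_op j f)) (lookup (Tm i (Tm j ?p)))"
      "agree ?S (T_op j (T_op i f)) (lookup (Tm j (Tm i ?p)))"
      by (intro agree_T_op_poly c a)+
    then show "T_op i (T_op j f) \<mu> = T_op j (T_op i f) \<mu>"
      using Tm.far[OF ij, of ?p] by (simp add: agree_def)
  qed
next
  fix i f
  show "T_op i (T_op (Suc i) (T_op i f)) = T_op (Suc i) (T_op i (T_op (Suc i) f))"
  proof
    fix \<mu>
    let ?S = "window (Suc (Suc i)) \<mu>"
    let ?p = "poly_on ?S f"
    have c: "closed_at i ?S" "closed_at (Suc i) ?S" by (rule closed_at_window, simp)+
    have a: "agree ?S f (lookup ?p)" by (rule agree_poly_on[OF finite_window])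
    have "agree ?S (T_op i (T_op (Suc i) (T_op i f))) (lookup (Tm i (Tm (Suc i) (Tm i ?p))))"
      "agree ?S (T_op (Suc i) (T_op i (T_op (Suc i) f))) (lookup (Tm (Suc i) (Tm i (Tm (Suc i) ?p))))"
      by (intro agree_T_op_poly c a)+
    then show "T_op i (T_op (Suc i) (T_op i f)) \<mu> = T_op (Suc i) (T_op i (T_op (Suc i) f)) \<mu>"
      using Tm.braid[of i ?p] by (simp add: agree_def)
  qed
qed

section \<open>Permutation operators on series\<close>

lemma T_perm_eq: "T_perm \<sigma> = Top.perm_act \<sigma>"
  by (simp add: T_perm_def Top.perm_act_def word_act_def)

lemma word_act_T_op_lookup: "word_act T_op ws (lookup p) = lookup (word_act Tm ws p)"
  by (induction ws) (simp_all add: T_op_lookup)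

lemma T_perm_lookup: "T_perm \<sigma> (lookup p) = lookup (Tm.perm_act \<sigma> p)"
  by (simp add: T_perm_eq Top.perm_act_def Tm.perm_act_def word_act_T_op_lookup)

lemma agree_word_act_Tinv_op:
  assumes "\<And>i. i \<in> set ws \<Longrightarrow> closed_at i S" "agree S f (lookup p)"
  shows "agree S (word_act Tinv_op ws f) (lookup (word_act Ti ws p))"
  using assms by (induction ws) (auto intro: agree_Tinv_op_poly)

text \<open>\<open>S\<close> is closed only under the letters below \<open>m\<close>. By Matsumoto's
  theorem the arbitrarily chosen reduced word may be replaced, on series and on polynomials alike,
  by one with such letters.\<close>

lemma agree_inv_T_perm_longest:
  assumes "\<And>i. i \<in> {1..<m} \<Longrightarrow> closed_at i S" "agree S f (lookup p)"
  shows "agree S (inv (T_perm (longest_perm m)) f) (lookup (TI_revp 1 m p))"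
proof -
  obtain ws where ws: "set ws \<subseteq> {1..<m}" "Top.perm_act (revp 1 m) = word_act T_op ws"
    "length ws = ninv (revp 1 m)" "word_perm ws = revp 1 m"
    using Top.perm_act_in_range[OF revp_permutes] .
  have "word_act T_op vs (word_act Tinv_op (rev vs) h) = h" "word_act Tinv_op (rev vs) (word_act T_op vs h) = h" for vs h
    by (induction vs arbitrary: h) simp_all
  then have "inv (T_perm (longest_perm m)) = word_act Tinv_op (rev ws)"
    unfolding longest_perm_eq_revp T_perm_eq ws(2) by (intro inv_unique_comp) (simp_all add: fun_eq_iff)
  moreover have "TI_revp 1 m p = word_act Ti (rev ws) p"
  proof (rule TI_revp_eqI)
    have "TT_revp 1 m = word_act Tm ws"
      using Tm.perm_act_word[of ws] ws(3,4) by simp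
    then show "TT_revp 1 m (word_act Ti (rev ws) p) = p" by simp
  qed
  moreover have "agree S (word_act Tinv_op (rev ws) f) (lookup (word_act Ti (rev ws) p))"
    by (rule agree_word_act_Tinv_op) (use assms ws(1) in auto)
  ultimately show ?thesis by simp
qed

lemma compose_K_op: "compose_list (map (\<lambda>i. K_op i (Suc i)) ws) f = (\<lambda>\<mu>. f (permute_mono (word_perm ws) \<mu>))"
proof (induction ws)
  case (Cons i ws)
  show ?case
  proof
    fix \<mu>
    have "compose_list (map (\<lambda>i. K_op i (Suc i)) (i # ws)) f \<mu> = f (permute_mono (word_perm ws) (swap_mono i (Suc i) \<mu>))"
      by (simp add: Cons.IH K_op_def)
    also have "permute_mono (word_perm ws) (swap_mono i (Suc i) \<mu>) = permute_mono (word_perm (i # ws)) \<mu>"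
      unfolding word_perm_simps by (rule permute_mono_comp) (simp_all add: bij_is_inj)
    finally show "compose_list (map (\<lambda>i. K_op i (Suc i)) (i # ws)) f \<mu> = f (permute_mono (word_perm (i # ws)) \<mu>)" .
  qed
qed (simp add: fun_eq_iff)

lemma K_perm_longest: "K_perm (longest_perm m) f = (\<lambda>\<mu>. f (permute_mono (longest_perm m) \<mu>))"
  unfolding K_perm_def compose_K_op longest_perm_eq_revp
  by (simp add: some_reduced_word)

lemma compose_tau_op:
  "compose_list (map tau_op [1..<Suc m]) f = (\<lambda>\<mu>. qq ^ (\<Sum>j\<in>{1..m}. lookup \<mu> j) * f \<mu>)"
proof (induction m arbitrary: f)
  case (Suc m)
  have "compose_list (map tau_op [1..<Suc (Suc m)]) f = compose_list (map tau_op [1..<Suc m]) (tau_op (Suc m) f)"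
    by simp
  also have "\<dots> = (\<lambda>\<mu>. qq ^ (\<Sum>j\<in>{1..m}. lookup \<mu> j) * tau_op (Suc m) f \<mu>)"
    by (rule Suc.IH)
  also have "\<dots> = (\<lambda>\<mu>. qq ^ (\<Sum>j\<in>{1..Suc m}. lookup \<mu> j) * f \<mu>)"
    by (simp add: fun_eq_iff tau_op_def power_add mult_ac)
  finally show ?case .
qed simp

section \<open>Cherednik operators on series and the definite description\<close>

lemma omega_op_lookup: "omega_op N (lookup p) = lookup (om N p)"
proof
  fix \<mu>
  have "omega_op N (lookup p) \<mu> = lookup (tau 1 p) (permute_mono (cyc N) \<mu>)"
    by (simp add: omega_op_def compose_K_op tau_op_lookup[of 1, unfolded One_nat_def] cyc_def)
  also have "\<dots> = lookup (om N p) \<mu>"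
    by (simp add: om_def lookup_subst)
  finally show "omega_op N (lookup p) \<mu> = lookup (om N p) \<mu>" .
qed

lemma scale_lookup: "scale c (lookup p) = lookup (cc c * p)"
  by (simp add: scale_def fun_eq_iff)

lemma Y_op_lookup: "Y_op N i (lookup p) = lookup (YY N i p)"
proof -
  have 1: "compose_list (map (\<lambda>j. inv (T_op j)) ws) (lookup r) = lookup (word_act Ti ws r)" for ws r
    by (induction ws) (simp_all add: inv_T_op Tinv_op_lookup)
  have 2: "compose_list (map T_op ws) (lookup r) = lookup (word_act Tm ws r)" for ws r
    using word_act_T_op_lookup by (simp add: word_act_def)
  show ?thesis
    unfolding Y_op_def YY_def comp_apply 1 omega_op_lookup 2 scale_lookup ..
qed

text \<open>Any competitor has finite support, hence is a polynomial and a joint eigenvector with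
  coefficient \<open>1\<close> at \<open>\<eta>\<close>; such an eigenvector is unique.\<close>

lemma nonsym_macdonald_eq:
  assumes \<eta>: "\<eta> \<in> compositions N" and E: "is_nonsym_E N \<eta> p"
  shows "nonsym_macdonald N \<eta> = lookup p"
  unfolding nonsym_macdonald_def
proof (rule the_equality)
  have p: "joint_eigen N \<eta> p" "lookup p \<eta> = 1" using E by (simp_all add: is_nonsym_E_def)
  have Y: "Y_op N i (lookup r) = scale (qq ^ lookup \<eta> i * tt powi (1 - int (comp_rank N \<eta> i))) (lookup r) \<longleftrightarrow>
      YY N i r = cc (eig N \<eta> i) * r" for i r
    unfolding Y_op_lookup scale_lookup eig_def by (simp add: lookup_inject)
  show "finite {\<nu>. lookup p \<nu> \<noteq> 0} \<and> lookup p \<eta> = 1 \<and>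
      (\<forall>\<nu>. \<nu> \<noteq> \<eta> \<and> lookup p \<nu> \<noteq> 0 \<longrightarrow> \<nu> \<in> compositions N \<and> comp_less N \<nu> \<eta>) \<and>
      (\<forall>i\<in>{1..N}. Y_op N i (lookup p) = scale (qq ^ lookup \<eta> i * tt powi (1 - int (comp_rank N \<eta> i))) (lookup p))"
    unfolding Y using p joint_eigen_support[OF p(1) \<eta>] by (auto simp: joint_eigen_def in_keys_iff)
  fix E
  assume *: "finite {\<nu>. E \<nu> \<noteq> 0} \<and> E \<eta> = 1 \<and>
      (\<forall>\<nu>. \<nu> \<noteq> \<eta> \<and> E \<nu> \<noteq> 0 \<longrightarrow> \<nu> \<in> compositions N \<and> comp_less N \<nu> \<eta>) \<and>
      (\<forall>i\<in>{1..N}. Y_op N i E = scale (qq ^ lookup \<eta> i * tt powi (1 - int (comp_rank N \<eta> i))) E)"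
  define r where "r = Abs_poly_mapping E"
  have r: "lookup r = E" using * by (simp add: r_def)
  have "keys r \<subseteq> compositions N"
  proof
    fix \<nu> assume "\<nu> \<in> keys r"
    then show "\<nu> \<in> compositions N"
      using * \<eta> by (cases "\<nu> = \<eta>") (auto simp: in_keys_iff r)
  qed
  then have "joint_eigen N \<eta> r"
    unfolding joint_eigen_def using * unfolding r[symmetric] Y by blast
  from joint_eigen_multiple[OF this p(1) \<eta> p(2)] show "E = lookup p"
    using * by (simp add: r[symmetric] cc_simps)
qed

lemma m_macdonald_fin_eq:
  assumes part: "is_partition lam" and N: "length a + length lam \<le> N"
  shows "\<exists>P. m_macdonald_fin N a lam = lookup P \<and>
    mbar P = cc (inverse (qq ^ sum_list a) * tt powi (int (length a choose 2) - int (inversions a))) *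
      subst (revp 1 (length a)) (\<lambda>i. of_bool (i \<in> {1..length a})) (TI_revp 1 (length a) P)"
proof -
  let ?m = "length a" and ?\<eta> = "eta_comp N a lam"
  note ctx = refl[of "length a"] part N
  have \<eta>: "?\<eta> \<in> compositions N" by (rule eta_compositions[OF ctx])
  obtain p where p: "is_nonsym_E N ?\<eta> p" using exists_is_nonsym_E[OF \<eta>] by blast
  define P where "P = cc (inverse (u_norm N ?m lam)) * Sym (Suc ?m) N p"
  have "m_macdonald_fin N a lam = lookup P"
    using N by (simp add: fun_eq_iff m_macdonald_fin_def nonsym_macdonald_eq[OF \<eta> p] T_perm_lookup P_def Sym_def
        lookup_sum divide_inverse mult.commute)
  then show ?thesis
    using mbar_m_macdonald[OF ctx p] by (auto simp: P_def)
qed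

section \<open>The bar identity in infinitely many variables\<close>

text \<open>The number of variables in which \<open>m_macdonald\<close> reads off a
  coefficient.\<close>

definition level :: "nat \<Rightarrow> mono \<Rightarrow> nat" where
  "level m \<mu> = Max (insert m (keys \<mu>))"

text \<open>Positions up to \<open>m\<close> never exceed the \<open>m\<close> inserted into the
  maximum, so only the support beyond \<open>m\<close> matters, and operators on the first
  \<open>m\<close> variables do not change it.\<close>

lemma level_cong:
  assumes "\<And>j. m < j \<Longrightarrow> lookup \<nu> j = 0 \<longleftrightarrow> lookup \<mu> j = 0"
  shows "level m \<nu> = level m \<mu>"
proof -
  have "level m \<kappa> = Max (insert m {j \<in> keys \<kappa>. m < j})" for \<kappa>
    unfolding level_def
  proof (rule Max_eqI)
    fix j assume "j \<in> insert m (keys \<kappa>)"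
    then show "j \<le> Max (insert m {j \<in> keys \<kappa>. m < j})"
    proof (cases "m < j")
      case True
      then show ?thesis using \<open>j \<in> insert m (keys \<kappa>)\<close> by (intro Max_ge) auto
    next
      case False
      then have "j \<le> m" by simp
      also have "m \<le> Max (insert m {j \<in> keys \<kappa>. m < j})" by (intro Max_ge) auto
      finally show ?thesis .
    qed
  next
    have "Max (insert m {j \<in> keys \<kappa>. m < j}) \<in> insert m {j \<in> keys \<kappa>. m < j}" by (intro Max_in) auto
    then show "Max (insert m {j \<in> keys \<kappa>. m < j}) \<in> insert m (keys \<kappa>)" by blast
  qed simp
  moreover have "{j \<in> keys \<nu>. m < j} = {j \<in> keys \<mu>. m < j}"
  proof (rule set_eqI)
    fix j
    show "j \<in> {j \<in> keys \<nu>. m < j} \<longleftrightarrow> j \<in> {j \<in> keys \<mu>. m < j}"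
      using assms[of j] by (cases "m < j") (simp_all add: in_keys_iff del: neq0_conv)
  qed
  ultimately show ?thesis by simp
qed

lemma closed_at_level: "i \<in> {1..<m} \<Longrightarrow> closed_at i {\<mu>. level m \<mu> = N}"
  unfolding closed_at_def
proof (intro ballI subsetI)
  fix \<mu> \<nu> assume i: "i \<in> {1..<m}" and "\<mu> \<in> {\<mu>. level m \<mu> = N}" and \<nu>: "\<nu> \<in> strip i \<mu>"
  moreover have "level m \<nu> = level m \<mu>"
    by (rule level_cong) (use i \<nu> in \<open>simp add: strip_def\<close>)
  ultimately show "\<nu> \<in> {\<mu>. level m \<mu> = N}" by simp
qed

lemma m_macdonald_eq_fin: "level (length a) \<mu> = N \<Longrightarrow> m_macdonald a lam \<mu> = m_macdonald_fin N a lam \<mu>"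
  by (simp add: m_macdonald_def level_def)

lemma bij_longest_perm [simp]: "bij (longest_perm m)"
  by (simp add: longest_perm_eq_revp)

lemma sum_permute_longest:
  "(\<Sum>j\<in>{1..m}. lookup (permute_mono (longest_perm m) \<mu>) j) = (\<Sum>j\<in>{1..m}. lookup \<mu> j)"
proof -
  have "(\<Sum>j\<in>{1..m}. lookup \<mu> (longest_perm m j)) = (\<Sum>j\<in>{1..m}. lookup \<mu> j)"
    using sum.permute[OF revp_permutes, of "lookup \<mu>" 1 m] by (simp add: longest_perm_eq_revp comp_def)
  then show ?thesis
    by (simp add: lookup_permute_mono bij_is_inj)
qed

lemma bar_m_macdonald:
  fixes a lam :: "nat list"
  defines "m \<equiv> length a"
  assumes "is_partition lam"
  shows "qq ^ sum_list a * tt ^ inversions a * bar_coef (m_macdonald a lam \<mu>) =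
    tt ^ (m choose 2) * (qq ^ (\<Sum>j\<in>{1..m}. lookup \<mu> j) *
      inv (T_perm (longest_perm m)) (m_macdonald a lam) (permute_mono (longest_perm m) \<mu>))"
proof -
  define N where "N = level m \<mu>"
  define S where "S = {\<mu>. level m \<mu> = N}"
  define \<mu>' where "\<mu>' = permute_mono (longest_perm m) \<mu>"
  have "level m \<mu>' = level m \<mu>"
    unfolding \<mu>'_def
    by (rule level_cong) (simp add: lookup_permute_mono bij_is_inj, simp add: longest_perm_def)
  then have \<mu>: "\<mu> \<in> S" "\<mu>' \<in> S" by (simp_all add: S_def N_def)
  define q t e where "q = qq ^ sum_list a" and "t = tt ^ inversions a"
    and "e = (\<lambda>i. of_bool (i \<in> {1..m}) :: int)"
  obtain P where P: "m_macdonald_fin N a lam = lookup P"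
    "mbar P = cc (inverse q * tt powi (int (m choose 2) - int (inversions a))) * subst (revp 1 m) e (TI_revp 1 m P)"
  proof (cases "length a + length lam \<le> N")
    case True
    then show ?thesis
      using m_macdonald_fin_eq[OF assms(2) True] that by (auto simp: m_def q_def e_def)
  next
    \<comment> \<open>With fewer than \<open>m + length lam\<close> variables the polynomial is zero
      by definition, and the zero polynomial satisfies the same equation.\<close>
    case False
    then have "m_macdonald_fin N a lam = lookup 0"
      by (simp add: m_macdonald_fin_def fun_eq_iff)
    then show ?thesis
      by (rule that) (simp add: linop_0[OF linop_TI_revp])
  qed
  have "agree S (m_macdonald a lam) (lookup P)"
    using m_macdonald_eq_fin[of a _ N lam] P(1) by (simp add: agree_def S_def m_def)
  moreover from this have "agree S (inv (T_perm (longest_perm m)) (m_macdonald a lam)) (lookup (TI_revp 1 m P))"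
    by (intro agree_inv_T_perm_longest) (simp add: S_def closed_at_level)
  ultimately have val: "m_macdonald a lam \<mu> = lookup P \<mu>"
    "inv (T_perm (longest_perm m)) (m_macdonald a lam) \<mu>' = lookup (TI_revp 1 m P) \<mu>'"
    using \<mu> by (simp_all add: agree_def)
  have wt: "wt e \<mu>' = int (\<Sum>j\<in>{1..m}. lookup \<mu> j)"
  proof -
    have "wt e \<mu>' = (\<Sum>j\<in>{1..m} \<union> keys \<mu>'. e j * int (lookup \<mu>' j))"
      by (rule wt_eq_sum) auto
    also have "\<dots> = (\<Sum>j\<in>{1..m}. e j * int (lookup \<mu>' j))"
      by (rule sum.mono_neutral_right) (auto simp: e_def)
    also have "\<dots> = (\<Sum>j\<in>{1..m}. int (lookup \<mu>' j))"
      by (intro sum.cong) (auto simp: e_def)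
    finally show ?thesis
      using sum_permute_longest[of m \<mu>] by (simp add: \<mu>'_def flip: of_nat_sum)
  qed
  have "bar_coef (lookup P \<mu>) = lookup (mbar P) \<mu>"
    by (simp add: lookup_mbar bar_def)
  also have "\<dots> = inverse q * tt powi (int (m choose 2) - int (inversions a)) * (qq powi wt e \<mu>' * lookup (TI_revp 1 m P) \<mu>')"
    unfolding P(2) by (simp add: lookup_subst \<mu>'_def longest_perm_eq_revp)
  also have "tt powi (int (m choose 2) - int (inversions a)) = tt ^ (m choose 2) / t"
    by (simp only: power_int_diff power_int_of_nat tt_nonzero simp_thms t_def)
  finally have "q * t * bar_coef (lookup P \<mu>) =
      q * t * (inverse q * (tt ^ (m choose 2) / t) * (qq powi wt e \<mu>' * lookup (TI_revp 1 m P) \<mu>'))"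
    by simp
  also have "\<dots> = tt ^ (m choose 2) * (qq powi wt e \<mu>' * lookup (TI_revp 1 m P) \<mu>')"
    by (simp add: q_def t_def field_simps)
  finally have "q * t * bar_coef (lookup P \<mu>) =
      tt ^ (m choose 2) * (qq ^ (\<Sum>j\<in>{1..m}. lookup \<mu> j) * lookup (TI_revp 1 m P) \<mu>')"
    unfolding wt power_int_of_nat .
  then show ?thesis
    by (simp only: q_def t_def val \<mu>'_def[symmetric])
qed

theorem proposition11:
  fixes m :: nat and a lam :: "nat list"
  assumes "length a = m" and "is_partition lam"
  shows "scale (qq ^ sum_list a * tt ^ inversions a) (bar (m_macdonald a lam)) =
           scale (tt ^ (m choose 2))
             (compose_list (map tau_op [1..<Suc m])
               (K_perm (longest_perm m) (inv (T_perm (longest_perm m)) (m_macdonald a lam))))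
       \<and> scale (qq ^ sum_list a * tt ^ inversions a) (subst_rev m (bar (m_macdonald a lam))) =
           scale (tt ^ (m choose 2)) (inv (T_perm (longest_perm m)) (m_macdonald a lam))"
proof
  let ?G = "inv (T_perm (longest_perm m)) (m_macdonald a lam)"
  let ?s = "\<lambda>\<mu>. \<Sum>j\<in>{1..m}. lookup \<mu> j" and ?r = "permute_mono (longest_perm m)"
  note id = bar_m_macdonald[OF assms(2), of a, unfolded assms(1)]
  show "scale (qq ^ sum_list a * tt ^ inversions a) (bar (m_macdonald a lam)) =
      scale (tt ^ (m choose 2)) (compose_list (map tau_op [1..<Suc m]) (K_perm (longest_perm m) ?G))"
    unfolding compose_tau_op K_perm_longest by (simp only: scale_def bar_def fun_eq_iff id simp_thms)
  show "scale (qq ^ sum_list a * tt ^ inversions a) (subst_rev m (bar (m_macdonald a lam))) =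
      scale (tt ^ (m choose 2)) ?G"
  proof
    fix \<mu>
    \<comment> \<open>The second form is the first one read at the reversed monomial: the reversal
      is an involution that preserves the degree in the first \<open>m\<close> variables, so the
      powers of \<open>q\<close> cancel.\<close>
    have rr: "?r (?r \<mu>) = \<mu>"
      using permute_mono_inv(1)[of "longest_perm m" \<mu>] by (simp add: longest_perm_eq_revp)
    have "scale (qq ^ sum_list a * tt ^ inversions a) (subst_rev m (bar (m_macdonald a lam))) \<mu> =
        inverse qq ^ ?s \<mu> * (qq ^ sum_list a * tt ^ inversions a * bar_coef (m_macdonald a lam (?r \<mu>)))"
      by (simp add: scale_def subst_rev_def bar_def mult_ac)
    also have "\<dots> = inverse qq ^ ?s \<mu> * (tt ^ (m choose 2) * (qq ^ ?s \<mu> * ?G \<mu>))"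
      unfolding id rr sum_permute_longest ..
    also have "\<dots> = scale (tt ^ (m choose 2)) ?G \<mu>"
      by (simp add: scale_def field_simps)
    finally show "scale (qq ^ sum_list a * tt ^ inversions a) (subst_rev m (bar (m_macdonald a lam))) \<mu> =
      scale (tt ^ (m choose 2)) ?G \<mu>" .
  qed
qed

end
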